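(* Let $R$ be a Krull domain acted on by a group $G$ by ring automorphisms. Suppose that $$\mathrm{coh}\bigl(Z^1_R(G,\mathrm U(R))_{\rm e}\cap\widetilde Z^1_R(G,\mathrm U(R))\bigr)\subseteq\sum_{\lambda\in\Lambda}\mathbf Z_{\ge0}\cdot\mathrm{coh}(\lambda)$$ for a non-empty finite subset $\Lambda$ of $Z^1(G,\mathrm U(R))^R$, and suppose that $\widetilde{\mathrm{Cl}}(R,G)$ is a torsion group. Then $\widetilde{\mathrm{Cl}}(R,G)$ is a finite group. Moreover, if the subset $$\mathrm{coh}\bigl(Z^1(G,\mathrm U(R))_{R,0}\cap Z^1_R(G,\mathrm U(R))_{\rm e}\cap\widetilde Z^1_R(G,\mathrm U(R))\bigr)$$ of $H^1(G,\mathrm U(R))$ does not contain a non-trivial torsion element, then $$\exp(\mathrm{UrCl}(R,G))=\exp(\widetilde{\mathrm{Cl}}(R,G))<\infty.$$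
   Context: $R^G$ is a Krull domain. $\mathcal Q(\cdot)$ is the fraction field, $\mathrm U(R)$ the unit group, $\mathrm{Ht}_1(A)$ the set of height one primes of $A$; $\mathrm{Ht}_1^{(i)}(R,R^G)=\{\mathfrak P\in \mathrm{Ht}_1(R): \mathrm{ht}(\mathfrak P\cap R^G)=i\}$, $\mathrm{Ht}_1^{[2]}(R,R^G)=\bigcup_{i\ge2}\mathrm{Ht}_1^{(i)}(R,R^G)$; for $\mathfrak q\in\mathrm{Ht}_1(R^G)$, $X_{\mathfrak q}(R)=\{\mathfrak P\in\mathrm{Ht}_1(R):\mathfrak P\cap R^G=\mathfrak q\}$. $\mathrm v_{R,\mathfrak P}$ is the normalized discrete valuation and $\mathrm e(\mathfrak P,\mathfrak q)$ the ramification index ($\mathrm v_{R,\mathfrak P}=\mathrm e(\mathfrak P,\mathfrak q)\,\mathrm v_{R^G,\mathfrak q}$ on $\mathcal Q(R^G)^\times$). $\mathrm{Div}(R)$ is the free abelian group on the prime divisors $\mathrm{div}_R(\mathfrak P)$, $\mathfrak P\in\mathrm{Ht}_1(R)$, and $\mathrm{div}_R(f)=\sum_{\mathfrak P} \mathrm v_{R,\mathfrak P}(f)\,\mathrm{div}_R(\mathfrak P)$. $Z^1(G,\mathrm U(R))$ is the group of 1-cocycles, written additively; $\mathrm{coh}:Z^1(G,\mathrm U(R))\to H^1(G,\mathrm U(R))$ is the canonical map. For a cocycle $\chi$, $R_\chi=\{x\in R:\sigma(x)=\chi(\sigma)x\ \forall\sigma\in G\}$. Put $Z^1(G,\mathrm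 U(R))^R=\{\chi: R_\chi\ne0\}$; $Z^1(G,\mathrm U(R))_R=\{\chi\in Z^1(G,\mathrm U(R))^R:\dim_{\mathcal Q(R^G)}\mathcal Q(R^G)\otimes_{R^G}R_\chi=1\}$; $Z^1_R(G,\mathrm U(R))_{(2)}=\{\chi\in -Z^1(G,\mathrm U(R))^R: R_{-\chi}\not\subseteq\mathfrak P\ \forall\,\mathfrak P\in\mathrm{Ht}_1^{[2]}(R,R^G)\}$; $\widetilde Z^1_R(G,\mathrm U(R))=Z^1_R(G,\mathrm U(R))_{(2)}\cap(-Z^1_R(G,\mathrm U(R))_{(2)})$; $Z^1_R(G,\mathrm U(R))_{\rm e}$ is the set of $\chi\in Z^1(G,\mathrm U(R))^R$ such that for every $\mathfrak P\in\mathrm{Ht}_1^{(1)}(R,R^G)$ there is a nonzero $f_{\mathfrak P}\in R_\chi$ with $\mathrm v_{R,\mathfrak P}(f_{\mathfrak P})\equiv0 \bmod \mathrm e(\mathfrak P,\mathfrak P\cap R^G)$. Let $E^*(G,R)\subseteq\mathrm{Div}(R)$ be the subgroup generated by $\sum_{\mathfrak P\in X_{\mathfrak q}(R)}\mathrm e(\mathfrak P,\mathfrak q)\,\mathrm{div}_R(\mathfrak P)$ ($\mathfrak q\in\mathrm{Ht}_1(R^G)$) and by $\mathrm{div}_R(\mathfrak P)$ ($\mathfrak P\in\mathrm{Ht}_1^{[2]}(R,R^G)$). An effective divisor $D$ is minimal effective relative to $(R^G,R)$ if $D=D_1+D_2$ with $0\le D_1\in E^*(G,R)$, $0\le D_2\in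 \mathrm{Div}(R)$ forces $D_1=0$. For $\chi\in Z^1(G,\mathrm U(R))_R$ (which contains $\widetilde Z^1_R(G,\mathrm U(R))$), $D(\chi)$ is the unique minimal effective divisor relative to $(R^G,R)$ with $0\le\mathrm{div}_R(f)-D(\chi)\in E^*(G,R)$ for a nonzero $f\in R_\chi$ (independent of $f$). For such $\chi$, $R_\chi$ is $R^G$-isomorphic to an ideal $I$ of $R^G$, unique up to multiplication by a nonzero element of $\mathcal Q(R^G)$; $[R_\chi]\in\mathrm{Cl}(R^G)$ is the class of the divisorial hull of $I$. Put $Z^1(G,\mathrm U(R))_{R,0}=\{\delta\in Z^1(G,\mathrm U(R))_R:D(\delta)=0\}$. $\mathrm{UrCl}(R,G)\subseteq\mathrm{Cl}(R)$ is the subgroup generated by the $[D(\chi)]$, and $\widetilde{\mathrm{Cl}}(R,G)\subseteq\mathrm{Cl}(R^G)$ the subgroup generated by the $[R_\chi]$, for $\chi\in Z^1_R(G,\mathrm U(R))_{\rm e}\cap\widetilde Z^1_R(G,\mathrm U(R))$. $\exp$ denotes the exponent of a group. *)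

theory Defs
  imports
    "HOL-Algebra.Algebra"
    "HOL-Algebra.Algebraic_Closure_Type"
    "HOL-Library.Extended_Nat"
    "HOL-Number_Theory.Cong"
begin

text \<open>
  A commutative domain is given as a subring \<open>A\<close> of a field (a type of class \<open>field\<close>), for
  example of its own field of fractions.  All fractions with numerator and denominator in \<open>A\<close> are
  then elements of that type, and it need not consist of such fractions only.
\<close>

abbreviation rng :: "'k::field set \<Rightarrow> 'k ring" where
  "rng A \<equiv> ring_of_type_algebra\<lparr>carrier := A\<rparr>"

section \<open>Krull domains\<close>

definition loc :: "'k::field set \<Rightarrow> 'k set \<Rightarrow> 'k set" where
  "loc A p = {a / b | a b. a \<in> A \<and> b \<in> A - p}"

definition frac_field :: "'k::field set \<Rightarrow> 'k set" where
  "frac_field A = {a / b | a b. a \<in> A \<and> b \<in> A - {0}}"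

text \<open>The height is \<open>\<infinity>\<close> if there are chains of primes of unbounded length below \<open>p\<close>.\<close>

definition ht :: "'k::field set \<Rightarrow> 'k set \<Rightarrow> enat" where
  "ht A p = Sup {enat n | n. \<exists>c :: nat \<Rightarrow> 'k set.
      (\<forall>i\<le>n. primeideal (c i) (rng A)) \<and> (\<forall>i<n. c i \<subset> c (Suc i)) \<and> c n = p}"

definition Ht1 :: "'k::field set \<Rightarrow> 'k set set" where
  "Ht1 A = {p. primeideal p (rng A) \<and> ht A p = 1}"

definition dvr :: "'k::field set \<Rightarrow> bool" where
  "dvr V \<longleftrightarrow> principal_domain (rng V) \<and> (\<exists>!m. maximalideal m (rng V)) \<and> \<not> field (rng V)"

definition krull_domain :: "'k::field set \<Rightarrow> bool" where
  "krull_domain A \<longleftrightarrow>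
     subring A ring_of_type_algebra \<and>
     (\<forall>p\<in>Ht1 A. dvr (loc A p)) \<and>
     A = {x \<in> frac_field A. \<forall>p\<in>Ht1 A. x \<in> loc A p} \<and>
     (\<forall>x\<in>A - {0}. finite {p \<in> Ht1 A. x \<in> p})"

text \<open>
  The normalized discrete valuation attached to \<open>p \<in> Ht1 A\<close>: here \<open>t\<close> is a uniformizer of the
  discrete valuation ring \<open>loc A p\<close>.  The value at \<open>0\<close> is irrelevant.
\<close>

definition val :: "'k::field set \<Rightarrow> 'k set \<Rightarrow> 'k \<Rightarrow> int" where
  "val A p x = (THE n. \<exists>t\<in>loc A p. \<exists>u\<in>Units (rng (loc A p)).
      maximalideal (PIdl\<^bsub>rng (loc A p)\<^esub> t) (rng (loc A p)) \<and> x = u * t powi n)"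

section \<open>Divisors and divisor class groups\<close>

definition Div :: "'k::field set \<Rightarrow> ('k set \<Rightarrow>\<^sub>0 int) monoid" where
  "Div A = free_Abelian_group (Ht1 A)"

definition effective :: "('b \<Rightarrow>\<^sub>0 int) \<Rightarrow> bool" where
  "effective D \<longleftrightarrow> (\<forall>p. 0 \<le> Poly_Mapping.lookup D p)"

definition pdiv :: "'k::field set \<Rightarrow> 'k \<Rightarrow> ('k set \<Rightarrow>\<^sub>0 int)" where
  "pdiv A f = Abs_poly_mapping (\<lambda>p. if p \<in> Ht1 A then val A p f else 0)"

definition Prin :: "'k::field set \<Rightarrow> ('k set \<Rightarrow>\<^sub>0 int) set" where
  "Prin A = pdiv A ` (frac_field A - {0})"

definition Cl :: "'k::field set \<Rightarrow> ('k set \<Rightarrow>\<^sub>0 int) set monoid" where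
  "Cl A = Div A Mod Prin A"

definition div_class :: "'k::field set \<Rightarrow> ('k set \<Rightarrow>\<^sub>0 int) \<Rightarrow> ('k set \<Rightarrow>\<^sub>0 int) set" where
  "div_class A D = Prin A #>\<^bsub>Div A\<^esub> D"

text \<open>The divisorial hull \<open>A : (A : I)\<close>, formed in the fraction field.\<close>

definition divisorial_hull :: "'k::field set \<Rightarrow> 'k set \<Rightarrow> 'k set" where
  "divisorial_hull A I =
     {x \<in> frac_field A. \<forall>y\<in>frac_field A. (\<forall>z\<in>I. y * z \<in> A) \<longrightarrow> x * y \<in> A}"

text \<open>
  Nonzero divisorial fractional ideals \<open>J\<close> are identified with divisors as usual: the coefficient
  at \<open>p\<close> is the minimum of the \<open>p\<close>-adic valuation on \<open>J - {0}\<close>.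
\<close>

definition ideal_div :: "'k::field set \<Rightarrow> 'k set \<Rightarrow> ('k set \<Rightarrow>\<^sub>0 int)" where
  "ideal_div A J = Abs_poly_mapping (\<lambda>p. if p \<in> Ht1 A then Inf (val A p ` (J - {0})) else 0)"

text \<open>
  For a submodule \<open>M\<close> of the ambient field isomorphic to a nonzero ideal \<open>I\<close> of \<open>A\<close>: the class of
  the divisorial hull of \<open>I\<close>.
\<close>

definition module_class :: "'k::field set \<Rightarrow> 'k set \<Rightarrow> ('k set \<Rightarrow>\<^sub>0 int) set" where
  "module_class A M = (THE c. \<exists>I h. ideal I (rng A) \<and> bij_betw h M I \<and>
      (\<forall>x\<in>M. \<forall>y\<in>M. h (x + y) = h x + h y) \<and> (\<forall>r\<in>A. \<forall>x\<in>M. h (r * x) = r * h x) \<and>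
      c = div_class A (ideal_div A (divisorial_hull A I)))"

section \<open>Extension of scalars to the fraction field\<close>

text \<open>
  The tensor product of \<open>F = frac_field A\<close> with the \<open>A\<close>-module \<open>M\<close> over \<open>A\<close> is the free abelian
  group on \<open>F \<times> M\<close> modulo the subgroup \<open>tensor_rel A M\<close>.
\<close>

definition tensor_rel :: "'k::field set \<Rightarrow> 'k set \<Rightarrow> ('k \<times> 'k \<Rightarrow>\<^sub>0 int) set" where
  "tensor_rel A M = generate (free_Abelian_group (frac_field A \<times> M))
     ({frag_of (a + b, x) - frag_of (a, x) - frag_of (b, x) | a b x.
         a \<in> frac_field A \<and> b \<in> frac_field A \<and> x \<in> M} \<union>
      {frag_of (a, x + y) - frag_of (a, x) - frag_of (a, y) | a x y.
         a \<in> frac_field A \<and> x \<in> M \<and> y \<in> M} \<union>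
      {frag_of (a * r, x) - frag_of (a, r * x) | a r x.
         a \<in> frac_field A \<and> r \<in> A \<and> x \<in> M})"

definition tensor_class ::
    "'k::field set \<Rightarrow> 'k set \<Rightarrow> ('k \<times> 'k \<Rightarrow>\<^sub>0 int) \<Rightarrow> ('k \<times> 'k \<Rightarrow>\<^sub>0 int) set" where
  "tensor_class A M z = tensor_rel A M #>\<^bsub>free_Abelian_group (frac_field A \<times> M)\<^esub> z"

text \<open>
  The tensor product has dimension one over \<open>frac_field A\<close>: some nonzero element spans it.  The
  scalar \<open>c\<close> acts by sending the pure tensor of \<open>a\<close> and \<open>x\<close> to that of \<open>c * a\<close> and \<open>x\<close>.
\<close>

definition rank_one :: "'k::field set \<Rightarrow> 'k set \<Rightarrow> bool" where
  "rank_one A M \<longleftrightarrow>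
     (\<exists>z\<in>carrier (free_Abelian_group (frac_field A \<times> M)).
        tensor_class A M z \<noteq> tensor_class A M 0 \<and>
        (\<forall>w\<in>carrier (free_Abelian_group (frac_field A \<times> M)). \<exists>c\<in>frac_field A.
           tensor_class A M w =
           tensor_class A M (frag_extend (\<lambda>(a, x). frag_of (c * a, x)) z)))"

section \<open>Torsion and exponent of groups\<close>

definition torsion_element :: "('a, 'm) monoid_scheme \<Rightarrow> 'a \<Rightarrow> bool" where
  "torsion_element H x \<longleftrightarrow> x \<in> carrier H \<and> (\<exists>n::nat. 0 < n \<and> x [^]\<^bsub>H\<^esub> n = \<one>\<^bsub>H\<^esub>)"

definition torsion_group :: "('a, 'm) monoid_scheme \<Rightarrow> bool" where
  "torsion_group H \<longleftrightarrow> (\<forall>x\<in>carrier H. torsion_element H x)"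

text \<open>The exponent is \<open>\<infinity>\<close> if no positive integer annihilates the group.\<close>

definition group_exponent :: "('a, 'm) monoid_scheme \<Rightarrow> enat" where
  "group_exponent H = Inf {enat n | n. 0 < n \<and> (\<forall>x\<in>carrier H. x [^]\<^bsub>H\<^esub> n = \<one>\<^bsub>H\<^esub>)}"

section \<open>Group actions, cocycles and relative invariants\<close>

definition ring_action ::
    "('g, 'm) monoid_scheme \<Rightarrow> ('g \<Rightarrow> 'k \<Rightarrow> 'k) \<Rightarrow> 'k::field set \<Rightarrow> bool" where
  "ring_action G act R \<longleftrightarrow>
     group_action G R act \<and> (\<forall>\<sigma>\<in>carrier G. act \<sigma> \<in> ring_iso (rng R) (rng R))"

definition fixed_ring ::
    "('g, 'm) monoid_scheme \<Rightarrow> ('g \<Rightarrow> 'k \<Rightarrow> 'k) \<Rightarrow> 'k::field set \<Rightarrow> 'k set" where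
  "fixed_ring G act R = {x \<in> R. \<forall>\<sigma>\<in>carrier G. act \<sigma> x = x}"

text \<open>
  The group of 1-cocycles with values in the unit group, written multiplicatively: the sum and the
  negative of cocycles are the product and \<open>m_inv\<close> in \<open>Z1 G act R\<close>.
\<close>

definition Z1 ::
    "('g, 'm) monoid_scheme \<Rightarrow> ('g \<Rightarrow> 'k \<Rightarrow> 'k) \<Rightarrow> 'k::field set \<Rightarrow> ('g \<Rightarrow> 'k) monoid" where
  "Z1 G act R =
     \<lparr>carrier = {\<chi> \<in> carrier G \<rightarrow>\<^sub>E Units (rng R).
        \<forall>\<sigma>\<in>carrier G. \<forall>\<tau>\<in>carrier G. \<chi> (\<sigma> \<otimes>\<^bsub>G\<^esub> \<tau>) = \<chi> \<sigma> * act \<sigma> (\<chi> \<tau>)},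
      monoid.mult = (\<lambda>\<chi> \<psi>. \<lambda>\<sigma>\<in>carrier G. \<chi> \<sigma> * \<psi> \<sigma>),
      one = (\<lambda>\<sigma>\<in>carrier G. 1)\<rparr>"

definition B1 ::
    "('g, 'm) monoid_scheme \<Rightarrow> ('g \<Rightarrow> 'k \<Rightarrow> 'k) \<Rightarrow> 'k::field set \<Rightarrow> ('g \<Rightarrow> 'k) set" where
  "B1 G act R = {\<lambda>\<sigma>\<in>carrier G. act \<sigma> u / u | u. u \<in> Units (rng R)}"

definition H1 ::
    "('g, 'm) monoid_scheme \<Rightarrow> ('g \<Rightarrow> 'k \<Rightarrow> 'k) \<Rightarrow> 'k::field set \<Rightarrow> ('g \<Rightarrow> 'k) set monoid" where
  "H1 G act R = Z1 G act R Mod B1 G act R"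

definition coh ::
    "('g, 'm) monoid_scheme \<Rightarrow> ('g \<Rightarrow> 'k \<Rightarrow> 'k) \<Rightarrow> 'k::field set \<Rightarrow> ('g \<Rightarrow> 'k) \<Rightarrow> ('g \<Rightarrow> 'k) set"
  where "coh G act R \<chi> = B1 G act R #>\<^bsub>Z1 G act R\<^esub> \<chi>"

definition semi_inv ::
    "('g, 'm) monoid_scheme \<Rightarrow> ('g \<Rightarrow> 'k \<Rightarrow> 'k) \<Rightarrow> 'k::field set \<Rightarrow> ('g \<Rightarrow> 'k) \<Rightarrow> 'k set" where
  "semi_inv G act R \<chi> = {x \<in> R. \<forall>\<sigma>\<in>carrier G. act \<sigma> x = \<chi> \<sigma> * x}"

section \<open>Ramification in the extension \<open>S \<subseteq> R\<close>\<close>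

definition Ht1_over :: "'k::field set \<Rightarrow> 'k set \<Rightarrow> enat \<Rightarrow> 'k set set" where
  "Ht1_over R S i = {P \<in> Ht1 R. ht S (P \<inter> S) = i}"

text \<open>Contractions of infinite height are included here.\<close>

definition Ht1_ge2 :: "'k::field set \<Rightarrow> 'k set \<Rightarrow> 'k set set" where
  "Ht1_ge2 R S = (\<Union>i\<in>{2..}. Ht1_over R S i)"

definition primes_over :: "'k::field set \<Rightarrow> 'k set \<Rightarrow> 'k set \<Rightarrow> 'k set set" where
  "primes_over R S q = {P \<in> Ht1 R. P \<inter> S = q}"

definition ram_index :: "'k::field set \<Rightarrow> 'k set \<Rightarrow> 'k set \<Rightarrow> 'k set \<Rightarrow> nat" where
  "ram_index R S P q = (THE e. \<forall>x\<in>frac_field S - {0}. val R P x = int e * val S q x)"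

definition Estar :: "'k::field set \<Rightarrow> 'k set \<Rightarrow> ('k set \<Rightarrow>\<^sub>0 int) set" where
  "Estar R S = generate (Div R)
     ((\<lambda>q. \<Sum>P\<in>primes_over R S q. frag_cmul (int (ram_index R S P q)) (frag_of P)) ` Ht1 S \<union>
      frag_of ` Ht1_ge2 R S)"

definition minimal_effective :: "'k::field set \<Rightarrow> 'k set \<Rightarrow> ('k set \<Rightarrow>\<^sub>0 int) \<Rightarrow> bool" where
  "minimal_effective R S D \<longleftrightarrow> D \<in> carrier (Div R) \<and> effective D \<and>
     (\<forall>D1 D2. D1 \<in> Estar R S \<and> effective D1 \<and> D2 \<in> carrier (Div R) \<and> effective D2 \<and>
        D = D1 + D2 \<longrightarrow> D1 = 0)"

section \<open>Distinguished sets of cocycles\<close>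

definition Z1_up ::
    "('g, 'm) monoid_scheme \<Rightarrow> ('g \<Rightarrow> 'k \<Rightarrow> 'k) \<Rightarrow> 'k::field set \<Rightarrow> ('g \<Rightarrow> 'k) set" where
  "Z1_up G act R = {\<chi> \<in> carrier (Z1 G act R). semi_inv G act R \<chi> \<noteq> {0}}"

definition Z1_down ::
    "('g, 'm) monoid_scheme \<Rightarrow> ('g \<Rightarrow> 'k \<Rightarrow> 'k) \<Rightarrow> 'k::field set \<Rightarrow> ('g \<Rightarrow> 'k) set" where
  "Z1_down G act R = {\<chi> \<in> Z1_up G act R. rank_one (fixed_ring G act R) (semi_inv G act R \<chi>)}"

definition Z1_2 ::
    "('g, 'm) monoid_scheme \<Rightarrow> ('g \<Rightarrow> 'k \<Rightarrow> 'k) \<Rightarrow> 'k::field set \<Rightarrow> ('g \<Rightarrow> 'k) set" where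
  "Z1_2 G act R = {\<chi> \<in> m_inv (Z1 G act R) ` Z1_up G act R.
     \<forall>P\<in>Ht1_ge2 R (fixed_ring G act R). \<not> semi_inv G act R (inv\<^bsub>Z1 G act R\<^esub> \<chi>) \<subseteq> P}"

definition Z1_tilde ::
    "('g, 'm) monoid_scheme \<Rightarrow> ('g \<Rightarrow> 'k \<Rightarrow> 'k) \<Rightarrow> 'k::field set \<Rightarrow> ('g \<Rightarrow> 'k) set" where
  "Z1_tilde G act R = Z1_2 G act R \<inter> m_inv (Z1 G act R) ` Z1_2 G act R"

definition Z1_e ::
    "('g, 'm) monoid_scheme \<Rightarrow> ('g \<Rightarrow> 'k \<Rightarrow> 'k) \<Rightarrow> 'k::field set \<Rightarrow> ('g \<Rightarrow> 'k) set" where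
  "Z1_e G act R = {\<chi> \<in> Z1_up G act R.
     \<forall>P\<in>Ht1_over R (fixed_ring G act R) 1. \<exists>f\<in>semi_inv G act R \<chi>. f \<noteq> 0 \<and>
       [val R P f = 0] (mod int (ram_index R (fixed_ring G act R) P (P \<inter> fixed_ring G act R)))}"

definition Dchi ::
    "('g, 'm) monoid_scheme \<Rightarrow> ('g \<Rightarrow> 'k \<Rightarrow> 'k) \<Rightarrow> 'k::field set \<Rightarrow> ('g \<Rightarrow> 'k) \<Rightarrow> ('k set \<Rightarrow>\<^sub>0 int)"
  where
  "Dchi G act R \<chi> = (THE D. minimal_effective R (fixed_ring G act R) D \<and>
     (\<exists>f\<in>semi_inv G act R \<chi>. f \<noteq> 0 \<and> effective (pdiv R f - D) \<and>
        pdiv R f - D \<in> Estar R (fixed_ring G act R)))"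

definition Z1_down0 ::
    "('g, 'm) monoid_scheme \<Rightarrow> ('g \<Rightarrow> 'k \<Rightarrow> 'k) \<Rightarrow> 'k::field set \<Rightarrow> ('g \<Rightarrow> 'k) set" where
  "Z1_down0 G act R = {\<delta> \<in> Z1_down G act R. Dchi G act R \<delta> = 0}"

section \<open>The two class groups\<close>

definition UrCl ::
    "('g, 'm) monoid_scheme \<Rightarrow> ('g \<Rightarrow> 'k \<Rightarrow> 'k) \<Rightarrow> 'k::field set \<Rightarrow> ('k set \<Rightarrow>\<^sub>0 int) set monoid"
  where
  "UrCl G act R = subgroup_generated (Cl R)
     ((\<lambda>\<chi>. div_class R (Dchi G act R \<chi>)) ` (Z1_e G act R \<inter> Z1_tilde G act R))"

definition Cl_tilde ::
    "('g, 'm) monoid_scheme \<Rightarrow> ('g \<Rightarrow> 'k \<Rightarrow> 'k) \<Rightarrow> 'k::field set \<Rightarrow> ('k set \<Rightarrow>\<^sub>0 int) set monoid"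
  where
  "Cl_tilde G act R = subgroup_generated (Cl (fixed_ring G act R))
     ((\<lambda>\<chi>. module_class (fixed_ring G act R) (semi_inv G act R \<chi>)) `
        (Z1_e G act R \<inter> Z1_tilde G act R))"

end

theory Submission
  imports Defs
begin

text \<open>
  Put \<open>S = R\<^sup>G\<close>. For \<open>\<chi>\<close> in the distinguished set of cocycles, nonzero elements of \<open>R\<^sub>\<chi>\<close> differ by
  factors in the fraction field of \<open>S\<close>, and the divisor of \<open>f \<in> R\<^sub>\<chi>\<close> over \<open>q \<in> Ht1 S\<close> is \<open>D(\<chi>)\<close> plus \<open>c(q, f)\<close> times
  the ramified sum of the primes over \<open>q\<close>. Localizing at \<open>q\<close> shows that some \<open>f\<close> has \<open>c(q, f) = 0\<close>, so
  \<open>[R\<^sub>\<chi>]\<close> is the class of the divisor with coefficients \<open>- c(q, f)\<close>. Hence \<open>m [R\<^sub>\<chi>] = 0\<close> if and only if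
  \<open>m D(\<chi>)\<close> is the divisor of an element of \<open>R\<^bsub>m\<chi>\<^esub>\<close>, and the condition on torsion makes this
  equivalent to \<open>m [D(\<chi>)] = 0\<close>. Finiteness holds because, up to units, \<open>R\<^sub>\<chi>\<close> contains a product of powers
  of finitely many fixed elements, so that all classes \<open>[R\<^sub>\<chi>]\<close> lie in a finitely generated group.
\<close>

section \<open>Subrings of a field and their prime ideals\<close>

text \<open>The group is arbitrary and acts on \<open>R\<close> alone, so neither integrality of
  \<open>R\<close> over the invariants nor a norm is at hand. What survives is that \<open>S\<close>
  contains every element of \<open>R\<close> lying in its fraction field \<open>K\<close>; this is
  the hypothesis of \<open>krull_pair\<close>, and the Krull property of \<open>S\<close> and the
  ramification indices are derived from it. By their contraction to \<open>S\<close>, the height one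
  primes \<open>P\<close> of \<open>R\<close> fall into three kinds: zero, where nonzero elements of
  \<open>K\<close> have value 0; height one, where \<open>v P\<close> restricts to a multiple of a
  valuation of \<open>S\<close>; and height at least two, which no divisor of \<open>S\<close> sees.
  The last kind is the obstacle when a relation in \<open>Cl S\<close> is lifted to
  \<open>R\<close>. The values there are pinned down from both sides by a relative invariant of
  \<chi> and one of the inverse of \<chi>, both outside \<open>P\<close>, and this is what
  \<open>Z1_tilde\<close> supplies. Exponents can be compared one cocycle at a time, since both
  class groups are generated by families over the same index set.\<close>

lemma ring_of_type_algebra_simps [simp]:
  "carrier ring_of_type_algebra = UNIV" "x \<otimes>\<^bsub>ring_of_type_algebra\<^esub> y = x * y"
  "x \<oplus>\<^bsub>ring_of_type_algebra\<^esub> y = x + y" "\<one>\<^bsub>ring_of_type_algebra\<^esub> = 1" "\<zero>\<^bsub>ring_of_type_algebra\<^esub> = 0"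
  by (simp_all add: ring_of_type_algebra_def)

lemma rng_simps [simp]:
  "carrier (rng A) = A" "x \<otimes>\<^bsub>rng A\<^esub> y = x * y" "x \<oplus>\<^bsub>rng A\<^esub> y = x + y"
  "\<one>\<^bsub>rng A\<^esub> = 1" "\<zero>\<^bsub>rng A\<^esub> = 0"
  by (simp_all add: ring_of_type_algebra_def)

lemma Units_rng: "Units (rng A) = {x \<in> A. x \<noteq> 0 \<and> inverse x \<in> A}"
proof -
  have "x \<noteq> 0 \<and> inverse x \<in> A" if "x \<in> A" "y \<in> A" "x * y = 1" for x y :: 'a
    using that inverse_unique[of x y] by auto
  moreover have "x \<in> Units (rng A)" if "x \<in> A" "x \<noteq> 0" "inverse x \<in> A" for x
    unfolding Units_def using that by (auto intro!: bexI[of _ "inverse x"])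
  ultimately show ?thesis
    by (auto simp only: Units_def rng_simps)
qed

locale subdomain =
  fixes A :: "'k::field set"
  assumes is_subring: "subring A ring_of_type_algebra"
begin

lemma rng_domain: "domain (rng A)"
proof -
  interpret K: field "ring_of_type_algebra :: 'k ring"
    by (rule field_from_type_algebra)
  show ?thesis
    using K.subring_is_domain[OF is_subring] .
qed

lemma rng_ring: "ring (rng A)" and rng_cring: "cring (rng A)"
  using rng_domain by (simp_all add: domain_def cring_def)

lemma zero_mem [simp]: "0 \<in> A" and one_mem [simp]: "1 \<in> A"
  using subringE[OF is_subring] by (auto simp: ring_of_type_algebra_def)

lemma add_mem: "x \<in> A \<Longrightarrow> y \<in> A \<Longrightarrow> x + y \<in> A"
  and mult_mem: "x \<in> A \<Longrightarrow> y \<in> A \<Longrightarrow> x * y \<in> A"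
  using subringE[OF is_subring] by (auto simp: ring_of_type_algebra_def)

lemma uminus_ring_of_type_algebra: "\<ominus>\<^bsub>ring_of_type_algebra\<^esub> x = - (x :: 'k)"
proof -
  interpret K: field "ring_of_type_algebra :: 'k ring"
    by (rule field_from_type_algebra)
  show ?thesis
    by (rule K.minus_equality) (simp_all add: ring_of_type_algebra_def)
qed

lemma uminus_mem: "x \<in> A \<Longrightarrow> - x \<in> A"
  using subringE(5)[OF is_subring] by (simp add: uminus_ring_of_type_algebra)

lemma power_mem: "x \<in> A \<Longrightarrow> x ^ n \<in> A"
  by (induction n) (auto intro: mult_mem)

lemma prod_mem: "(\<And>i. i \<in> I \<Longrightarrow> f i \<in> A) \<Longrightarrow> prod f I \<in> A"
  by (induction I rule: infinite_finite_induct) (auto intro: mult_mem)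

lemma ideal_iff:
  "ideal I (rng A) \<longleftrightarrow> I \<subseteq> A \<and> 0 \<in> I \<and> (\<forall>x\<in>I. \<forall>y\<in>I. x + y \<in> I) \<and> (\<forall>a\<in>A. \<forall>x\<in>I. a * x \<in> I)"
    (is "?l \<longleftrightarrow> ?r")
proof
  assume I: ?l
  note sub = ideal.axioms(1)[OF I]
  show ?r
    using additive_subgroup.a_subset[OF sub] additive_subgroup.zero_closed[OF sub]
      additive_subgroup.a_closed[OF sub] ideal.I_l_closed[OF I] by simp
next
  assume r: ?r
  have neg: "- x \<in> I" if "x \<in> I" for x
  proof -
    have "- 1 * x \<in> I" using r that uminus_mem[OF one_mem] by blast
    then show ?thesis by simp
  qed
  have "inv\<^bsub>add_monoid (rng A)\<^esub> x \<in> I" if "x \<in> I" for x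
  proof -
    have "- x \<in> I" "- x \<in> A" "x \<in> A" using r that neg by blast+
    moreover have "inv\<^bsub>add_monoid (rng A)\<^esub> x = - x"
      using abelian_group.minus_equality[OF ring.is_abelian_group[OF rng_ring], of "- x" x] calculation
      by (simp add: a_inv_def)
    ultimately show ?thesis by simp
  qed
  then have "subgroup I (add_monoid (rng A))"
    using r by (intro subgroup.intro) auto
  moreover have "x * a \<in> I" "a * x \<in> I" if "a \<in> I" "x \<in> A" for a x
    using r that by (auto simp: mult.commute[of a x])
  ultimately show ?l
    by (intro idealI rng_ring) simp_all
qed

definition prime_of :: "'k set \<Rightarrow> bool" where
  "prime_of p \<longleftrightarrow> ideal p (rng A) \<and> 1 \<notin> p \<and> (\<forall>a\<in>A. \<forall>b\<in>A. a * b \<in> p \<longrightarrow> a \<in> p \<or> b \<in> p)"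

lemma primeideal_iff: "primeideal p (rng A) \<longleftrightarrow> prime_of p"
proof
  assume p: "primeideal p (rng A)"
  have "1 \<notin> p"
    using ideal.one_imp_carrier[OF primeideal.axioms(1)[OF p]] primeideal.I_notcarr[OF p] by auto
  then show "prime_of p"
    using primeideal.I_prime[OF p] primeideal.axioms(1)[OF p] by (simp add: prime_of_def)
next
  assume "prime_of p"
  then show "primeideal p (rng A)"
    by (intro primeidealI rng_cring) (auto simp: prime_of_def)
qed

lemma prime_ofD:
  assumes "prime_of p"
  shows "p \<subseteq> A" "0 \<in> p" "1 \<notin> p" "x \<in> p \<Longrightarrow> y \<in> p \<Longrightarrow> x + y \<in> p" "a \<in> A \<Longrightarrow> x \<in> p \<Longrightarrow> a * x \<in> p"
    "a \<in> A \<Longrightarrow> b \<in> A \<Longrightarrow> a * b \<in> p \<Longrightarrow> a \<in> p \<or> b \<in> p"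
  using assms by (auto simp: prime_of_def ideal_iff)

lemma prime_of_zero: "prime_of {0}"
  by (auto simp: prime_of_def ideal_iff)

lemma prime_power_mem: "prime_of p \<Longrightarrow> x \<in> A \<Longrightarrow> x ^ n \<in> p \<Longrightarrow> x \<in> p"
proof (induction n)
  case (Suc n)
  then show ?case using prime_ofD(6)[of p x "x ^ n"] power_mem by auto
qed (auto dest: prime_ofD)

lemma prime_prod_mem:
  assumes "prime_of p" "finite I" "\<And>i. i \<in> I \<Longrightarrow> f i \<in> A" "prod f I \<in> p"
  shows "\<exists>i\<in>I. f i \<in> p"
  using assms(2-4)
proof (induction I rule: finite_induct)
  case empty
  then show ?case using prime_ofD(3)[OF assms(1)] by simp
next
  case (insert i I)
  then show ?case using prime_ofD(6)[OF assms(1), of "f i" "prod f I"] prod_mem[of I f] by auto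
qed

text \<open>Dual to avoiding a union of primes: one element of each \<open>Q\<close> outside
  \<open>p\<close> is chosen, and the product of these stays outside because \<open>p\<close> is
  prime.\<close>

lemma prime_avoidance:
  assumes "prime_of p" "finite T" "\<And>Q. Q \<in> T \<Longrightarrow> ideal Q (rng A) \<and> \<not> Q \<subseteq> p"
  obtains s where "s \<in> A" "s \<notin> p" "\<And>Q. Q \<in> T \<Longrightarrow> s \<in> Q"
proof -
  have "\<exists>x. x \<in> Q - p" if "Q \<in> T" for Q
    using assms(3)[OF that] by blast
  then obtain x where x: "\<And>Q. Q \<in> T \<Longrightarrow> x Q \<in> Q - p"
    by metis
  have xA: "x Q \<in> A" if "Q \<in> T" for Q
    using x[OF that] assms(3)[OF that] by (auto simp: ideal_iff)
  show thesis
  proof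
    show "prod x T \<in> A" using xA by (rule prod_mem)
    show "prod x T \<notin> p" using prime_prod_mem[OF assms(1,2), of x] xA x by blast
    show "prod x T \<in> Q" if "Q \<in> T" for Q
    proof -
      have "prod x T = prod x (T - {Q}) * x Q"
        using assms(2) that by (subst prod.remove[of _ Q]) (auto simp: mult.commute)
      moreover have "prod x (T - {Q}) \<in> A" by (rule prod_mem) (use xA in auto)
      ultimately show ?thesis using assms(3)[OF that] x[OF that] by (auto simp: ideal_iff)
    qed
  qed
qed

section \<open>Heights and primes of height one\<close>

lemma ht_ge:
  assumes "\<forall>i\<le>n. prime_of (c i)" "\<forall>i<n. c i \<subset> c (Suc i)" "c n = p"
  shows "enat n \<le> ht A p"
  unfolding ht_def primeideal_iff using assms by (intro Sup_upper) blast

lemma ht_ge_1: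
  assumes "prime_of p" "p \<noteq> {0}"
  shows "1 \<le> ht A p"
proof -
  have "{0} \<subset> p" using assms prime_ofD(2)[OF assms(1)] by blast
  then have "enat 1 \<le> ht A p"
    using assms by (intro ht_ge[of 1 "\<lambda>i. if i = 0 then {0} else p"]) (auto simp: prime_of_zero)
  then show ?thesis by (simp add: one_enat_def)
qed

lemma ht_ge_2:
  assumes "prime_of p" "prime_of p'" "p' \<noteq> {0}" "p' \<subset> p"
  shows "2 \<le> ht A p"
proof -
  have "{0} \<subset> p'" using assms prime_ofD(2)[OF assms(2)] by blast
  then have "enat 2 \<le> ht A p"
    using assms by (intro ht_ge[of 2 "\<lambda>i. if i = 0 then {0} else if i = 1 then p' else p"])
      (auto simp: prime_of_zero less_2_cases_iff)
  then show ?thesis by (simp add: numeral_eq_enat)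
qed

text \<open>A longer chain can be cut at its lower end, so excluding chains of length exactly
  \<open>n\<close> bounds the supremum. The alternative \<open>n = 0\<close> is kept because nothing
  in \<open>enat\<close> lies below 0.\<close>

lemma ht_le_cases:
  assumes "\<forall>c. \<not> ((\<forall>i\<le>n. prime_of (c i)) \<and> (\<forall>i<n. c i \<subset> c (Suc i)) \<and> c n = p)"
  shows "ht A p < enat n \<or> n = 0"
proof (cases n)
  case (Suc m)
  have "k \<le> m" if "\<forall>i\<le>k. prime_of (c i)" "\<forall>i<k. c i \<subset> c (Suc i)" "c k = p" for k c
  proof (rule ccontr)
    assume "\<not> k \<le> m"
    then have "n \<le> k" using Suc by simp
    then show False
      using assms[rule_format, of "\<lambda>i. c (i + (k - n))"] that by (auto simp: less_diff_conv)
  qed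
  then have "ht A p \<le> enat m"
    unfolding ht_def primeideal_iff by (intro Sup_least) auto
  then show ?thesis using Suc by (auto intro: order_le_less_trans)
qed simp

lemma ht_eq_0_iff: "prime_of p \<Longrightarrow> ht A p = 0 \<longleftrightarrow> p = {0}"
proof -
  assume p: "prime_of p"
  have "ht A {0} < enat 1 \<or> (1::nat) = 0"
  proof (rule ht_le_cases, safe)
    fix c :: "nat \<Rightarrow> 'k set"
    assume "\<forall>i\<le>1. prime_of (c i)" "\<forall>i<1. c i \<subset> c (Suc i)" "c 1 = {0}"
    then show False using prime_ofD(2)[of "c 0"] by auto
  qed
  then have "ht A {0} = 0" by (cases "ht A {0}") (auto simp: zero_enat_def)
  then show ?thesis using ht_ge_1[OF p] by (cases "p = {0}") auto
qed

text \<open>The zero ideal is prime in a domain, so a chain of length two below \<open>p\<close>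
  exists exactly when some nonzero prime lies strictly inside \<open>p\<close>. This replaces the
  supremum in \<open>ht\<close> by minimality.\<close>

lemma Ht1_iff:
  "p \<in> Ht1 A \<longleftrightarrow> prime_of p \<and> p \<noteq> {0} \<and> (\<forall>p'. prime_of p' \<and> p' \<subseteq> p \<longrightarrow> p' = {0} \<or> p' = p)"
    (is "?l \<longleftrightarrow> ?r")
proof
  assume ?l
  then have p: "prime_of p" and h: "ht A p = 1" by (auto simp: Ht1_def primeideal_iff)
  have "\<not> 2 \<le> ht A p" using h by (simp add: one_enat_def numeral_eq_enat)
  then show ?r using p h ht_eq_0_iff[OF p] ht_ge_2[OF p] by auto
next
  assume r: ?r
  have "ht A p < enat 2 \<or> (2::nat) = 0"
  proof (rule ht_le_cases, safe)
    fix c :: "nat \<Rightarrow> 'k set"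
    assume c: "\<forall>i\<le>2. prime_of (c i)" "\<forall>i<2. c i \<subset> c (Suc i)" "p = c 2"
    have "c 0 \<subset> c 1" "c 1 \<subset> p"
      using c(2)[rule_format, of 0] c(2)[rule_format, of 1] c(3) by (simp_all add: numeral_2_eq_2)
    moreover have "prime_of (c 0)" "prime_of (c 1)" using c(1) by simp_all
    moreover have "0 \<in> c 0" by (rule prime_ofD(2)) fact
    ultimately show False using r by blast
  qed
  then have "ht A p < 2" by (simp add: numeral_eq_enat)
  moreover have "1 \<le> ht A p" using r ht_ge_1 by blast
  ultimately have "ht A p = 1"
    by (cases "ht A p") (auto simp: one_enat_def numeral_eq_enat)
  then show ?l using r by (simp add: Ht1_def primeideal_iff)
qed

lemma Ht1_prime: "p \<in> Ht1 A \<Longrightarrow> prime_of p"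
  by (simp add: Ht1_iff)

lemma Ht1_incomparable: "p \<in> Ht1 A \<Longrightarrow> p' \<in> Ht1 A \<Longrightarrow> p \<subseteq> p' \<Longrightarrow> p = p'"
  using Ht1_iff by metis

section \<open>The fraction field and localizations at primes\<close>

abbreviation Fr :: "'k set" where "Fr \<equiv> frac_field A"

lemma frac_fieldI: "a \<in> A \<Longrightarrow> b \<in> A \<Longrightarrow> b \<noteq> 0 \<Longrightarrow> a / b \<in> Fr"
  by (auto simp: frac_field_def)

lemma frac_fieldE:
  assumes "x \<in> Fr"
  obtains a b where "a \<in> A" "b \<in> A" "b \<noteq> 0" "x = a / b"
  using assms by (auto simp: frac_field_def)

lemma mem_frac: "a \<in> A \<Longrightarrow> a \<in> Fr"
  using frac_fieldI[of a 1] by simp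

lemma frac_mult: "x \<in> Fr \<Longrightarrow> y \<in> Fr \<Longrightarrow> x * y \<in> Fr"
  by (elim frac_fieldE) (auto intro!: frac_fieldI mult_mem)

lemma frac_inverse: "x \<in> Fr \<Longrightarrow> inverse x \<in> Fr"
  by (elim frac_fieldE) (metis divide_inverse frac_fieldI inverse_divide inverse_zero mult_zero_right zero_mem one_mem
      mem_frac)

lemma frac_divide: "x \<in> Fr \<Longrightarrow> y \<in> Fr \<Longrightarrow> x / y \<in> Fr"
  by (simp add: divide_inverse frac_mult frac_inverse)

lemma frac_power: "x \<in> Fr \<Longrightarrow> x ^ n \<in> Fr"
  by (induction n) (auto intro: frac_mult mem_frac)

lemma frac_powi: "x \<in> Fr \<Longrightarrow> x powi n \<in> Fr"
  by (auto simp: power_int_def intro: frac_power frac_inverse)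

lemma frac_add: "x \<in> Fr \<Longrightarrow> y \<in> Fr \<Longrightarrow> x + y \<in> Fr"
proof (elim frac_fieldE)
  fix a b c d assume "a \<in> A" "b \<in> A" "b \<noteq> 0" "x = a / b" "c \<in> A" "d \<in> A" "d \<noteq> 0" "y = c / d"
  then have "x + y = (a * d + c * b) / (b * d)" by (simp add: add_frac_eq)
  then show ?thesis using \<open>a \<in> A\<close> \<open>b \<in> A\<close> \<open>c \<in> A\<close> \<open>d \<in> A\<close> \<open>b \<noteq> 0\<close> \<open>d \<noteq> 0\<close>
    by (auto intro!: frac_fieldI add_mem mult_mem)
qed

lemma locI: "a \<in> A \<Longrightarrow> b \<in> A \<Longrightarrow> b \<notin> p \<Longrightarrow> a / b \<in> loc A p"
  by (auto simp: loc_def)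

lemma locE:
  assumes "x \<in> loc A p"
  obtains a b where "a \<in> A" "b \<in> A" "b \<notin> p" "x = a / b"
  using assms by (auto simp: loc_def)

lemma subset_loc: "prime_of p \<Longrightarrow> A \<subseteq> loc A p"
  using locI[of _ 1 p] prime_ofD(3) by fastforce

lemma loc_subset: "prime_of p \<Longrightarrow> loc A p \<subseteq> Fr"
  using prime_ofD(2) by (fastforce elim: locE intro: frac_fieldI)

lemma loc_subring:
  assumes "prime_of p"
  shows "subring (loc A p) ring_of_type_algebra"
proof -
  interpret K: field "ring_of_type_algebra :: 'k ring"
    by (rule field_from_type_algebra)
  have ab: "a * b \<notin> p" if "a \<in> A" "b \<in> A" "a \<notin> p" "b \<notin> p" for a b
    using prime_ofD(6)[OF assms] that by blast
  have 0: "b \<noteq> 0" if "b \<notin> p" for b using that prime_ofD(2)[OF assms] by auto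
  show ?thesis
  proof (rule K.subringI)
    show "loc A p \<subseteq> carrier ring_of_type_algebra" by (simp add: ring_of_type_algebra_def)
    show "\<one>\<^bsub>ring_of_type_algebra\<^esub> \<in> loc A p"
      using subset_loc[OF assms] by (auto simp: ring_of_type_algebra_def)
    show "\<ominus>\<^bsub>ring_of_type_algebra\<^esub> h \<in> loc A p" if "h \<in> loc A p" for h
      using that unfolding uminus_ring_of_type_algebra
      by (elim locE) (metis locI minus_divide_left uminus_mem)
    fix x y assume "x \<in> loc A p" "y \<in> loc A p"
    then obtain a b c d where h: "a \<in> A" "b \<in> A" "b \<notin> p" "x = a / b" "c \<in> A" "d \<in> A" "d \<notin> p" "y = c / d"
      by (elim locE) blast
    then have "x * y = (a * c) / (b * d)" "x + y = (a * d + c * b) / (b * d)"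
      using 0[of b] 0[of d] by (auto simp: add_frac_eq)
    then show "x \<otimes>\<^bsub>ring_of_type_algebra\<^esub> y \<in> loc A p" "x \<oplus>\<^bsub>ring_of_type_algebra\<^esub> y \<in> loc A p"
      using h ab by (auto simp: ring_of_type_algebra_def intro!: locI mult_mem add_mem)
  qed
qed

end

section \<open>Discrete valuations\<close>

text \<open>A normalized discrete valuation with ring \<open>loc A p\<close>, described without the
  definite description in \<open>val\<close>. The inequality for sums is encoded in
  \<open>loc A p\<close> being closed under addition; the value at 0 is left free, as it is in
  \<open>val\<close>.\<close>

definition is_val :: "'k::field set \<Rightarrow> 'k set \<Rightarrow> ('k \<Rightarrow> int) \<Rightarrow> bool" where
  "is_val A p v \<longleftrightarrow>
     (\<forall>x\<in>frac_field A - {0}. \<forall>y\<in>frac_field A - {0}. v (x * y) = v x + v y) \<and>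
     (\<exists>t\<in>frac_field A - {0}. v t = 1) \<and>
     (\<forall>x\<in>frac_field A - {0}. x \<in> loc A p \<longleftrightarrow> 0 \<le> v x)"

context subdomain
begin

context
  fixes p v
  assumes v: "is_val A p v" and p: "prime_of p"
begin

lemma is_val_mult: "x \<in> Fr \<Longrightarrow> x \<noteq> 0 \<Longrightarrow> y \<in> Fr \<Longrightarrow> y \<noteq> 0 \<Longrightarrow> v (x * y) = v x + v y"
  using v by (simp add: is_val_def)

lemma is_val_one: "v 1 = 0"
  using is_val_mult[of 1 1] mem_frac by simp

lemma is_val_inverse: "x \<in> Fr \<Longrightarrow> x \<noteq> 0 \<Longrightarrow> v (inverse x) = - v x"
  using is_val_mult[of x "inverse x"] is_val_one frac_inverse by simp

lemma is_val_divide: "x \<in> Fr \<Longrightarrow> x \<noteq> 0 \<Longrightarrow> y \<in> Fr \<Longrightarrow> y \<noteq> 0 \<Longrightarrow> v (x / y) = v x - v y"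
  by (simp add: divide_inverse is_val_mult is_val_inverse frac_inverse)

lemma is_val_power: "x \<in> Fr \<Longrightarrow> x \<noteq> 0 \<Longrightarrow> v (x ^ n) = int n * v x"
  by (induction n) (simp_all add: is_val_one is_val_mult frac_power algebra_simps)

lemma is_val_powi: "x \<in> Fr \<Longrightarrow> x \<noteq> 0 \<Longrightarrow> v (x powi n) = n * v x"
  by (simp add: power_int_def is_val_power is_val_inverse frac_inverse)

lemma is_val_loc: "x \<in> Fr \<Longrightarrow> x \<noteq> 0 \<Longrightarrow> x \<in> loc A p \<longleftrightarrow> 0 \<le> v x"
  using v by (simp add: is_val_def)

lemma is_val_nonneg: "x \<in> A \<Longrightarrow> x \<noteq> 0 \<Longrightarrow> 0 \<le> v x"
  using is_val_loc[of x] mem_frac subset_loc[OF p] by blast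

lemma is_val_pos_iff:
  assumes "x \<in> A" "x \<noteq> 0"
  shows "0 < v x \<longleftrightarrow> x \<in> p"
proof -
  have "inverse x \<in> loc A p \<longleftrightarrow> x \<notin> p"
  proof
    assume "inverse x \<in> loc A p"
    then obtain a b where ab: "a \<in> A" "b \<in> A" "b \<notin> p" "inverse x = a / b" by (rule locE)
    have "b \<noteq> 0" using ab prime_ofD(2)[OF p] by auto
    then have "b = a * x" using ab assms by (simp add: field_simps)
    then show "x \<notin> p" using ab prime_ofD(5)[OF p] by blast
  qed (use locI[of 1 x p] assms in \<open>simp add: inverse_eq_divide\<close>)
  moreover have "inverse x \<in> loc A p \<longleftrightarrow> v x \<le> 0"
    using is_val_loc[of "inverse x"] is_val_inverse[of x] assms mem_frac frac_inverse by simp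
  ultimately show ?thesis by auto
qed

lemma Units_loc: "Units (rng (loc A p)) = {x \<in> Fr. x \<noteq> 0 \<and> v x = 0}"
proof -
  have "x \<in> Fr" if "x \<in> loc A p" for x using that loc_subset[OF p] by blast
  then show ?thesis
    unfolding Units_rng using is_val_loc is_val_inverse frac_inverse
    by (fastforce simp: frac_inverse)
qed

text \<open>\<open>val\<close> describes uniformizers as generators of a maximal ideal; here they
  become the elements of value 1. The elements of value at least 1 form an ideal \<open>m\<close>
  with only units outside, so a proper principal ideal lies in \<open>m\<close>, and a maximal one
  equals it.\<close>

lemma maximal_PIdl_iff:
  assumes t: "t \<in> loc A p"
  shows "maximalideal (PIdl\<^bsub>rng (loc A p)\<^esub> t) (rng (loc A p)) \<longleftrightarrow> t \<noteq> 0 \<and> v t = 1"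
proof -
  interpret V: subdomain "loc A p"
    by (rule subdomain.intro[OF loc_subring[OF p]])
  have VFr: "x \<in> Fr" if "x \<in> loc A p" for x using that loc_subset[OF p] by blast
  define m where "m = {x \<in> Fr. x = 0 \<or> 1 \<le> v x}"
  have PIdl: "PIdl\<^bsub>rng (loc A p)\<^esub> s = {x * s | x. x \<in> loc A p}" for s
    by (simp add: cgenideal_def)
  have m_eq: "PIdl\<^bsub>rng (loc A p)\<^esub> s = m" if s: "s \<in> loc A p" "s \<noteq> 0" "v s = 1" for s
  proof (intro equalityI subsetI)
    fix y assume "y \<in> PIdl\<^bsub>rng (loc A p)\<^esub> s"
    then obtain x where "x \<in> loc A p" "y = x * s" by (auto simp: PIdl)
    then show "y \<in> m"
      using s is_val_mult[of x s] is_val_loc[of x] VFr by (auto simp: m_def frac_mult)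
  next
    fix y assume y: "y \<in> m"
    have "y / s \<in> loc A p"
    proof (cases "y = 0")
      case False
      then show ?thesis using y s VFr is_val_loc[of "y / s"]
        by (auto simp: m_def is_val_divide frac_divide)
    qed simp
    then show "y \<in> PIdl\<^bsub>rng (loc A p)\<^esub> s" unfolding PIdl using s(2) by force
  qed
  obtain t0 where t0: "t0 \<in> Fr" "t0 \<noteq> 0" "v t0 = 1"
    using v by (auto simp: is_val_def)
  then have t0V: "t0 \<in> loc A p" using is_val_loc by simp
  have m_ideal: "ideal m (rng (loc A p))"
    using cring.cgenideal_ideal[OF V.rng_cring, of t0] m_eq[of t0] t0 t0V by simp
  have one: "1 \<notin> m" by (simp add: m_def is_val_one)
  have m_max: "maximalideal m (rng (loc A p))"
  proof (rule maximalidealI[OF m_ideal])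
    show "carrier (rng (loc A p)) \<noteq> m" using one V.one_mem by (metis rng_simps(1))
    fix J assume J: "ideal J (rng (loc A p))" "m \<subseteq> J" "J \<subseteq> carrier (rng (loc A p))"
    show "J = m \<or> J = carrier (rng (loc A p))"
    proof (rule disjCI)
      assume "J \<noteq> carrier (rng (loc A p))"
      then have 1: "1 \<notin> J" using ideal.one_imp_carrier[OF J(1)] by auto
      have "x \<in> m" if x: "x \<in> J" for x
      proof (rule ccontr)
        assume xm: "x \<notin> m"
        have xV: "x \<in> loc A p" using x J(3) by auto
        then have "x \<noteq> 0" "v x = 0" using xm is_val_loc[of x] VFr[of x] by (auto simp: m_def)
        then have "inverse x \<in> loc A p"
          using xV VFr is_val_loc[of "inverse x"] by (simp add: is_val_inverse frac_inverse)
        then have "inverse x * x \<in> J" using J(1) x by (simp add: V.ideal_iff)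
        then show False using 1 \<open>x \<noteq> 0\<close> by simp
      qed
      then show "J = m" using J(2) by blast
    qed
  qed
  show ?thesis
  proof
    assume M: "maximalideal (PIdl\<^bsub>rng (loc A p)\<^esub> t) (rng (loc A p))"
    then have ne: "loc A p \<noteq> PIdl\<^bsub>rng (loc A p)\<^esub> t"
      using maximalideal.I_notcarr[OF M] by simp
    have sub: "PIdl\<^bsub>rng (loc A p)\<^esub> t \<subseteq> m"
    proof
      fix y assume "y \<in> PIdl\<^bsub>rng (loc A p)\<^esub> t"
      then obtain x where x: "x \<in> loc A p" "y = x * t" by (auto simp: PIdl)
      show "y \<in> m"
      proof (rule ccontr)
        assume "y \<notin> m"
        have yV: "y \<in> loc A p" using x t V.mult_mem by simp
        then have y: "y \<noteq> 0" "v y = 0"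
          using \<open>y \<notin> m\<close> is_val_loc[of y] VFr[of y] by (auto simp: m_def)
        then have iy: "inverse y \<in> loc A p"
          using yV VFr is_val_loc[of "inverse y"] by (simp add: is_val_inverse frac_inverse)
        have "z \<in> PIdl\<^bsub>rng (loc A p)\<^esub> t" if "z \<in> loc A p" for z
        proof -
          have "z = z * (inverse y * y)" using y by simp
          then have "z = (z * inverse y * x) * t" by (simp only: x(2) mult.assoc)
          moreover have "z * inverse y * x \<in> loc A p" using that iy x V.mult_mem by blast
          ultimately show ?thesis unfolding PIdl by blast
        qed
        moreover have "PIdl\<^bsub>rng (loc A p)\<^esub> t \<subseteq> loc A p"
          using t V.mult_mem by (auto simp: PIdl)
        ultimately show False using ne by blast
      qed
    qed
    have mV: "m \<subseteq> carrier (rng (loc A p))" using m_ideal by (simp add: V.ideal_iff)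
    have "m = PIdl\<^bsub>rng (loc A p)\<^esub> t \<or> m = carrier (rng (loc A p))"
      using maximalideal.I_maximal[OF M m_ideal sub mV] .
    moreover have "m \<noteq> carrier (rng (loc A p))" using one V.one_mem by (metis rng_simps(1))
    ultimately have eq: "m = PIdl\<^bsub>rng (loc A p)\<^esub> t" by blast
    \<comment> \<open>\<open>t0\<close> has value 1 and is a multiple of \<open>t\<close>; as
      \<open>v t\<close> is at least 1 and the cofactor has nonnegative value,
      \<open>v t = 1\<close>.\<close>
    have "t0 \<in> m" using t0 by (simp add: m_def)
    then obtain x where x: "x \<in> loc A p" "t0 = x * t" unfolding eq by (auto simp: PIdl)
    have "t \<noteq> 0" "x \<noteq> 0" using x t0 by auto
    moreover have "t \<in> m" unfolding eq PIdl using V.one_mem by force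
    moreover have "v t0 = v x + v t" using x calculation VFr t by (simp add: is_val_mult)
    moreover have "0 \<le> v x" using is_val_loc[of x] x VFr[of x] \<open>x \<noteq> 0\<close> by simp
    ultimately show "t \<noteq> 0 \<and> v t = 1" using t0 by (auto simp: m_def)
  next
    assume "t \<noteq> 0 \<and> v t = 1"
    then show "maximalideal (PIdl\<^bsub>rng (loc A p)\<^esub> t) (rng (loc A p))"
      using m_eq[of t] t m_max by simp
  qed
qed

text \<open>To control the definite description it suffices to exhibit one function satisfying
  \<open>is_val\<close>: dividing \<open>x\<close> by the right power of a uniformizer leaves a
  unit, and any such factorization reveals its exponent through \<open>v\<close>.\<close>

lemma val_eq:
  assumes x: "x \<in> Fr" "x \<noteq> 0"
  shows "val A p x = v x"
  unfolding val_def
proof (rule the_equality)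
  have LF: "t \<in> Fr" if "t \<in> loc A p" for t using loc_subset[OF p] that by blast
  obtain t where t: "t \<in> Fr" "t \<noteq> 0" "v t = 1"
    using v by (auto simp: is_val_def)
  then have tV: "t \<in> loc A p" using is_val_loc by simp
  define u where "u = x / t powi v x"
  have "u \<in> Units (rng (loc A p))"
    using x t by (auto simp: Units_loc u_def is_val_divide is_val_powi frac_divide frac_powi power_int_eq_0_iff)
  moreover have "x = u * t powi v x" using t by (simp add: u_def)
  ultimately show "\<exists>t\<in>loc A p. \<exists>u\<in>Units (rng (loc A p)).
      maximalideal (PIdl\<^bsub>rng (loc A p)\<^esub> t) (rng (loc A p)) \<and> x = u * t powi v x"
    using tV t maximal_PIdl_iff[OF tV] by blast
  fix n
  assume "\<exists>t\<in>loc A p. \<exists>u\<in>Units (rng (loc A p)).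
      maximalideal (PIdl\<^bsub>rng (loc A p)\<^esub> t) (rng (loc A p)) \<and> x = u * t powi n"
  then obtain t u where "t \<in> loc A p" "t \<noteq> 0" "v t = 1" "u \<in> Fr" "u \<noteq> 0" "v u = 0" "x = u * t powi n"
    using maximal_PIdl_iff by (auto simp: Units_loc)
  then show "n = v x"
    using LF[of t] by (simp add: is_val_mult is_val_powi frac_powi power_int_eq_0_iff)
qed

end

lemma is_val_val:
  assumes "is_val A p v" "prime_of p"
  shows "is_val A p (val A p)"
proof -
  have e: "val A p x = v x" if "x \<in> Fr - {0}" for x
    using that by (intro val_eq[OF assms]) simp_all
  have "val A p (x * y) = val A p x + val A p y" if "x \<in> Fr - {0}" "y \<in> Fr - {0}" for x y
  proof -
    have "x * y \<in> Fr - {0}" using that frac_mult by simp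
    then show ?thesis using that assms(1) e by (simp add: is_val_def)
  qed
  moreover have "\<exists>t\<in>Fr - {0}. val A p t = 1"
  proof -
    obtain t where "t \<in> Fr - {0}" "v t = 1" using assms(1) unfolding is_val_def by blast
    then show ?thesis using e[of t] by (intro bexI[of _ t]) simp_all
  qed
  moreover have "x \<in> loc A p \<longleftrightarrow> 0 \<le> val A p x" if "x \<in> Fr - {0}" for x
    using e[OF that] assms(1) that unfolding is_val_def by simp
  ultimately show ?thesis unfolding is_val_def by blast
qed

end

text \<open>In a local principal ideal domain that is not a field, a generator \<open>t\<close> of
  the maximal ideal \<open>m\<close> is a nonzero nonunit, elements outside \<open>m\<close> are
  units, and no nonzero element is divisible by all powers of \<open>t\<close>. Dividing by
  \<open>t\<close> as long as possible therefore ends in a unit.\<close>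

lemma dvr_uniformizer:
  fixes V :: "'k::field set"
  assumes "dvr V"
  obtains t where "t \<in> V" "t \<noteq> 0" "inverse t \<notin> V"
    "\<And>x. x \<in> V \<Longrightarrow> x \<noteq> 0 \<Longrightarrow> \<exists>n. \<exists>u\<in>Units (rng V). x = u * t ^ n"
proof -
  have pd: "principal_domain (rng V)" and nf: "\<not> field (rng V)"
    using assms unfolding dvr_def by blast+
  obtain m where m: "maximalideal m (rng V)" and m_uniq: "\<And>m'. maximalideal m' (rng V) \<Longrightarrow> m' = m"
    using assms unfolding dvr_def by blast
  have dom: "domain (rng V)" using pd by (simp add: principal_domain_def)
  have cr: "cring (rng V)" using dom by (simp add: domain_def)
  have nd: "noetherian_domain (rng V)"
  proof -
    interpret P: principal_domain "rng V" by (rule pd)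
    show ?thesis by (rule P.noetherian_domain_axioms)
  qed
  have mul: "x * y \<in> V" if "x \<in> V" "y \<in> V" for x y
    using monoid.m_closed[of "rng V" x y] cr that by (simp add: cring_def ring_def)
  have one: "1 \<in> V" using monoid.one_closed[of "rng V"] cr by (simp add: cring_def ring_def)
  obtain t where t: "t \<in> V" "m = PIdl\<^bsub>rng V\<^esub> t"
    using principal_domain.exists_gen[OF pd maximalideal.axioms(1)[OF m]] by auto
  have m_eq: "m = {x * t | x. x \<in> V}" using t by (simp add: cgenideal_def)
  have t0: "t \<noteq> 0"
  proof
    assume "t = 0"
    then have "m = {0}" using one by (auto simp: m_eq)
    then show False using cring.zeromaximalideal_eq_field[OF cr] m nf by simp
  qed
  have tinv: "inverse t \<notin> V"
  proof
    assume "inverse t \<in> V"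
    then have "x \<in> m" if "x \<in> V" for x
      unfolding m_eq using that mul t0 by (intro CollectI exI[of _ "x * inverse t"]) simp
    moreover have "m \<subseteq> V" unfolding m_eq using t(1) mul by auto
    ultimately have "m = V" by blast
    then show False using maximalideal.I_notcarr[OF m] by simp
  qed
  have unit: "u \<in> Units (rng V)" if u: "u \<in> V" "u \<noteq> 0" "u \<notin> m" for u
  proof (rule ccontr)
    assume "u \<notin> Units (rng V)"
    \<comment> \<open>A nonunit has an irreducible divisor, which generates a maximal ideal, hence
      \<open>m\<close>; so \<open>u\<close> would lie in \<open>m\<close>.\<close>
    then obtain b where b: "b \<in> V" "ring_irreducible\<^bsub>rng V\<^esub> b" "b divides\<^bsub>rng V\<^esub> u"
      using noetherian_domain.exists_irreducible_divisor[OF nd, of u] u by auto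
    then have "PIdl\<^bsub>rng V\<^esub> b = m"
      using principal_domain.irreducible_imp_maximalideal[OF pd, of b] m_uniq by simp
    moreover obtain c where "c \<in> V" "u = c * b" using b by (auto simp: factor_def mult.commute)
    ultimately show False using u(3) by (auto simp: cgenideal_def)
  qed
  have ex: "\<exists>n. \<exists>y\<in>V. x = y * t ^ n \<and> y \<notin> m" if x: "x \<in> V" "x \<noteq> 0" for x
  proof (rule ccontr)
    assume no: "\<not> ?thesis"
    have all: "\<exists>y\<in>V. x = y * t ^ n" for n
    proof (induction n)
      case 0
      then show ?case using x by simp
    next
      case (Suc n)
      then obtain y where y: "y \<in> V" "x = y * t ^ n" by blast
      then have "y \<in> m" using no by blast
      then obtain z where "z \<in> V" "y = z * t" by (auto simp: m_eq)
      then show ?case using y by (intro bexI[of _ z]) (simp_all add: mult.assoc)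
    qed
    \<comment> \<open>The intersection of the ideals generated by the powers of \<open>t\<close>; it
      contains \<open>x\<close>. Its generator turns out to be \<open>t\<close> times an element of
      \<open>I\<close>, which would make \<open>t\<close> a unit.\<close>
    define I where "I = {z \<in> V. \<forall>n. \<exists>y\<in>V. z = y * t ^ n}"
    have "ideal I (rng V)"
    proof -
      interpret V: subdomain V
      proof (rule subdomain.intro)
        interpret K: field "ring_of_type_algebra :: 'k ring"
          by (rule field_from_type_algebra)
        show "subring V ring_of_type_algebra"
          using K.ring_incl_imp_subring[of V] cr by (simp add: cring_def)
      qed
      have "\<exists>y\<in>V. a + b = y * t ^ n" if "a \<in> I" "b \<in> I" for a b n
      proof -
        have "\<exists>y\<in>V. a = y * t ^ n" "\<exists>z\<in>V. b = z * t ^ n"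
          using that unfolding I_def by simp_all
        then obtain y z where "y \<in> V" "a = y * t ^ n" "z \<in> V" "b = z * t ^ n"
          by blast
        then show ?thesis
          by (intro bexI[of _ "y + z"]) (simp_all add: algebra_simps V.add_mem)
      qed
      moreover have "\<exists>y\<in>V. a * b = y * t ^ n" if "a \<in> V" "b \<in> I" for a b n
      proof -
        have "\<exists>z\<in>V. b = z * t ^ n" using that unfolding I_def by simp
        then obtain z where "z \<in> V" "b = z * t ^ n" by blast
        then show ?thesis
          using that mul by (intro bexI[of _ "a * z"]) (simp_all add: mult.assoc)
      qed
      moreover have "\<exists>y\<in>V. 0 = y * t ^ n" for n by (rule bexI[of _ 0]) simp_all
      ultimately show ?thesis
        unfolding V.ideal_iff I_def by (auto simp: V.add_mem V.mult_mem)
    qed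
    then obtain z where z: "z \<in> V" "I = PIdl\<^bsub>rng V\<^esub> z"
      using principal_domain.exists_gen[OF pd] by auto
    have I_eq: "I = {y * z | y. y \<in> V}" using z by (simp add: cgenideal_def)
    have xI: "x \<in> I" using all x by (simp add: I_def)
    have zI: "z \<in> I" unfolding I_eq using one by force
    have z0: "z \<noteq> 0" using xI x(2) by (auto simp: I_eq)
    obtain y where y: "y \<in> V" "z = y * t" using zI by (auto simp: I_def dest: spec[of _ 1])
    have "\<exists>w\<in>V. y = w * t ^ n" for n
    proof -
      obtain w where "w \<in> V" "z = w * t ^ Suc n" using zI by (auto simp: I_def simp del: power_Suc)
      then show ?thesis using y t0 by (intro bexI[of _ w]) simp_all
    qed
    then have "y \<in> I" using y by (simp add: I_def)
    then obtain c where "c \<in> V" "y = c * z" by (auto simp: I_eq)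
    then have "c * t = 1" "c \<in> V" using y z0 by (simp_all add: mult.assoc)
    then show False using tinv inverse_unique[of t c] by (simp add: mult.commute)
  qed
  show thesis
  proof (rule that[OF t(1) t0 tinv])
    fix x assume x: "x \<in> V" "x \<noteq> 0"
    then obtain n y where "y \<in> V" "x = y * t ^ n" "y \<notin> m" using ex by blast
    then show "\<exists>n. \<exists>u\<in>Units (rng V). x = u * t ^ n" using unit[of y] x by auto
  qed
qed

context subdomain
begin

text \<open>Each nonzero fraction is a unit of \<open>loc A p\<close> times an integer power of the
  uniformizer \<open>t\<close>. The exponent is unique because a negative power of \<open>t\<close>
  would bring \<open>inverse t\<close> into the ring; this exponent is the valuation.\<close>

lemma is_val_of_dvr:
  assumes d: "dvr (loc A p)" and p: "prime_of p"
  shows "\<exists>v. is_val A p v"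
proof -
  interpret V: subdomain "loc A p"
    by (rule subdomain.intro[OF loc_subring[OF p]])
  let ?V = "loc A p"
  let ?U = "Units (rng ?V)"
  obtain t where t: "t \<in> ?V" "t \<noteq> 0" "inverse t \<notin> ?V"
    and ex: "\<And>x. x \<in> ?V \<Longrightarrow> x \<noteq> 0 \<Longrightarrow> \<exists>n. \<exists>u\<in>?U. x = u * t ^ n"
    using dvr_uniformizer[OF d] by blast
  have U: "u * u' \<in> ?U" "inverse u \<in> ?U" if "u \<in> ?U" "u' \<in> ?U" for u u'
    using that by (auto simp: Units_rng V.mult_mem)
  have U1: "1 \<in> ?U" by (simp add: Units_rng)
  have UV: "u \<in> ?V" "u \<noteq> 0" if "u \<in> ?U" for u using that by (simp_all add: Units_rng)
  have ex': "\<exists>n. \<exists>u\<in>?U. x = u * t powi n" if x: "x \<in> Fr" "x \<noteq> 0" for x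
  proof -
    obtain a b where ab: "a \<in> A" "b \<in> A" "b \<noteq> 0" "x = a / b" using x(1) by (rule frac_fieldE)
    have "a \<in> ?V" "b \<in> ?V" using ab subset_loc[OF p] by auto
    moreover have "a \<noteq> 0" using ab x by auto
    ultimately obtain n u n' u' where h: "u \<in> ?U" "u' \<in> ?U" "a = u * t ^ n" "b = u' * t ^ n'"
      using ex[of a] ex[of b] ab(3) by blast
    then have "x = (u * inverse u') * t powi (int n - int n')"
      using ab t by (simp add: power_int_diff field_simps)
    then show ?thesis using h U by blast
  qed
  have neg: "0 \<le> n" if "u \<in> ?U" "u * t powi n \<in> ?V" for u n
  proof (rule ccontr)
    assume n: "\<not> 0 \<le> n"
    have "inverse u * (u * t powi n) \<in> ?V"
      using UV(1)[OF U(2)[OF that(1) that(1)]] that(2) by (rule V.mult_mem)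
    moreover have "inverse u * (u * t powi n) = t powi n"
      using UV(2)[OF that(1)] by (simp add: mult.assoc[symmetric])
    ultimately have "t powi n \<in> ?V" by simp
    \<comment> \<open>The complementary power that leaves exactly the exponent -1.\<close>
    moreover have "t ^ nat (- n - 1) \<in> ?V" using t V.power_mem by blast
    ultimately have "t powi n * t ^ nat (- n - 1) \<in> ?V" by (rule V.mult_mem)
    also have "t powi n * t ^ nat (- n - 1) = t powi (n + (- n - 1))"
      using n t by (subst power_int_add) (auto simp: power_int_def)
    finally show False using t by simp
  qed
  have uniq: "n = n'" if "u \<in> ?U" "u' \<in> ?U" "u * t powi n = u' * t powi n'" for u u' n n'
  proof -
    have "(u * inverse u') * t powi (n - n') = 1" "(u' * inverse u) * t powi (n' - n) = 1"
      using that t UV[of u] UV[of u'] by (auto simp: power_int_diff field_simps)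
    then have "(u * inverse u') * t powi (n - n') \<in> ?V" "(u' * inverse u) * t powi (n' - n) \<in> ?V"
      by simp_all
    then have "0 \<le> n - n'" "0 \<le> n' - n" using neg that U by blast+
    then show ?thesis by simp
  qed
  define v where "v x = (THE n. \<exists>u\<in>?U. x = u * t powi n)" for x
  have v: "v (u * t powi n) = n" if "u \<in> ?U" for u n
    unfolding v_def using that uniq by (intro the_equality) blast+
  have "v (x * y) = v x + v y" if xy: "x \<in> Fr - {0}" "y \<in> Fr - {0}" for x y
  proof -
    obtain n u n' u' where h: "u \<in> ?U" "u' \<in> ?U" "x = u * t powi n" "y = u' * t powi n'"
      using ex'[of x] ex'[of y] xy by blast
    have xy_eq: "x * y = (u * u') * t powi (n + n')" using h t by (simp add: power_int_add)
    have "v (x * y) = n + n'" unfolding xy_eq by (rule v[OF U(1)[OF h(1,2)]])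
    moreover have "v x = n" "v y = n'" unfolding h(3,4) using v h(1,2) by blast+
    ultimately show ?thesis by simp
  qed
  moreover have "v t = 1" using v[OF U1, of 1] by simp
  moreover have "t \<in> Fr - {0}" using t loc_subset[OF p] by blast
  moreover have "x \<in> ?V \<longleftrightarrow> 0 \<le> v x" if x: "x \<in> Fr - {0}" for x
  proof -
    obtain n u where h: "u \<in> ?U" "x = u * t powi n" using ex'[of x] x by blast
    have "x \<in> ?V" if "0 \<le> n"
    proof -
      have "t powi n = t ^ nat n" using that by (simp add: power_int_def)
      then show ?thesis using h UV V.mult_mem V.power_mem t by simp
    qed
    then show ?thesis using neg[of u n] h v by auto
  qed
  ultimately show ?thesis unfolding is_val_def by blast
qed

end

section \<open>Krull domains\<close>

lemma lookup_Abs_if: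
  assumes "finite {p \<in> Y. f p \<noteq> 0}"
  shows "Poly_Mapping.lookup (Abs_poly_mapping (\<lambda>p. if p \<in> Y then f p else 0)) q = (if q \<in> Y then f q else 0)"
proof -
  have "{p. (if p \<in> Y then f p else 0) \<noteq> 0} = {p \<in> Y. f p \<noteq> 0}" by auto
  then have "finite {p. (if p \<in> Y then f p else 0) \<noteq> 0}" using assms by simp
  then show ?thesis by (simp add: Abs_poly_mapping_inverse)
qed

text \<open>The Krull axioms restated through valuations. In this form they are also established for
  the ring of invariants, whose valuations come by restriction from \<open>R\<close> and not from a
  \<open>dvr\<close>.\<close>

locale krull = subdomain +
  assumes is_val: "p \<in> Ht1 A \<Longrightarrow> is_val A p (val A p)"
    and mem_if_nonneg: "x \<in> frac_field A \<Longrightarrow> x \<noteq> 0 \<Longrightarrow> (\<And>p. p \<in> Ht1 A \<Longrightarrow> 0 \<le> val A p x) \<Longrightarrow> x \<in> A"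
    and finite_mem: "x \<in> A \<Longrightarrow> x \<noteq> 0 \<Longrightarrow> finite {p \<in> Ht1 A. x \<in> p}"

lemma krull_domain_imp_krull:
  assumes "krull_domain A"
  shows "krull A"
proof -
  interpret subdomain A
    using assms by (simp add: subdomain_def krull_domain_def)
  have iv: "is_val A p (val A p)" if "p \<in> Ht1 A" for p
    using is_val_of_dvr[of p] is_val_val[of p] Ht1_prime[OF that] that assms
    unfolding krull_domain_def by blast
  show ?thesis
  proof unfold_locales
    show "is_val A p (val A p)" if "p \<in> Ht1 A" for p by (rule iv) fact
    show "finite {p \<in> Ht1 A. x \<in> p}" if "x \<in> A" "x \<noteq> 0" for x
      using assms that unfolding krull_domain_def by blast
    fix x assume x: "x \<in> Fr" "x \<noteq> 0" "\<And>p. p \<in> Ht1 A \<Longrightarrow> 0 \<le> val A p x"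
    then have "\<forall>p\<in>Ht1 A. x \<in> loc A p"
      using is_val_loc[OF iv Ht1_prime] by blast
    then show "x \<in> A" using assms x(1) unfolding krull_domain_def by blast
  qed
qed

context krull
begin

abbreviation v :: "'a set \<Rightarrow> 'a \<Rightarrow> int" where "v \<equiv> val A"

lemma v_mult: "p \<in> Ht1 A \<Longrightarrow> x \<in> Fr \<Longrightarrow> x \<noteq> 0 \<Longrightarrow> y \<in> Fr \<Longrightarrow> y \<noteq> 0 \<Longrightarrow> v p (x * y) = v p x + v p y"
  using is_val_mult[OF is_val Ht1_prime] by blast

lemma v_one: "p \<in> Ht1 A \<Longrightarrow> v p 1 = 0"
  using is_val_one[OF is_val Ht1_prime] by blast

lemma v_inverse: "p \<in> Ht1 A \<Longrightarrow> x \<in> Fr \<Longrightarrow> x \<noteq> 0 \<Longrightarrow> v p (inverse x) = - v p x"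
  using is_val_inverse[OF is_val Ht1_prime] by blast

lemma v_divide: "p \<in> Ht1 A \<Longrightarrow> x \<in> Fr \<Longrightarrow> x \<noteq> 0 \<Longrightarrow> y \<in> Fr \<Longrightarrow> y \<noteq> 0 \<Longrightarrow> v p (x / y) = v p x - v p y"
  using is_val_divide[OF is_val Ht1_prime] by blast

lemma v_power: "p \<in> Ht1 A \<Longrightarrow> x \<in> Fr \<Longrightarrow> x \<noteq> 0 \<Longrightarrow> v p (x ^ n) = int n * v p x"
  using is_val_power[OF is_val Ht1_prime] by blast

lemma v_nonneg: "p \<in> Ht1 A \<Longrightarrow> x \<in> A \<Longrightarrow> x \<noteq> 0 \<Longrightarrow> 0 \<le> v p x"
  using is_val_nonneg[OF is_val Ht1_prime] by blast

lemma v_pos_iff: "p \<in> Ht1 A \<Longrightarrow> x \<in> A \<Longrightarrow> x \<noteq> 0 \<Longrightarrow> 0 < v p x \<longleftrightarrow> x \<in> p"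
  using is_val_pos_iff[OF is_val Ht1_prime] by blast

lemma v_zero_iff: "p \<in> Ht1 A \<Longrightarrow> x \<in> A \<Longrightarrow> x \<noteq> 0 \<Longrightarrow> v p x = 0 \<longleftrightarrow> x \<notin> p"
  using v_pos_iff[of p x] v_nonneg[of p x] by linarith

lemma v_uniformizer:
  assumes "p \<in> Ht1 A"
  obtains t where "t \<in> Fr" "t \<noteq> 0" "v p t = 1"
  using is_val[OF assms] by (auto simp: is_val_def)

lemma v_prod:
  assumes "p \<in> Ht1 A" "\<And>i. i \<in> I \<Longrightarrow> f i \<in> A \<and> f i \<noteq> 0"
  shows "v p (\<Prod>i\<in>I. f i) = (\<Sum>i\<in>I. v p (f i))"
  using assms(2)
proof (induction I rule: infinite_finite_induct)
  case (insert i I)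
  have "(\<Prod>i\<in>I. f i) \<in> Fr" using prod_mem[of I f] insert mem_frac by blast
  moreover have "(\<Prod>i\<in>I. f i) \<noteq> 0" using insert by simp
  ultimately show ?case using insert assms(1) mem_frac by (simp add: v_mult)
qed (simp_all add: v_one assms(1))

lemma Unit_if_v_zero:
  assumes "x \<in> Fr" "x \<noteq> 0" "\<And>p. p \<in> Ht1 A \<Longrightarrow> v p x = 0"
  shows "x \<in> Units (rng A)"
  unfolding Units_rng using assms mem_if_nonneg[of x] mem_if_nonneg[of "inverse x"]
  by (simp add: v_inverse frac_inverse)

lemma v_Unit: "u \<in> Units (rng A) \<Longrightarrow> p \<in> Ht1 A \<Longrightarrow> v p u = 0"
  using v_nonneg[of p u] v_nonneg[of p "inverse u"] v_inverse[of p u] mem_frac[of u]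
  by (simp add: Units_rng)

lemma finite_support:
  assumes "x \<in> Fr" "x \<noteq> 0"
  shows "finite {p \<in> Ht1 A. v p x \<noteq> 0}"
proof -
  obtain a b where ab: "a \<in> A" "b \<in> A" "b \<noteq> 0" "x = a / b"
    using assms(1) by (rule frac_fieldE)
  have a: "a \<noteq> 0" using ab assms(2) by auto
  have "p \<in> {p \<in> Ht1 A. a \<in> p} \<union> {p \<in> Ht1 A. b \<in> p}" if "p \<in> Ht1 A" "v p x \<noteq> 0" for p
  proof (rule ccontr)
    assume "\<not> ?thesis"
    then have "v p a = 0" "v p b = 0" using v_zero_iff that(1) ab a by auto
    then show False using that ab a mem_frac by (simp add: v_divide)
  qed
  then have "{p \<in> Ht1 A. v p x \<noteq> 0} \<subseteq> {p \<in> Ht1 A. a \<in> p} \<union> {p \<in> Ht1 A. b \<in> p}" by blast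
  moreover have "finite ({p \<in> Ht1 A. a \<in> p} \<union> {p \<in> Ht1 A. b \<in> p})"
    using finite_mem[OF ab(1) a] finite_mem[OF ab(2,3)] by simp
  ultimately show ?thesis by (rule finite_subset)
qed

section \<open>Principal divisors and the divisor class group\<close>

lemma lookup_pdiv:
  assumes "x \<in> Fr" "x \<noteq> 0"
  shows "Poly_Mapping.lookup (pdiv A x) p = (if p \<in> Ht1 A then v p x else 0)"
  unfolding pdiv_def using finite_support[OF assms] by (rule lookup_Abs_if)

lemma pdiv_Div: "x \<in> Fr \<Longrightarrow> x \<noteq> 0 \<Longrightarrow> pdiv A x \<in> carrier (Div A)"
  by (auto simp: Div_def in_keys_iff lookup_pdiv split: if_splits)

lemma pdiv_mult: "x \<in> Fr \<Longrightarrow> x \<noteq> 0 \<Longrightarrow> y \<in> Fr \<Longrightarrow> y \<noteq> 0 \<Longrightarrow> pdiv A (x * y) = pdiv A x + pdiv A y"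
  by (rule poly_mapping_eqI) (simp add: lookup_add lookup_pdiv v_mult frac_mult)

lemma pdiv_divide: "x \<in> Fr \<Longrightarrow> x \<noteq> 0 \<Longrightarrow> y \<in> Fr \<Longrightarrow> y \<noteq> 0 \<Longrightarrow> pdiv A (x / y) = pdiv A x - pdiv A y"
  by (rule poly_mapping_eqI) (simp add: lookup_minus lookup_pdiv v_divide frac_divide)

lemma pdiv_power: "x \<in> Fr \<Longrightarrow> x \<noteq> 0 \<Longrightarrow> pdiv A (x ^ n) = frag_cmul (int n) (pdiv A x)"
  by (rule poly_mapping_eqI) (simp add: lookup_pdiv v_power frac_power)

lemma pdiv_one: "pdiv A 1 = 0"
  by (rule poly_mapping_eqI) (simp add: lookup_pdiv mem_frac v_one)

lemma pdiv_inverse: "x \<in> Fr \<Longrightarrow> x \<noteq> 0 \<Longrightarrow> pdiv A (inverse x) = - pdiv A x"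
  by (rule poly_mapping_eqI) (simp add: lookup_pdiv v_inverse frac_inverse)

lemma Div_group: "comm_group (Div A)"
  by (simp add: Div_def abelian_free_Abelian_group)

lemma Div_simps [simp]:
  "D \<in> carrier (Div A) \<longleftrightarrow> Poly_Mapping.keys D \<subseteq> Ht1 A" "x \<otimes>\<^bsub>Div A\<^esub> y = x + y" "\<one>\<^bsub>Div A\<^esub> = 0"
  by (simp_all add: Div_def)

lemma Div_pow: "D \<in> carrier (Div A) \<Longrightarrow> D [^]\<^bsub>Div A\<^esub> (n::nat) = frag_cmul (int n) D"
  by (simp add: Div_def)

lemma Div_inv: "D \<in> carrier (Div A) \<Longrightarrow> inv\<^bsub>Div A\<^esub> D = - D"
  by (simp add: Div_def)

lemma Prin_iff: "D \<in> Prin A \<longleftrightarrow> (\<exists>x\<in>Fr. x \<noteq> 0 \<and> D = pdiv A x)"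
  by (auto simp: Prin_def)

lemma Prin_subgroup: "subgroup (Prin A) (Div A)"
proof (rule subgroup.intro)
  show "Prin A \<subseteq> carrier (Div A)" using pdiv_Div by (auto simp: Prin_iff simp del: Div_simps)
  show "\<one>\<^bsub>Div A\<^esub> \<in> Prin A" unfolding Prin_iff by (intro bexI[of _ 1]) (simp_all add: pdiv_one mem_frac)
  show "x \<otimes>\<^bsub>Div A\<^esub> y \<in> Prin A" if xy: "x \<in> Prin A" "y \<in> Prin A" for x y
  proof -
    obtain a b where "a \<in> Fr" "a \<noteq> 0" "x = pdiv A a" "b \<in> Fr" "b \<noteq> 0" "y = pdiv A b"
      using xy by (auto simp: Prin_iff)
    then show ?thesis unfolding Prin_iff
      by (intro bexI[of _ "a * b"]) (simp_all add: pdiv_mult frac_mult)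
  qed
  show "inv\<^bsub>Div A\<^esub> x \<in> Prin A" if x: "x \<in> Prin A" for x
  proof -
    obtain a where a: "a \<in> Fr" "a \<noteq> 0" "x = pdiv A a"
      using x by (auto simp: Prin_iff)
    have "inv\<^bsub>Div A\<^esub> x = - x" using a pdiv_Div by (intro Div_inv) simp
    then show ?thesis unfolding Prin_iff using a
      by (intro bexI[of _ "inverse a"]) (simp_all add: pdiv_inverse frac_inverse)
  qed
qed

lemma Prin_normal: "Prin A \<lhd> Div A"
  using comm_group.subgroup_imp_normal[OF Div_group Prin_subgroup] .

lemma Cl_group: "comm_group (Cl A)"
  unfolding Cl_def by (rule comm_group.abelian_FactGroup[OF Div_group Prin_subgroup])

lemma div_class_hom: "div_class A \<in> hom (Div A) (Cl A)"
  using normal.r_coset_hom_Mod[OF Prin_normal] by (simp add: div_class_def[abs_def] Cl_def)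

lemma div_class_closed: "D \<in> carrier (Div A) \<Longrightarrow> div_class A D \<in> carrier (Cl A)"
  using div_class_hom by (auto simp: hom_def)

lemma div_class_eq_one_iff:
  assumes "D \<in> carrier (Div A)"
  shows "div_class A D = \<one>\<^bsub>Cl A\<^esub> \<longleftrightarrow> D \<in> Prin A"
proof -
  interpret D: comm_group "Div A" by (rule Div_group)
  have "D \<in> Prin A" if "Prin A #>\<^bsub>Div A\<^esub> D = Prin A"
    using D.rcos_self[OF assms Prin_subgroup] that by simp
  moreover have "Prin A #>\<^bsub>Div A\<^esub> D = Prin A" if "D \<in> Prin A"
    using D.coset_join2[OF assms Prin_subgroup that] .
  ultimately show ?thesis by (auto simp: div_class_def Cl_def)
qed

lemma div_class_pow:
  assumes "D \<in> carrier (Div A)"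
  shows "div_class A D [^]\<^bsub>Cl A\<^esub> (n::nat) = div_class A (frag_cmul (int n) D)"
proof -
  interpret h: group_hom "Div A" "Cl A" "div_class A"
    using Div_group Cl_group div_class_hom
    by (simp add: group_hom_def group_hom_axioms_def comm_group_def)
  show ?thesis using h.hom_nat_pow[OF assms, of n] Div_pow[OF assms, of n] by simp
qed

lemma div_class_eq:
  assumes "D \<in> carrier (Div A)" "x \<in> Fr" "x \<noteq> 0" "D' = D + pdiv A x"
  shows "div_class A D' = div_class A D"
proof -
  interpret D: comm_group "Div A" by (rule Div_group)
  interpret C: comm_group "Cl A" by (rule Cl_group)
  have "div_class A (pdiv A x) = \<one>\<^bsub>Cl A\<^esub>"
    using div_class_eq_one_iff[OF pdiv_Div] assms Prin_iff by blast
  moreover have "div_class A D' = div_class A D \<otimes>\<^bsub>Cl A\<^esub> div_class A (pdiv A x)"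
    using div_class_hom assms pdiv_Div by (simp add: hom_def del: Div_simps(1))
  ultimately show ?thesis
    using div_class_closed[OF assms(1)] C.r_one by simp
qed

text \<open>Avoidance for the contracted ideals \<open>P \<inter> S\<close> gives an element of
  \<open>S\<close> outside \<open>q\<close> with positive value at every prime of \<open>T\<close>;
  its \<open>N\<close>-th power has values at least \<open>N\<close> there and stays outside the
  prime \<open>q\<close>.\<close>

lemma v_avoidance:
  assumes S: "subdomain S" "S \<subseteq> A" and q: "subdomain.prime_of S q"
    and T: "finite T" "T \<subseteq> Ht1 A" "\<And>P. P \<in> T \<Longrightarrow> \<not> P \<inter> S \<subseteq> q"
  obtains s where "s \<in> S" "s \<notin> q" "s \<noteq> 0" "\<And>P. P \<in> T \<Longrightarrow> int N \<le> v P s"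
proof -
  interpret S: subdomain S by (rule S(1))
  have id: "ideal (P \<inter> S) (rng S)" if "P \<in> T" for P
  proof -
    have "prime_of P" using T that Ht1_prime by blast
    then show ?thesis using S(2) prime_ofD[of P] by (auto simp: S.ideal_iff S.add_mem S.mult_mem)
  qed
  have fin: "finite ((\<lambda>P. P \<inter> S) ` T)" using T(1) by simp
  have cond: "ideal Q (rng S) \<and> \<not> Q \<subseteq> q" if "Q \<in> (\<lambda>P. P \<inter> S) ` T" for Q
    using that id T(3) by blast
  obtain s where s: "s \<in> S" "s \<notin> q" "\<And>Q. Q \<in> (\<lambda>P. P \<inter> S) ` T \<Longrightarrow> s \<in> Q"
    using S.prime_avoidance[OF q fin cond] by blast
  have s0: "s \<noteq> 0" using s S.prime_ofD(2)[OF q] by auto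
  show thesis
  proof
    show "s ^ N \<in> S" "s ^ N \<noteq> 0" using s s0 S.power_mem by auto
    show "s ^ N \<notin> q" using S.prime_power_mem[OF q] s by blast
    show "int N \<le> v P (s ^ N)" if P: "P \<in> T" for P
    proof -
      have "P \<in> Ht1 A" "s \<in> P" "s \<in> A" using P T s S(2) by auto
      then have "1 \<le> v P s" using v_pos_iff[of P s] s0 by simp
      then have "int N * 1 \<le> int N * v P s" by (intro mult_left_mono) auto
      then show ?thesis
        using \<open>P \<in> Ht1 A\<close> \<open>s \<in> A\<close> s0 mem_frac by (simp add: v_power)
    qed
  qed
qed

text \<open>\<open>x\<close> has finitely many poles, none contracting into \<open>q\<close>, so
  some element of \<open>S\<close> outside \<open>q\<close> vanishes at them to high enough order.
  Thus only poles over primes inside \<open>q\<close> can obstruct integrality locally at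
  \<open>q\<close>, a device used throughout.\<close>

lemma clear_denominator:
  assumes S: "subdomain S" "S \<subseteq> A" and q: "subdomain.prime_of S q"
    and x: "x \<in> Fr" "x \<noteq> 0" and neg: "\<And>P. P \<in> Ht1 A \<Longrightarrow> v P x < 0 \<Longrightarrow> \<not> P \<inter> S \<subseteq> q"
  obtains s where "s \<in> S" "s \<notin> q" "s \<noteq> 0" "s * x \<in> A"
proof -
  define T where "T = {P \<in> Ht1 A. v P x < 0}"
  have "T \<subseteq> {P \<in> Ht1 A. v P x \<noteq> 0}" unfolding T_def by (rule Collect_mono) simp
  then have fin: "finite T" using finite_support[OF x] by (rule finite_subset)
  \<comment> \<open>The total pole order dominates each single one and serves as a common
    exponent.\<close>
  define N where "N = nat (\<Sum>P\<in>T. - v P x)"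
  have N: "- v P x \<le> int N" if "P \<in> T" for P
  proof -
    have "- v P x \<le> (\<Sum>P\<in>T. - v P x)"
      using fin that by (intro member_le_sum) (auto simp: T_def)
    then show ?thesis by (simp add: N_def)
  qed
  obtain s where s: "s \<in> S" "s \<notin> q" "s \<noteq> 0" "\<And>P. P \<in> T \<Longrightarrow> int N \<le> v P s"
    using v_avoidance[OF S q fin, of N thesis] neg by (auto simp: T_def)
  have sA: "s \<in> A" using s S by auto
  have "0 \<le> v P (s * x)" if "P \<in> Ht1 A" for P
  proof (cases "P \<in> T")
    case True
    then show ?thesis using s(4)[of P] N[of P] that sA s(3) x mem_frac by (simp add: v_mult)
  next
    case False
    then show ?thesis using v_nonneg[of P s] that sA s(3) x mem_frac by (simp add: v_mult T_def)
  qed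
  then have "s * x \<in> A"
    using sA s(3) x mem_frac frac_mult by (intro mem_if_nonneg) auto
  with s show thesis using that by blast
qed

text \<open>The hull is tested with the multiplier \<open>s / z\<close>, where \<open>s\<close>
  cancels the zeros of \<open>z\<close> away from \<open>p\<close> and is a unit at
  \<open>p\<close>. It maps \<open>I\<close> into \<open>A\<close> by minimality of \<open>z\<close>
  at \<open>p\<close>, hence maps \<open>x\<close> into \<open>A\<close> too, and its value at
  \<open>p\<close> is \<open>- v p z\<close>.\<close>

lemma hull_min:
  assumes I: "I \<subseteq> A" and p: "p \<in> Ht1 A" and z: "z \<in> I" "z \<noteq> 0"
    and min: "\<And>w. w \<in> I \<Longrightarrow> w \<noteq> 0 \<Longrightarrow> v p z \<le> v p w"
    and x: "x \<in> divisorial_hull A I" "x \<noteq> 0"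
  shows "v p z \<le> v p x"
proof -
  have zA: "z \<in> A" using I z by auto
  have xFr: "x \<in> Fr" using x by (simp add: divisorial_hull_def)
  define T where "T = {q \<in> Ht1 A. v q z \<noteq> 0} - {p}"
  have fin: "finite T" using finite_support[of z] zA z mem_frac by (simp add: T_def)
  define N where "N = nat (\<Sum>q\<in>T. v q z)"
  have N: "v q z \<le> int N" if "q \<in> T" for q
  proof -
    have "v q z \<le> (\<Sum>q\<in>T. v q z)"
      using fin that v_nonneg zA z by (intro member_le_sum) (auto simp: T_def)
    then show ?thesis by (simp add: N_def)
  qed
  \<comment> \<open>Distinct primes of height one are incomparable, so avoidance applies with
    \<open>A\<close> itself as the subring.\<close>
  have "\<not> P \<inter> A \<subseteq> p" if "P \<in> T" for P
    using that Ht1_incomparable[of P p] p prime_ofD(1)[OF Ht1_prime, of P] by (auto simp: T_def)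
  then obtain s where s: "s \<in> A" "s \<notin> p" "s \<noteq> 0" "\<And>P. P \<in> T \<Longrightarrow> int N \<le> v P s"
    using v_avoidance[OF subdomain_axioms order.refl Ht1_prime[OF p] fin, of N thesis]
    by (auto simp: T_def)
  have y: "s / z \<in> Fr" "s / z \<noteq> 0" using s zA z frac_fieldI by auto
  have vy: "v q (s / z) = v q s - v q z" if "q \<in> Ht1 A" for q
    using that s zA z mem_frac by (simp add: v_divide)
  have vs: "v p s = 0" using v_zero_iff[OF p] s by simp
  have "s / z * w \<in> A" if w: "w \<in> I" for w
  proof (cases "w = 0")
    case False
    have wA: "w \<in> A" using w I by auto
    show ?thesis
    proof (rule mem_if_nonneg)
      show "s / z * w \<in> Fr" using frac_mult[OF y(1) mem_frac[OF wA]] .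
      show "s / z * w \<noteq> 0" using y(2) False by simp
      fix q assume q: "q \<in> Ht1 A"
      have e: "v q (s / z * w) = v q s - v q z + v q w"
        using v_mult[OF q y mem_frac[OF wA] False] vy[OF q] by simp
      consider "q = p" | "q \<in> T" | "v q z = 0" using q by (auto simp: T_def)
      then show "0 \<le> v q (s / z * w)"
        unfolding e using N[of q] s(4)[of q] min[OF w False] vs v_nonneg[OF q wA False]
          v_nonneg[OF q s(1,3)] by cases auto
    qed
  qed simp
  then have "x * (s / z) \<in> A"
    using x(1) y(1) unfolding divisorial_hull_def by blast
  then have "0 \<le> v p (x * (s / z))" using v_nonneg[OF p] x(2) y(2) by simp
  then show ?thesis using v_mult[OF p xFr x(2) y] vy[OF p] vs by simp
qed

text \<open>By \<open>hull_min\<close> the hull has the same minimal values as \<open>I\<close>, so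
  the divisor can be read off from \<open>I\<close>. Since the minima are attained,
  \<open>Inf\<close> over the integers returns them.\<close>

lemma lookup_ideal_div_hull:
  assumes I: "I \<subseteq> A" and D: "Poly_Mapping.keys D \<subseteq> Ht1 A"
    and ex: "\<And>p. p \<in> Ht1 A \<Longrightarrow> \<exists>z\<in>I. z \<noteq> 0 \<and> v p z = Poly_Mapping.lookup D p"
    and min: "\<And>p w. p \<in> Ht1 A \<Longrightarrow> w \<in> I \<Longrightarrow> w \<noteq> 0 \<Longrightarrow> Poly_Mapping.lookup D p \<le> v p w"
  shows "ideal_div A (divisorial_hull A I) = D"
proof -
  have sub: "I \<subseteq> divisorial_hull A I"
    using I mem_frac by (auto simp: divisorial_hull_def mult.commute)
  have Inf: "Inf (v p ` (divisorial_hull A I - {0})) = Poly_Mapping.lookup D p" if p: "p \<in> Ht1 A" for p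
  proof (rule cInf_eq_minimum)
    obtain z where z: "z \<in> I" "z \<noteq> 0" "v p z = Poly_Mapping.lookup D p"
      using ex[OF p] by blast
    show "Poly_Mapping.lookup D p \<in> v p ` (divisorial_hull A I - {0})"
      using z sub by (intro image_eqI[of _ _ z]) auto
    fix n assume "n \<in> v p ` (divisorial_hull A I - {0})"
    then obtain x where "x \<in> divisorial_hull A I" "x \<noteq> 0" "n = v p x" by auto
    then show "Poly_Mapping.lookup D p \<le> n"
      using hull_min[OF I p z(1,2), of x] min[OF p] z(3) by simp
  qed
  show ?thesis
  proof (rule poly_mapping_eqI)
    fix p
    have "finite {p \<in> Ht1 A. Inf (v p ` (divisorial_hull A I - {0})) \<noteq> 0}"
      by (rule finite_subset[OF _ finite_keys[of D]]) (auto simp: Inf in_keys_iff)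
    then have "Poly_Mapping.lookup (ideal_div A (divisorial_hull A I)) p =
        (if p \<in> Ht1 A then Inf (v p ` (divisorial_hull A I - {0})) else 0)"
      unfolding ideal_div_def by (rule lookup_Abs_if)
    then show "Poly_Mapping.lookup (ideal_div A (divisorial_hull A I)) p = Poly_Mapping.lookup D p"
      using Inf D by (auto simp: in_keys_iff)
  qed
qed

text \<open>Any isomorphism of \<open>M\<close> onto an ideal is multiplication by a constant of the
  ambient field, so it differs from the embedding by \<open>c\<close> by a factor in the fraction
  field, and the divisors differ by a principal one. This settles the definite description in
  \<open>module_class\<close>.\<close>

lemma module_class_eq:
  assumes M: "m0 \<in> M" "m0 \<noteq> 0" "\<And>x y. x \<in> M \<Longrightarrow> y \<in> M \<Longrightarrow> x + y \<in> M" "0 \<in> M"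
      "\<And>a x. a \<in> A \<Longrightarrow> x \<in> M \<Longrightarrow> a * x \<in> M" "\<And>x. x \<in> M \<Longrightarrow> c * x \<in> A" "c \<noteq> 0"
    and D: "Poly_Mapping.keys D \<subseteq> Ht1 A"
    and ex: "\<And>p. p \<in> Ht1 A \<Longrightarrow> \<exists>z\<in>M. z \<noteq> 0 \<and> v p (c * z) = Poly_Mapping.lookup D p"
    and min: "\<And>p w. p \<in> Ht1 A \<Longrightarrow> w \<in> M \<Longrightarrow> w \<noteq> 0 \<Longrightarrow> Poly_Mapping.lookup D p \<le> v p (c * w)"
  shows "module_class A M = div_class A D"
  unfolding module_class_def
proof (rule the_equality)
  let ?I = "(\<lambda>x. c * x) ` M"
  have "ideal ?I (rng A)"
    unfolding ideal_iff
  proof (intro conjI ballI)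
    show "?I \<subseteq> A" using M(6) by auto
    show "0 \<in> ?I" using M(4) by force
    show "x + y \<in> ?I" if "x \<in> ?I" "y \<in> ?I" for x y
      using that M(3) by (auto simp: distrib_left[symmetric])
    show "a * x \<in> ?I" if ax: "a \<in> A" "x \<in> ?I" for a x
    proof -
      obtain y where "y \<in> M" "x = c * y" using ax by auto
      then have "a * y \<in> M" "a * x = c * (a * y)" using M(5)[OF ax(1)] by (simp_all add: mult.left_commute)
      then show ?thesis by blast
    qed
  qed
  moreover have "bij_betw (\<lambda>x. c * x) M ?I"
    using M(7) by (auto simp: bij_betw_def inj_on_def)
  moreover have "ideal_div A (divisorial_hull A ?I) = D"
    using M(6,7) D ex min by (intro lookup_ideal_div_hull) auto
  ultimately show "\<exists>I h. ideal I (rng A) \<and> bij_betw h M I \<and>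
      (\<forall>x\<in>M. \<forall>y\<in>M. h (x + y) = h x + h y) \<and> (\<forall>r\<in>A. \<forall>x\<in>M. h (r * x) = r * h x) \<and>
      div_class A D = div_class A (ideal_div A (divisorial_hull A I))"
    by (intro exI[of _ ?I] exI[of _ "\<lambda>x. c * x"]) (simp add: algebra_simps)
  fix C
  assume "\<exists>I h. ideal I (rng A) \<and> bij_betw h M I \<and>
      (\<forall>x\<in>M. \<forall>y\<in>M. h (x + y) = h x + h y) \<and> (\<forall>r\<in>A. \<forall>x\<in>M. h (r * x) = r * h x) \<and>
      C = div_class A (ideal_div A (divisorial_hull A I))"
  then obtain I h where I: "ideal I (rng A)" and bij: "bij_betw h M I"
    and add: "\<And>x y. x \<in> M \<Longrightarrow> y \<in> M \<Longrightarrow> h (x + y) = h x + h y"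
    and lin: "\<And>r x. r \<in> A \<Longrightarrow> x \<in> M \<Longrightarrow> h (r * x) = r * h x"
    and C: "C = div_class A (ideal_div A (divisorial_hull A I))"
    by blast
  define d where "d = h m0 / m0"
  have hI: "h x \<in> A" if "x \<in> M" for x
    using that bij I by (auto simp: bij_betw_def ideal_iff)
  have h: "h x = d * x" if x: "x \<in> M" for x
  proof -
    \<comment> \<open>Linearity holds only for scalars in \<open>A\<close>. Both
      \<open>c * m0\<close> and \<open>c * x\<close> lie there, and expanding \<open>h\<close> of
      the same product in two ways relates \<open>h x\<close> to \<open>h m0\<close>.\<close>
    have "h ((c * m0) * x) = (c * m0) * h x" "h ((c * x) * m0) = (c * x) * h m0"
      using lin M(1,6) x by simp_all
    moreover have "(c * m0) * x = (c * x) * m0" by (simp add: ac_simps)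
    ultimately have "c * (m0 * h x) = c * (x * h m0)" by (simp only: mult.assoc)
    then have "m0 * h x = x * h m0" using mult_left_cancel[OF M(7)] by blast
    then show ?thesis using M(2) by (simp add: d_def field_simps)
  qed
  have I_eq: "I = (\<lambda>x. d * x) ` M"
    using bij h by (auto simp: bij_betw_def)
  have d0: "d \<noteq> 0"
  proof
    assume "d = 0"
    then have "h m0 = h 0" using h M(1,4) by simp
    then show False using bij M(1,2,4) by (auto simp: bij_betw_def inj_on_def)
  qed
  have "d * m0 \<in> A" "c * m0 \<in> A" using hI[OF M(1)] h[OF M(1)] M(1,6) by simp_all
  then have "(d * m0) / (c * m0) \<in> Fr" using M(2,7) by (intro frac_fieldI) simp_all
  then have dc: "d / c \<in> Fr" "d / c \<noteq> 0" using d0 M(2,7) by simp_all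
  have vd: "v p (d * x) = v p (c * x) + v p (d / c)" if "p \<in> Ht1 A" "x \<in> M" "x \<noteq> 0" for p x
  proof -
    have "c * x \<in> Fr" "c * x \<noteq> 0" using that M(6,7) mem_frac by auto
    then have "v p (c * x * (d / c)) = v p (c * x) + v p (d / c)"
      using dc that(1) by (intro v_mult)
    then show ?thesis using M(7) by (simp add: ac_simps)
  qed
  have "ideal_div A (divisorial_hull A I) = D + pdiv A (d / c)"
  proof (rule lookup_ideal_div_hull)
    show "I \<subseteq> A" using I by (simp add: ideal_iff)
    show "Poly_Mapping.keys (D + pdiv A (d / c)) \<subseteq> Ht1 A"
      using D keys_add[of D "pdiv A (d / c)"] pdiv_Div[OF dc] by auto
    fix p assume p: "p \<in> Ht1 A"
    obtain z where z: "z \<in> M" "z \<noteq> 0" "v p (c * z) = Poly_Mapping.lookup D p"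
      using ex[OF p] by blast
    then show "\<exists>z\<in>I. z \<noteq> 0 \<and> v p z = Poly_Mapping.lookup (D + pdiv A (d / c)) p"
      unfolding I_eq using vd[OF p z(1,2)] d0 p dc
      by (intro bexI[of _ "d * z"]) (simp_all add: lookup_add lookup_pdiv)
    fix w assume "w \<in> I" "w \<noteq> 0"
    then obtain x where "x \<in> M" "w = d * x" "x \<noteq> 0" unfolding I_eq by auto
    then show "Poly_Mapping.lookup (D + pdiv A (d / c)) p \<le> v p w"
      using vd[OF p, of x] min[OF p, of x] p dc by (simp add: lookup_add lookup_pdiv)
  qed
  then show "C = div_class A D"
    unfolding C using div_class_eq[OF _ dc] D by simp
qed

end

section \<open>Subrings cut out of a Krull domain by a subfield\<close>

text \<open>The abstraction of a ring of invariants: a subring that is the intersection of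
  \<open>R\<close> with its own fraction field. No group appears until cocycles do.\<close>

locale krull_pair = R: krull R + S: subdomain S for R S :: "'k::field set" +
  assumes sub: "S \<subseteq> R" and inter: "x \<in> R \<Longrightarrow> x \<in> frac_field S \<Longrightarrow> x \<in> S"
begin

abbreviation v where "v \<equiv> val R"
abbreviation w where "w \<equiv> val S"
abbreviation K where "K \<equiv> frac_field S"

lemma K_Fr: "x \<in> K \<Longrightarrow> x \<in> R.Fr"
  using sub by (elim S.frac_fieldE) (auto intro: R.frac_fieldI)

lemma contract_prime:
  assumes "P \<in> Ht1 R"
  shows "S.prime_of (P \<inter> S)"
proof -
  note P = R.prime_ofD[OF R.Ht1_prime[OF assms]]
  have "a \<in> P \<or> b \<in> P" if "a \<in> S" "b \<in> S" "a * b \<in> P" for a b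
    using P(6)[of a b] that sub by blast
  moreover have "a * x \<in> P" if "a \<in> S" "x \<in> P" for a x
    using P(5)[of a x] that sub by blast
  ultimately show ?thesis
    using P(2,3,4) by (auto simp: S.prime_of_def S.ideal_iff S.add_mem S.mult_mem)
qed

lemma v_zero_of_contract_zero:
  assumes P: "P \<in> Ht1 R" "P \<inter> S = {0}" and x: "x \<in> K" "x \<noteq> 0"
  shows "v P x = 0"
proof -
  obtain a b where ab: "a \<in> S" "b \<in> S" "b \<noteq> 0" "x = a / b" using x(1) by (rule S.frac_fieldE)
  then have "a \<noteq> 0" using x by auto
  then have "v P a = 0" "v P b = 0"
    using R.v_zero_iff[OF P(1)] ab P(2) sub by auto
  then show ?thesis
    using R.v_divide[OF P(1), of a b] ab \<open>a \<noteq> 0\<close> sub R.mem_frac by auto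
qed

lemma mem_S_if_nonneg:
  assumes "x \<in> K" "x \<noteq> 0" "\<And>P. P \<in> Ht1 R \<Longrightarrow> 0 \<le> v P x"
  shows "x \<in> S"
  using inter R.mem_if_nonneg[OF K_Fr] assms by blast

lemma v_neg_if_notin_S:
  assumes "x \<in> K" "x \<notin> S"
  shows "\<exists>P\<in>Ht1 R. v P x < 0"
  using mem_S_if_nonneg[of x] assms by force

text \<open>Complete integral closedness, inherited from the valuations of \<open>R\<close>: at a
  pole of \<open>x\<close> the element \<open>c * x ^ n\<close> would have negative value for large
  \<open>n\<close>.\<close>

lemma almost_integral:
  assumes "c \<in> S" "c \<noteq> 0" "x \<in> K" "x \<noteq> 0" "\<And>n. c * x ^ n \<in> S"
  shows "x \<in> S"
proof (rule mem_S_if_nonneg[OF assms(3,4)])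
  fix P assume P: "P \<in> Ht1 R"
  have cR: "c \<in> R" using assms(1) sub by auto
  \<comment> \<open>A pole has order at least 1, so one more than the value of \<open>c\<close> is
    large enough.\<close>
  define n where "n = nat (v P c) + 1"
  have "0 \<le> v P (c * x ^ n)" using assms sub P by (intro R.v_nonneg) auto
  also have "v P (c * x ^ n) = v P c + int n * v P x"
    using P assms(2-4) K_Fr R.mem_frac[OF cR] by (simp add: R.v_mult R.v_power R.frac_power)
  finally have "0 \<le> v P c + int n * v P x" .
  moreover have "int n * v P x \<le> int n * (-1)" if "v P x < 0"
    using that by (intro mult_left_mono) auto
  ultimately show "0 \<le> v P x"
    using R.v_nonneg[OF P cR assms(2)] by (force simp: n_def)
qed

text \<open>Otherwise all poles of \<open>inverse a\<close> could be cleared by an \<open>s\<close>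
  in \<open>S\<close> outside \<open>q\<close>; then \<open>s / a\<close> lies in \<open>S\<close>,
  and \<open>s\<close> is a multiple of \<open>a\<close>, hence in \<open>q\<close>. This stands in
  for lying over, as \<open>R\<close> need not be integral over \<open>S\<close>.\<close>

lemma exists_over_below:
  assumes q: "S.prime_of q" and a: "a \<in> q" "a \<noteq> 0"
  shows "\<exists>P\<in>Ht1 R. a \<in> P \<and> P \<inter> S \<subseteq> q"
proof (rule ccontr)
  assume no: "\<not> ?thesis"
  have aS: "a \<in> S" using S.prime_ofD(1)[OF q] a by auto
  have aR: "a \<in> R" using aS sub by auto
  have ia: "inverse a \<in> R.Fr" "inverse a \<noteq> 0" using R.frac_inverse R.mem_frac aR a by auto
  have neg: "\<not> P \<inter> S \<subseteq> q" if P: "P \<in> Ht1 R" "v P (inverse a) < 0" for P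
  proof -
    have "0 < v P a" using P a(2) R.mem_frac[OF aR] by (simp add: R.v_inverse)
    then have "a \<in> P" using R.v_pos_iff[OF P(1) aR a(2)] by simp
    then show ?thesis using no P(1) by blast
  qed
  obtain s where s: "s \<in> S" "s \<notin> q" "s * inverse a \<in> R"
    using R.clear_denominator[OF S.subdomain_axioms sub q ia neg] by blast
  have "s * inverse a \<in> S"
    using inter[OF s(3)] S.frac_mult S.frac_inverse S.mem_frac s(1) aS by blast
  then have "(s * inverse a) * a \<in> q" using S.prime_ofD(5)[OF q] a by blast
  then show False using s a by (simp add: mult.assoc)
qed

text \<open>
  If the denominators of \<open>x\<close> were concentrated over primes of height at least two, then for an \<open>x\<close>
  with the least total denominator a nonzero prime below such a prime \<open>p\<close> would be stable under
  multiplication by \<open>x\<close>, so that \<open>x\<close> would be almost integral over \<open>S\<close>.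
\<close>

lemma mem_S_if_nonneg_over_Ht1:
  assumes "x \<in> K" "x \<noteq> 0" "\<And>P. P \<in> Ht1 R \<Longrightarrow> P \<inter> S \<in> Ht1 S \<Longrightarrow> 0 \<le> v P x"
  shows "x \<in> S"
proof -
  define N where "N y = {P \<in> Ht1 R. v P y < 0}" for y
  define \<mu> where "\<mu> y = nat (\<Sum>P\<in>N y. - v P y)" for y
  have finN: "finite (N y)" if "y \<in> K" "y \<noteq> 0" for y
  proof -
    have "N y \<subseteq> {P \<in> Ht1 R. v P y \<noteq> 0}" unfolding N_def by (rule Collect_mono) simp
    then show ?thesis using R.finite_support[OF K_Fr[OF that(1)] that(2)] by (rule finite_subset)
  qed
  have "y \<in> K \<Longrightarrow> y \<noteq> 0 \<Longrightarrow> (\<forall>P\<in>N y. P \<inter> S \<notin> Ht1 S) \<Longrightarrow> y \<in> S" for y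
  proof (induction "\<mu> y" arbitrary: y rule: less_induct)
    case less
    note yK = less.prems(1) and y0 = less.prems(2) and bad = less.prems(3)
    have yFr: "y \<in> R.Fr" by (rule K_Fr[OF yK])
    show ?case
    proof (rule ccontr)
      assume nS: "y \<notin> S"
      \<comment> \<open>Multiplying by an \<open>s\<close> in the pole \<open>P\<close> creates no
        new poles and strictly improves the value at \<open>P\<close>, so the total pole order drops
        and the induction hypothesis applies to \<open>s * y\<close>.\<close>
      have mul: "s * y \<in> S" if P: "P \<in> N y" "s \<in> P" "s \<in> S" for P s
      proof (cases "s = 0")
        case False
        have sR: "s \<in> R" using P sub by auto
        have sFr: "s \<in> R.Fr" by (rule R.mem_frac[OF sR])
        have e: "v Q (s * y) = v Q s + v Q y" if "Q \<in> Ht1 R" for Q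
          using R.v_mult[OF that sFr False yFr y0] .
        have le: "v Q y \<le> v Q (s * y)" if "Q \<in> Ht1 R" for Q
          using e[OF that] R.v_nonneg[OF that sR False] by simp
        have sN: "N (s * y) \<subseteq> N y"
        proof
          fix Q assume "Q \<in> N (s * y)"
          then show "Q \<in> N y" using le[of Q] by (simp add: N_def)
        qed
        have PH: "P \<in> Ht1 R" "v P y < 0" using P(1) by (simp_all add: N_def)
        have lt: "v P y < v P (s * y)"
          using e[OF PH(1)] R.v_pos_iff[OF PH(1) sR False] P(2) by simp
        define g where "g Q = (if Q \<in> N (s * y) then - v Q (s * y) else 0)" for Q
        have "(\<Sum>Q\<in>N (s * y). - v Q (s * y)) = (\<Sum>Q\<in>N y. g Q)"
          unfolding g_def using sN finN[OF yK y0] by (simp add: sum.If_cases Int_absorb1)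
        also have "\<dots> < (\<Sum>Q\<in>N y. - v Q y)"
        proof (rule sum_strict_mono_ex1)
          show "finite (N y)" by (rule finN[OF yK y0])
          show "\<forall>Q\<in>N y. g Q \<le> - v Q y" using le by (auto simp: g_def N_def)
          show "\<exists>Q\<in>N y. g Q < - v Q y" using P(1) lt PH by (intro bexI[of _ P]) (auto simp: g_def)
        qed
        finally have "(\<Sum>Q\<in>N (s * y). - v Q (s * y)) < (\<Sum>Q\<in>N y. - v Q y)" .
        moreover have "0 \<le> (\<Sum>Q\<in>N (s * y). - v Q (s * y))"
          by (rule sum_nonneg) (simp add: N_def)
        ultimately have "\<mu> (s * y) < \<mu> y" by (simp add: \<mu>_def)
        then show ?thesis
          using less.hyps[of "s * y"] bad sN False y0 S.frac_mult[OF S.mem_frac[OF P(3)] yK] by auto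
      qed simp
      obtain P where P: "P \<in> N y" using v_neg_if_notin_S[OF yK nS] by (auto simp: N_def)
      then have PH: "P \<in> Ht1 R" by (simp add: N_def)
      note p = contract_prime[OF PH]
      have "v P y \<noteq> 0" using P by (simp add: N_def)
      then have "P \<inter> S \<noteq> {0}" using v_zero_of_contract_zero[OF PH _ yK y0] by blast
      moreover have "P \<inter> S \<notin> Ht1 S" using bad P by blast
      ultimately obtain p' where p': "S.prime_of p'" "p' \<subseteq> P \<inter> S" "p' \<noteq> {0}" "p' \<noteq> P \<inter> S"
        using p unfolding S.Ht1_iff by blast
      obtain c where c: "c \<in> p'" "c \<noteq> 0" using p'(3) S.prime_ofD(2)[OF p'(1)] by blast
      \<comment> \<open>A subset of \<open>S\<close> that contains \<open>c\<close> and is stable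
        under multiplication by \<open>y\<close> contains all \<open>c * y ^ n\<close>, and then
        \<open>y\<close> would be almost integral.\<close>
      have stable: False if st: "\<And>u. u \<in> I \<Longrightarrow> u * y \<in> I" and I: "I \<subseteq> S" "c \<in> I" for I
      proof -
        have "c * y ^ n \<in> I" for n
        proof (induction n)
          case (Suc n)
          then show ?case using st[OF Suc] by (simp add: ac_simps)
        qed (simp add: I)
        then show False using almost_integral[OF _ c(2) yK y0] I nS by blast
      qed
      have "\<not> (\<forall>u. u \<in> P \<inter> S \<longrightarrow> u * y \<in> P \<inter> S)"
        using stable[of "P \<inter> S"] c p' by blast
      then obtain t where t: "t \<in> P" "t \<in> S" "t * y \<notin> P" using mul[OF P] by blast
      have tyS: "t * y \<in> S" using mul[OF P] t by blast
      \<comment> \<open>If \<open>t\<close> were in \<open>p'\<close>, so would be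
        \<open>u * (t * y)\<close> for each \<open>u\<close> in \<open>P \<inter> S\<close>; as
        \<open>t * y\<close> is outside \<open>P\<close>, all of \<open>P \<inter> S\<close> would
        be pushed into \<open>p'\<close>.\<close>
      have tp': "t \<notin> p'"
      proof
        assume tp: "t \<in> p'"
        have "u \<in> p'" if u: "u \<in> P" "u \<in> S" for u
        proof -
          have "(u * y) * t \<in> p'" using S.prime_ofD(5)[OF p'(1)] mul[OF P u] tp by blast
          then have "u * (t * y) \<in> p'" by (simp add: ac_simps)
          then show ?thesis using S.prime_ofD(6)[OF p'(1) u(2) tyS] t(3) p'(2) by blast
        qed
        then show False using p' by blast
      qed
      \<comment> \<open>Now \<open>t * (u * y) = (t * y) * u\<close> lies in \<open>p'\<close> while
        \<open>t\<close> does not. So \<open>p'\<close> is stable under \<open>y\<close>, the final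
        contradiction.\<close>
      have "u * y \<in> p'" if u: "u \<in> p'" for u
      proof -
        have uy: "u * y \<in> S" using mul[OF P] u p'(2) by blast
        have "(t * y) * u \<in> p'" using S.prime_ofD(5)[OF p'(1) tyS u] .
        then have "t * (u * y) \<in> p'" by (simp add: ac_simps)
        then show ?thesis using S.prime_ofD(6)[OF p'(1) t(2) uy] tp' by blast
      qed
      then show False using stable[of p'] c p'(2) by blast
    qed
  qed
  from this[OF assms(1,2)] show ?thesis using assms(3) by (force simp: N_def)
qed

section \<open>Fibres over height one primes of the subring, and ramification\<close>

abbreviation Over where "Over \<equiv> primes_over R S"

lemma Over_iff: "P \<in> Over q \<longleftrightarrow> P \<in> Ht1 R \<and> P \<inter> S = q"
  by (simp add: primes_over_def)

lemma Ht1_nonzero_elt: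
  assumes "q \<in> Ht1 S"
  obtains a where "a \<in> q" "a \<in> S" "a \<noteq> 0"
  using assms S.prime_ofD(1,2)[of q] unfolding S.Ht1_iff by blast

text \<open>A nonzero element of \<open>q\<close> lies in some \<open>P\<close> contracting into
  \<open>q\<close>; the contraction is a nonzero prime, so minimality of \<open>q\<close> makes it
  equal to \<open>q\<close>.\<close>

lemma Over_nonempty: "q \<in> Ht1 S \<Longrightarrow> Over q \<noteq> {}"
proof -
  assume q: "q \<in> Ht1 S"
  obtain a where a: "a \<in> q" "a \<in> S" "a \<noteq> 0" using Ht1_nonzero_elt[OF q] .
  obtain P where P: "P \<in> Ht1 R" "a \<in> P" "P \<inter> S \<subseteq> q"
    using exists_over_below[OF S.Ht1_prime[OF q] a(1,3)] by blast
  have "P \<inter> S = q"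
    using q P a contract_prime[OF P(1)] unfolding S.Ht1_iff by blast
  then show ?thesis using P by (auto simp: Over_iff)
qed

lemma Over_finite:
  assumes q: "q \<in> Ht1 S"
  shows "finite (Over q)"
proof -
  obtain a where a: "a \<in> q" "a \<in> S" "a \<noteq> 0" using Ht1_nonzero_elt[OF q] .
  have "Over q \<subseteq> {P \<in> Ht1 R. a \<in> P}" using a by (auto simp: Over_iff)
  moreover have "finite {P \<in> Ht1 R. a \<in> P}" using R.finite_mem a sub by blast
  ultimately show ?thesis by (rule finite_subset)
qed

context
  fixes q
  assumes q: "q \<in> Ht1 S"
begin

lemma Over_v_pos_iff: "P \<in> Over q \<Longrightarrow> x \<in> S \<Longrightarrow> x \<noteq> 0 \<Longrightarrow> 0 < v P x \<longleftrightarrow> x \<in> q"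
  using R.v_pos_iff[of P x] sub by (auto simp: Over_iff)

lemma Over_v_zero_iff: "P \<in> Over q \<Longrightarrow> x \<in> S \<Longrightarrow> x \<noteq> 0 \<Longrightarrow> v P x = 0 \<longleftrightarrow> x \<notin> q"
  using R.v_zero_iff[of P x] sub by (auto simp: Over_iff)

text \<open>A pole over a prime inside \<open>q\<close> lies over 0 or over \<open>q\<close>. The
  first cannot occur for \<open>x\<close> in \<open>K\<close>, the second is excluded by the
  condition, and all other poles are cleared by an element of \<open>S\<close> outside
  \<open>q\<close>.\<close>

lemma loc_iff:
  assumes x: "x \<in> K" "x \<noteq> 0"
  shows "x \<in> loc S q \<longleftrightarrow> (\<forall>P\<in>Over q. 0 \<le> v P x)"
proof
  assume "x \<in> loc S q"
  then obtain a b where ab: "a \<in> S" "b \<in> S" "b \<notin> q" "x = a / b" by (rule S.locE)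
  have "a \<noteq> 0" "b \<noteq> 0" using ab x S.prime_ofD(2)[OF S.Ht1_prime[OF q]] by auto
  show "\<forall>P\<in>Over q. 0 \<le> v P x"
  proof
    fix P assume P: "P \<in> Over q"
    have "v P x = v P a - v P b"
      using ab \<open>a \<noteq> 0\<close> \<open>b \<noteq> 0\<close> P sub R.mem_frac by (auto simp: R.v_divide Over_iff subset_iff)
    moreover have "v P b = 0" using Over_v_zero_iff[OF P ab(2) \<open>b \<noteq> 0\<close>] ab by simp
    moreover have "0 \<le> v P a" using R.v_nonneg[of P a] P sub ab \<open>a \<noteq> 0\<close> by (auto simp: Over_iff)
    ultimately show "0 \<le> v P x" by simp
  qed
next
  assume nn: "\<forall>P\<in>Over q. 0 \<le> v P x"
  have neg: "\<not> P \<inter> S \<subseteq> q" if P: "P \<in> Ht1 R" "v P x < 0" for P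
  proof
    assume "P \<inter> S \<subseteq> q"
    then have "P \<inter> S = {0} \<or> P \<inter> S = q"
      using q contract_prime[OF P(1)] unfolding S.Ht1_iff by blast
    then show False
    proof
      assume "P \<inter> S = {0}"
      then show False using v_zero_of_contract_zero[OF P(1) _ x] P(2) by simp
    next
      assume "P \<inter> S = q"
      then have "P \<in> Over q" using P(1) by (simp add: Over_iff)
      then show False using nn P(2) by force
    qed
  qed
  obtain s where s: "s \<in> S" "s \<notin> q" "s \<noteq> 0" "s * x \<in> R"
    using R.clear_denominator[OF S.subdomain_axioms sub S.Ht1_prime[OF q] K_Fr[OF x(1)] x(2) neg]
    by blast
  have "s * x \<in> S" using inter[OF s(4)] S.frac_mult S.mem_frac s(1) x(1) by blast
  then have "(s * x) / s \<in> loc S q" using s S.locI by blast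
  then show "x \<in> loc S q" using s by simp
qed

text \<open>\<open>x\<close> lies in \<open>loc S q\<close> and so has a denominator outside
  \<open>q\<close>; its value at a prime over \<open>q\<close> is then 0 precisely if the numerator
  is outside \<open>q\<close>, whichever prime of the fibre is taken.\<close>

lemma unit_all_Over:
  assumes x: "x \<in> K" "x \<noteq> 0" and nn: "\<forall>P\<in>Over q. 0 \<le> v P x" and P0: "P0 \<in> Over q" "v P0 x = 0"
    and P: "P \<in> Over q"
  shows "v P x = 0"
proof -
  have "x \<in> loc S q" using loc_iff[OF x] nn by simp
  then obtain a b where ab: "a \<in> S" "b \<in> S" "b \<notin> q" "x = a / b" by (rule S.locE)
  have ne: "a \<noteq> 0" "b \<noteq> 0" using ab x S.prime_ofD(2)[OF S.Ht1_prime[OF q]] by auto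
  have e: "v Q x = v Q a" if Q: "Q \<in> Over q" for Q
  proof -
    have "v Q x = v Q a - v Q b"
      using ab ne Q sub R.mem_frac by (auto simp: R.v_divide Over_iff subset_iff)
    then show ?thesis using Over_v_zero_iff[OF Q ab(2) ne(2)] ab by simp
  qed
  show ?thesis
    using e[OF P] e[OF P0(1)] P0(2) Over_v_zero_iff[OF _ ab(1) ne(1)] P P0 by simp
qed

text \<open>Let \<open>P0\<close> minimize the ratio of \<open>v P x\<close> to \<open>v P a\<close>
  over the finite fibre. Then \<open>x\<close> to the power \<open>v P0 a\<close>, divided by
  \<open>a\<close> to the power \<open>v P0 x\<close>, has value 0 at \<open>P0\<close> and
  nonnegative values on the fibre, hence value 0 on all of it; this is the proportionality.\<close>

lemma v_proportional:
  assumes x: "x \<in> K" "x \<noteq> 0" and a: "a \<in> S" "a \<noteq> 0" "a \<in> q" and P: "P \<in> Over q" "P' \<in> Over q"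
  shows "v P x * v P' a = v P' x * v P a"
proof -
  have pos: "0 < v Q a" if "Q \<in> Over q" for Q using Over_v_pos_iff[OF that a(1,2)] a by simp
  define r where "r Q = real_of_int (v Q x) / real_of_int (v Q a)" for Q
  obtain P0 where P0: "P0 \<in> Over q" "\<And>Q. Q \<in> Over q \<Longrightarrow> r P0 \<le> r Q"
    using arg_min_if_finite(1)[OF Over_finite[OF q] Over_nonempty[OF q], of r]
      arg_min_least[OF Over_finite[OF q] Over_nonempty[OF q], of _ r] by blast
  define y where "y = x ^ nat (v P0 a) / a powi v P0 x"
  have aK: "a \<in> K" using S.mem_frac a by simp
  have y: "y \<in> K" "y \<noteq> 0"
    using x a aK by (auto simp: y_def S.frac_divide S.frac_power S.frac_powi power_int_eq_0_iff)
  have vy: "v Q y = v P0 a * v Q x - v P0 x * v Q a" if Q: "Q \<in> Over q" for Q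
  proof -
    have Q1: "Q \<in> Ht1 R" using Q by (simp add: Over_iff)
    have "v Q (a powi v P0 x) = v P0 x * v Q a"
      using S.is_val_powi K_Fr[OF aK] a R.is_val_powi[OF R.is_val[OF Q1] R.Ht1_prime[OF Q1]] by blast
    then show ?thesis
      unfolding y_def using Q1 x a aK K_Fr pos[OF P0(1)]
      by (simp add: R.v_divide R.v_power R.frac_power R.frac_powi power_int_eq_0_iff)
  qed
  have "0 \<le> v Q y" if Q: "Q \<in> Over q" for Q
  proof -
    have "r P0 \<le> r Q" using P0 Q by blast
    then have "real_of_int (v P0 x) * real_of_int (v Q a) \<le> real_of_int (v Q x) * real_of_int (v P0 a)"
      using pos[OF Q] pos[OF P0(1)] by (simp add: r_def divide_simps mult.commute)
    then have "v P0 x * v Q a \<le> v Q x * v P0 a" by (simp flip: of_int_mult)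
    then show ?thesis using vy[OF Q] by (simp add: mult.commute)
  qed
  then have "v Q y = 0" if "Q \<in> Over q" for Q
    using unit_all_Over[OF y _ P0(1) _ that] vy[OF P0(1)] by (simp add: mult.commute)
  then have e: "v P0 a * v Q x = v P0 x * v Q a" if "Q \<in> Over q" for Q
    using vy[OF that] that by simp
  have "v P0 a * (v P x * v P' a) = (v P0 a * v P x) * v P' a" by (simp add: ac_simps)
  also have "\<dots> = (v P0 a * v P' x) * v P a" unfolding e[OF P(1)] e[OF P(2)] by (simp add: ac_simps)
  also have "\<dots> = v P0 a * (v P' x * v P a)" by (simp add: ac_simps)
  finally show ?thesis using pos[OF P0(1)] by simp
qed

lemma nonneg_all_Over:
  assumes x: "x \<in> K" "x \<noteq> 0" and P: "P \<in> Over q" "0 \<le> v P x" and Q: "Q \<in> Over q"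
  shows "0 \<le> v Q x"
proof -
  obtain a where a: "a \<in> q" "a \<in> S" "a \<noteq> 0" using Ht1_nonzero_elt[OF q] .
  have "v P x * v Q a = v Q x * v P a" by (rule v_proportional[OF x a(2,3,1) P(1) Q])
  moreover have pos: "0 < v Q a" "0 < v P a" using Over_v_pos_iff a P(1) Q by auto
  moreover have "0 \<le> v P x * v Q a" using P(2) pos by simp
  ultimately show ?thesis by (simp add: zero_le_mult_iff)
qed

text \<open>The values of \<open>v P\<close> on nonzero elements of \<open>K\<close> form a group of
  integers; dividing by its positive generator normalizes the restriction. The valuation ring is
  \<open>loc S q\<close> since, by proportionality, one prime of the fibre decides the sign at all
  of them.\<close>

lemma Over_val:
  assumes P: "P \<in> Over q"
  shows "is_val S q (w q) \<and> (\<exists>e>0. \<forall>x\<in>K - {0}. v P x = int e * w q x)"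
proof -
  have P1: "P \<in> Ht1 R" using P by (simp add: Over_iff)
  obtain a where a: "a \<in> q" "a \<in> S" "a \<noteq> 0" using Ht1_nonzero_elt[OF q] .
  define e where "e = (LEAST n. 0 < n \<and> (\<exists>x\<in>K - {0}. v P x = int n))"
  have "0 < v P a" using Over_v_pos_iff[OF P] a by simp
  then have "\<exists>n. 0 < n \<and> (\<exists>x\<in>K - {0}. v P x = int n)"
    using a S.mem_frac by (intro exI[of _ "nat (v P a)"]) auto
  then have e: "0 < e \<and> (\<exists>x\<in>K - {0}. v P x = int e)"
    unfolding e_def by (rule LeastI_ex)
  then obtain t where t: "t \<in> K" "t \<noteq> 0" "v P t = int e" by blast
  have dvd: "int e dvd v P x" if x: "x \<in> K" "x \<noteq> 0" for x
  proof (rule ccontr)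
    assume nd: "\<not> int e dvd v P x"
    \<comment> \<open>Division with remainder: \<open>y\<close> would have a positive value smaller
      than the least one.\<close>
    define y where "y = x / t powi (v P x div int e)"
    have y: "y \<in> K" "y \<noteq> 0"
      using x t by (auto simp: y_def S.frac_divide S.frac_powi power_int_eq_0_iff)
    have "v P (t powi (v P x div int e)) = (v P x div int e) * int e"
      using R.is_val_powi[OF R.is_val[OF P1] R.Ht1_prime[OF P1] K_Fr[OF t(1)] t(2)] t(3) by simp
    then have "v P y = v P x mod int e"
      unfolding y_def using R.v_divide[OF P1 K_Fr[OF x(1)] x(2) K_Fr[OF S.frac_powi[OF t(1)]]] t(2)
      by (simp add: power_int_eq_0_iff minus_div_mult_eq_mod)
    moreover have "0 < v P x mod int e" "v P x mod int e < int e"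
    proof -
      have "v P x mod int e \<noteq> 0" using nd by presburger
      moreover have "0 \<le> v P x mod int e" using e by simp
      ultimately show "0 < v P x mod int e" by linarith
      show "v P x mod int e < int e" using e by simp
    qed
    ultimately have "0 < nat (v P y) \<and> (\<exists>x\<in>K - {0}. v P x = int (nat (v P y)))" "nat (v P y) < e"
      using y by auto
    then show False using not_less_Least unfolding e_def by blast
  qed
  define u where "u x = v P x div int e" for x
  have u: "v P x = int e * u x" if "x \<in> K - {0}" for x
    using dvd[of x] that by (simp add: u_def)
  have iv: "is_val S q u"
    unfolding is_val_def
  proof (intro conjI ballI)
    fix x y assume xy: "x \<in> K - {0}" "y \<in> K - {0}"
    then have "x * y \<in> K - {0}" using S.frac_mult by simp
    then have "int e * u (x * y) = int e * (u x + u y)"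
      using u[of x] u[of y] u[of "x * y"] xy R.v_mult[OF P1 K_Fr[of x] _ K_Fr[of y]]
      by (simp add: distrib_left)
    then show "u (x * y) = u x + u y" using e by simp
  next
    show "\<exists>t\<in>K - {0}. u t = 1" using t e by (intro bexI[of _ t]) (simp_all add: u_def)
  next
    fix x assume x: "x \<in> K - {0}"
    have "x \<in> loc S q \<longleftrightarrow> 0 \<le> v P x"
      using loc_iff[of x] nonneg_all_Over[of x P] x P by blast
    also have "\<dots> \<longleftrightarrow> 0 \<le> u x" using u[OF x] e by (simp add: zero_le_mult_iff)
    finally show "x \<in> loc S q \<longleftrightarrow> 0 \<le> u x" .
  qed
  have "val S q x = u x" if "x \<in> K - {0}" for x
    using S.val_eq[OF iv S.Ht1_prime[OF q]] that by simp
  then show ?thesis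
    using S.is_val_val[OF iv S.Ht1_prime[OF q]] u e by auto
qed

end

text \<open>Normalized restrictions supply the valuations, \<open>mem_S_if_nonneg_over_Ht1\<close>
  reduces integrality to the height one primes of \<open>S\<close>, and finiteness descends from
  \<open>R\<close> because the fibres are nonempty.\<close>

lemma is_krull: "krull S"
proof unfold_locales
  show iv: "is_val S q (val S q)" if "q \<in> Ht1 S" for q
    using Over_val[OF that] Over_nonempty[OF that] by blast
  show "x \<in> S" if x: "x \<in> K" "x \<noteq> 0" "\<And>q. q \<in> Ht1 S \<Longrightarrow> 0 \<le> val S q x" for x
  proof (rule mem_S_if_nonneg_over_Ht1[OF x(1,2)])
    fix P assume P: "P \<in> Ht1 R" "P \<inter> S \<in> Ht1 S"
    then have "P \<in> Over (P \<inter> S)" by (simp add: Over_iff)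
    then show "0 \<le> v P x" using Over_val[OF P(2)] x P(2) by fastforce
  qed
  show "finite {q \<in> Ht1 S. x \<in> q}" if x: "x \<in> S" "x \<noteq> 0" for x
  proof -
    have "{q \<in> Ht1 S. x \<in> q} \<subseteq> (\<lambda>P. P \<inter> S) ` {P \<in> Ht1 R. x \<in> P}"
    proof
      fix q assume q: "q \<in> {q \<in> Ht1 S. x \<in> q}"
      then obtain P where "P \<in> Over q" using Over_nonempty by blast
      then show "q \<in> (\<lambda>P. P \<inter> S) ` {P \<in> Ht1 R. x \<in> P}"
        using q by (intro image_eqI[of _ _ P]) (auto simp: Over_iff)
    qed
    moreover have "finite {P \<in> Ht1 R. x \<in> P}" using R.finite_mem x sub by blast
    ultimately show ?thesis by (meson finite_imageI finite_subset)
  qed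
qed

sublocale S: krull S
  by (rule is_krull)

abbreviation e where "e \<equiv> ram_index R S"

lemma ram_index:
  assumes q: "q \<in> Ht1 S" and P: "P \<in> Over q"
  shows "0 < e P q" "x \<in> K \<Longrightarrow> x \<noteq> 0 \<Longrightarrow> v P x = int (e P q) * w q x"
proof -
  obtain n where n: "0 < n" "\<forall>x\<in>K - {0}. v P x = int n * w q x"
    using Over_val[OF q P] by blast
  obtain t where t: "t \<in> K" "t \<noteq> 0" "w q t = 1" using S.v_uniformizer[OF q] .
  have "e P q = n"
    unfolding ram_index_def
  proof (rule the_equality, rule n(2))
    fix m assume "\<forall>x\<in>K - {0}. v P x = int m * w q x"
    then have "int m * w q t = int n * w q t" using n(2) t by force
    then show "m = n" using t by simp
  qed
  with n show "0 < e P q" "x \<in> K \<Longrightarrow> x \<noteq> 0 \<Longrightarrow> v P x = int (e P q) * w q x" by auto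
qed

lemma Ht1_over_1_iff: "P \<in> Ht1_over R S 1 \<longleftrightarrow> P \<in> Ht1 R \<and> P \<inter> S \<in> Ht1 S"
  using contract_prime[of P] by (auto simp: Ht1_over_def Ht1_def S.primeideal_iff)

text \<open>A contraction of height 0 is zero, so height at least two, infinite height included, is
  what remains besides zero and height one.\<close>

lemma Ht1_ge2_iff: "P \<in> Ht1_ge2 R S \<longleftrightarrow> P \<in> Ht1 R \<and> P \<inter> S \<noteq> {0} \<and> P \<inter> S \<notin> Ht1 S"
proof (cases "P \<in> Ht1 R")
  case True
  note p = contract_prime[OF True]
  have "P \<in> Ht1_ge2 R S \<longleftrightarrow> 2 \<le> ht S (P \<inter> S)" using True by (auto simp: Ht1_ge2_def Ht1_over_def)
  also have "\<dots> \<longleftrightarrow> ht S (P \<inter> S) \<noteq> 0 \<and> ht S (P \<inter> S) \<noteq> 1"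
  proof (cases "ht S (P \<inter> S)")
    case (enat n)
    then show ?thesis by (auto simp: numeral_eq_enat zero_enat_def one_enat_def)
  qed simp
  also have "\<dots> \<longleftrightarrow> P \<inter> S \<noteq> {0} \<and> P \<inter> S \<notin> Ht1 S"
    using S.ht_eq_0_iff[OF p] p by (simp add: Ht1_def S.primeideal_iff)
  finally show ?thesis using True by simp
qed (auto simp: Ht1_ge2_def Ht1_over_def)

end

section \<open>Divisors modulo the divisors coming from the subring\<close>

lemma free_Abelian_subgroup_cmul:
  assumes "subgroup H (free_Abelian_group Y)" "D \<in> H"
  shows "frag_cmul n D \<in> H"
proof -
  interpret comm_group "free_Abelian_group Y" by (rule abelian_free_Abelian_group)
  have "D \<in> carrier (free_Abelian_group Y)" using subgroup.subset[OF assms(1)] assms(2) by blast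
  then have "Poly_Mapping.keys D \<subseteq> Y" by (simp only: carrier_free_Abelian_group_iff)
  then show ?thesis using subgroup_int_pow_closed[OF assms, of n] by simp
qed

lemma free_Abelian_subgroup_sum:
  assumes "subgroup H (free_Abelian_group Y)" "\<And>i. i \<in> I \<Longrightarrow> f i \<in> H"
  shows "sum f I \<in> H"
  using assms(2)
proof (induction I rule: infinite_finite_induct)
  case (insert i I)
  then show ?case using subgroup.m_closed[OF assms(1), of "f i" "sum f I"] by simp
qed (use subgroup.one_closed[OF assms(1)] in simp_all)

context krull_pair
begin

definition E :: "'k set \<Rightarrow> ('k set \<Rightarrow>\<^sub>0 int)" where
  "E q = (\<Sum>P\<in>Over q. frag_cmul (int (e P q)) (frag_of P))"

lemma lookup_E:
  assumes "q \<in> Ht1 S"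
  shows "Poly_Mapping.lookup (E q) P = (if P \<in> Over q then int (e P q) else 0)"
proof -
  have "Poly_Mapping.lookup (E q) P = (\<Sum>Q\<in>Over q. if P = Q then int (e Q q) else 0)"
    unfolding E_def lookup_sum by (rule sum.cong) auto
  then show ?thesis using Over_finite[OF assms] by simp
qed

text \<open>Coordinates for \<open>Estar\<close>, as \<open>Estar_iff\<close> shows. Coefficients at
  primes whose contraction has height at least two are unrestricted, each such prime being a
  generator by itself.\<close>

definition Estar_like :: "('k set \<Rightarrow>\<^sub>0 int) \<Rightarrow> bool" where
  "Estar_like D \<longleftrightarrow> Poly_Mapping.keys D \<subseteq> Ht1 R \<and>
     (\<forall>q\<in>Ht1 S. \<exists>n. \<forall>P\<in>Over q. Poly_Mapping.lookup D P = int (e P q) * n) \<and>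
     (\<forall>P\<in>Ht1 R. P \<inter> S = {0} \<longrightarrow> Poly_Mapping.lookup D P = 0)"

lemma Estar_like_add:
  assumes "Estar_like D" "Estar_like D'"
  shows "Estar_like (D + D')"
  unfolding Estar_like_def
proof (intro conjI ballI impI)
  show "Poly_Mapping.keys (D + D') \<subseteq> Ht1 R"
    using assms keys_add[of D D'] by (auto simp: Estar_like_def)
  show "\<exists>n. \<forall>P\<in>Over q. Poly_Mapping.lookup (D + D') P = int (e P q) * n" if q: "q \<in> Ht1 S" for q
  proof -
    obtain n where "\<forall>P\<in>Over q. Poly_Mapping.lookup D P = int (e P q) * n"
      using assms(1) q unfolding Estar_like_def by blast
    moreover obtain n' where "\<forall>P\<in>Over q. Poly_Mapping.lookup D' P = int (e P q) * n'"
      using assms(2) q unfolding Estar_like_def by blast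
    ultimately show ?thesis by (intro exI[of _ "n + n'"]) (simp add: lookup_add distrib_left)
  qed
  show "Poly_Mapping.lookup (D + D') P = 0" if "P \<in> Ht1 R" "P \<inter> S = {0}" for P
    using assms that unfolding Estar_like_def lookup_add by fastforce
qed

lemma Estar_like_uminus:
  assumes "Estar_like D"
  shows "Estar_like (- D)"
  unfolding Estar_like_def
proof (intro conjI ballI impI)
  show "Poly_Mapping.keys (- D) \<subseteq> Ht1 R" using assms unfolding Estar_like_def by simp
  show "\<exists>n. \<forall>P\<in>Over q. Poly_Mapping.lookup (- D) P = int (e P q) * n" if q: "q \<in> Ht1 S" for q
  proof -
    obtain n where "\<forall>P\<in>Over q. Poly_Mapping.lookup D P = int (e P q) * n"
      using assms q unfolding Estar_like_def by blast
    then show ?thesis by (intro exI[of _ "- n"]) simp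
  qed
  show "Poly_Mapping.lookup (- D) P = 0" if "P \<in> Ht1 R" "P \<inter> S = {0}" for P
    using assms that unfolding Estar_like_def by fastforce
qed

lemma Estar_like_E:
  assumes q: "q \<in> Ht1 S"
  shows "Estar_like (E q)"
  unfolding Estar_like_def
proof (intro conjI ballI impI)
  show "Poly_Mapping.keys (E q) \<subseteq> Ht1 R"
    using lookup_E[OF q] by (auto simp: in_keys_iff Over_iff split: if_splits)
  fix q' assume "q' \<in> Ht1 S"
  show "\<exists>n. \<forall>P\<in>Over q'. Poly_Mapping.lookup (E q) P = int (e P q') * n"
    using lookup_E[OF q] by (cases "q' = q") (auto simp: Over_iff intro: exI[of _ 1])
next
  fix P assume "P \<in> Ht1 R" "P \<inter> S = {0}"
  then have "P \<notin> Over q" using q by (auto simp: Over_iff S.Ht1_iff)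
  then show "Poly_Mapping.lookup (E q) P = 0" using lookup_E[OF q] by simp
qed

lemma Estar_like_frag_of: "P \<in> Ht1_ge2 R S \<Longrightarrow> Estar_like (frag_of P)"
  by (auto simp: Estar_like_def Ht1_ge2_iff Over_iff intro!: exI[of _ 0])

lemma Estar_subgroup: "subgroup (Estar R S) (Div R)"
proof -
  have "E ` Ht1 S \<union> frag_of ` Ht1_ge2 R S \<subseteq> carrier (Div R)"
    using Estar_like_E Estar_like_frag_of by (auto simp: Estar_like_def subset_iff)
  then show ?thesis
    unfolding Estar_def E_def
    using group.generate_is_subgroup[OF comm_group.axioms(2)[OF R.Div_group]] by blast
qed

lemma Estar_iff: "D \<in> Estar R S \<longleftrightarrow> Estar_like D"
proof
  assume "D \<in> Estar R S"
  then have "D \<in> generate (Div R) (E ` Ht1 S \<union> frag_of ` Ht1_ge2 R S)"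
    by (simp add: Estar_def E_def)
  then show "Estar_like D"
  proof (induction rule: generate.induct)
    case one
    show ?case by (auto simp: Estar_like_def intro: exI[of _ 0])
  next
    case (incl h)
    then show ?case using Estar_like_E Estar_like_frag_of by blast
  next
    case (inv h)
    then have h: "Estar_like h" using Estar_like_E Estar_like_frag_of by blast
    then have "inv\<^bsub>Div R\<^esub> h = - h" by (intro R.Div_inv) (simp add: Estar_like_def)
    then show ?case using Estar_like_uminus[OF h] by simp
  next
    case (eng h h')
    then show ?case by (simp add: Estar_like_add)
  qed
next
  assume D: "Estar_like D"
  obtain n where n: "\<And>q P. q \<in> Ht1 S \<Longrightarrow> P \<in> Over q \<Longrightarrow> Poly_Mapping.lookup D P = int (e P q) * n q"
    using D unfolding Estar_like_def by metis
  \<comment> \<open>\<open>T\<close> and \<open>U\<close> collect the finitely many generators that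
    occur: the height one primes below the support, and the primes of the support with contraction
    of height at least two. Primes over zero carry no coefficient by assumption.\<close>
  define T where "T = (\<lambda>P. P \<inter> S) ` Poly_Mapping.keys D \<inter> Ht1 S"
  define U where "U = Poly_Mapping.keys D \<inter> Ht1_ge2 R S"
  have fin: "finite T" "finite U" by (auto simp: T_def U_def)
  have eq: "D = (\<Sum>q\<in>T. frag_cmul (n q) (E q)) + (\<Sum>P\<in>U. frag_cmul (Poly_Mapping.lookup D P) (frag_of P))"
  proof (rule poly_mapping_eqI)
    fix P
    have "Poly_Mapping.lookup (\<Sum>q\<in>T. frag_cmul (n q) (E q)) P =
        (\<Sum>q\<in>T. if P \<inter> S = q then (if P \<in> Ht1 R then n q * int (e P q) else 0) else 0)"
      unfolding lookup_sum by (rule sum.cong) (auto simp: lookup_E T_def Over_iff)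
    also have "\<dots> = (if P \<inter> S \<in> T \<and> P \<in> Ht1 R then n (P \<inter> S) * int (e P (P \<inter> S)) else 0)"
      using fin by simp
    finally have 1: "Poly_Mapping.lookup (\<Sum>q\<in>T. frag_cmul (n q) (E q)) P =
        (if P \<inter> S \<in> T \<and> P \<in> Ht1 R then n (P \<inter> S) * int (e P (P \<inter> S)) else 0)" .
    have "Poly_Mapping.lookup (\<Sum>Q\<in>U. frag_cmul (Poly_Mapping.lookup D Q) (frag_of Q)) P =
        (\<Sum>Q\<in>U. if P = Q then Poly_Mapping.lookup D Q else 0)"
      unfolding lookup_sum by (rule sum.cong) auto
    then have 2: "Poly_Mapping.lookup (\<Sum>Q\<in>U. frag_cmul (Poly_Mapping.lookup D Q) (frag_of Q)) P =
        (if P \<in> U then Poly_Mapping.lookup D P else 0)"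
      using fin by simp
    have "Poly_Mapping.lookup D P = (if P \<inter> S \<in> T \<and> P \<in> Ht1 R then n (P \<inter> S) * int (e P (P \<inter> S)) else 0)
        + (if P \<in> U then Poly_Mapping.lookup D P else 0)"
    proof (cases "P \<in> Poly_Mapping.keys D")
      case True
      then have P: "P \<in> Ht1 R" and nz: "P \<inter> S \<noteq> {0}" using D by (auto simp: Estar_like_def in_keys_iff)
      show ?thesis
      proof (cases "P \<inter> S \<in> Ht1 S")
        case H: True
        have "P \<inter> S \<in> T" using H True by (simp add: T_def)
        moreover have "P \<notin> U" using H by (simp add: U_def Ht1_ge2_iff)
        ultimately show ?thesis using n[OF H, of P] P by (simp add: Over_iff mult.commute)
      next
        case H: False
        have "P \<inter> S \<notin> T" "P \<in> U" using H True P nz by (simp_all add: T_def U_def Ht1_ge2_iff)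
        then show ?thesis by simp
      qed
    next
      case False
      then have z: "Poly_Mapping.lookup D P = 0" by (simp add: in_keys_iff)
      have "n (P \<inter> S) * int (e P (P \<inter> S)) = 0" if "P \<inter> S \<in> T" "P \<in> Ht1 R"
        using n[of "P \<inter> S" P] z that by (simp add: T_def Over_iff mult.commute)
      then show ?thesis using z by simp
    qed
    then show "Poly_Mapping.lookup D P = Poly_Mapping.lookup
        ((\<Sum>q\<in>T. frag_cmul (n q) (E q)) + (\<Sum>P\<in>U. frag_cmul (Poly_Mapping.lookup D P) (frag_of P))) P"
      unfolding lookup_add 1 2 .
  qed
  have sg: "subgroup (Estar R S) (free_Abelian_group (Ht1 R))"
    using Estar_subgroup by (simp add: Div_def)
  have "E q \<in> Estar R S" if "q \<in> T" for q
    unfolding Estar_def E_def using that by (intro generate.incl) (simp add: T_def)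
  moreover have "frag_of P \<in> Estar R S" if "P \<in> U" for P
    unfolding Estar_def using that by (intro generate.incl) (simp add: U_def)
  ultimately have "(\<Sum>q\<in>T. frag_cmul (n q) (E q)) \<in> Estar R S"
    "(\<Sum>P\<in>U. frag_cmul (Poly_Mapping.lookup D P) (frag_of P)) \<in> Estar R S"
    by (auto intro!: free_Abelian_subgroup_sum[OF sg] free_Abelian_subgroup_cmul[OF sg])
  then have "(\<Sum>q\<in>T. frag_cmul (n q) (E q)) + (\<Sum>P\<in>U. frag_cmul (Poly_Mapping.lookup D P) (frag_of P)) \<in> Estar R S"
    using subgroup.m_closed[OF sg] by simp
  then show "D \<in> Estar R S" by (subst eq)
qed

text \<open>
  \<open>coef q f\<close> is the largest multiple of \<open>E q\<close> that can be split off from the divisor of a good \<open>f\<close>.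
  For a relative invariant \<open>f\<close> of a cocycle \<open>\<chi>\<close> in the statement, \<open>Dmin f\<close> is \<open>D(\<chi>)\<close> and
  \<open>- Cdiv f\<close> represents the class of \<open>R\<^sub>\<chi>\<close>.
\<close>

definition good :: "'k \<Rightarrow> bool" where
  "good f \<longleftrightarrow> f \<in> R.Fr \<and> f \<noteq> 0 \<and> (\<forall>P\<in>Ht1 R. P \<inter> S = {0} \<longrightarrow> v P f = 0) \<and>
     (\<forall>q\<in>Ht1 S. \<forall>P\<in>Over q. int (e P q) dvd v P f)"

definition coef :: "'k set \<Rightarrow> 'k \<Rightarrow> int" where
  "coef q f = Min ((\<lambda>P. v P f div int (e P q)) ` Over q)"

definition Cdiv :: "'k \<Rightarrow> ('k set \<Rightarrow>\<^sub>0 int)" where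
  "Cdiv f = Abs_poly_mapping (\<lambda>q. if q \<in> Ht1 S then coef q f else 0)"

definition Dmin :: "'k \<Rightarrow> ('k set \<Rightarrow>\<^sub>0 int)" where
  "Dmin f = Abs_poly_mapping (\<lambda>P. if P \<in> {P \<in> Ht1 R. P \<inter> S \<in> Ht1 S}
     then v P f - int (e P (P \<inter> S)) * coef (P \<inter> S) f else 0)"

context
  fixes f
  assumes f: "good f"
begin

lemma good_Fr: "f \<in> R.Fr" "f \<noteq> 0"
  using f by (simp_all add: good_def)

lemma good_dvd: "q \<in> Ht1 S \<Longrightarrow> P \<in> Over q \<Longrightarrow> int (e P q) dvd v P f"
  using f unfolding good_def by blast

lemma good_zero: "P \<in> Ht1 R \<Longrightarrow> P \<inter> S = {0} \<Longrightarrow> v P f = 0"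
  using f unfolding good_def by blast

lemma coef_le: "q \<in> Ht1 S \<Longrightarrow> P \<in> Over q \<Longrightarrow> int (e P q) * coef q f \<le> v P f"
proof -
  assume q: "q \<in> Ht1 S" and P: "P \<in> Over q"
  have "coef q f \<le> v P f div int (e P q)"
    unfolding coef_def using Over_finite[OF q] P by (intro Min_le) auto
  then have "int (e P q) * coef q f \<le> int (e P q) * (v P f div int (e P q))"
    by (intro mult_left_mono) auto
  then show ?thesis using good_dvd[OF q P] by simp
qed

text \<open>Divisibility of the values by the ramification indices, part of \<open>good\<close>,
  makes the minimal integer quotient an exact one.\<close>

lemma coef_attained: "q \<in> Ht1 S \<Longrightarrow> \<exists>P\<in>Over q. v P f = int (e P q) * coef q f"
proof -
  assume q: "q \<in> Ht1 S"
  have "coef q f \<in> (\<lambda>P. v P f div int (e P q)) ` Over q"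
    unfolding coef_def using Over_finite[OF q] Over_nonempty[OF q] by (intro Min_in) auto
  then obtain P where P: "P \<in> Over q" "coef q f = v P f div int (e P q)" by blast
  have "v P f = int (e P q) * coef q f" unfolding P(2) using good_dvd[OF q P(1)] by simp
  then show ?thesis using P(1) by blast
qed

lemma finite_coef: "finite {q \<in> Ht1 S. coef q f \<noteq> 0}"
proof -
  have "{q \<in> Ht1 S. coef q f \<noteq> 0} \<subseteq> (\<lambda>P. P \<inter> S) ` {P \<in> Ht1 R. v P f \<noteq> 0}"
  proof
    fix q assume q: "q \<in> {q \<in> Ht1 S. coef q f \<noteq> 0}"
    then obtain P where P: "P \<in> Over q" "v P f = int (e P q) * coef q f"
      using coef_attained by blast
    then have "v P f \<noteq> 0" using ram_index(1)[of q P] q by simp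
    then show "q \<in> (\<lambda>P. P \<inter> S) ` {P \<in> Ht1 R. v P f \<noteq> 0}"
      using P by (intro image_eqI[of _ _ P]) (auto simp: Over_iff)
  qed
  then show ?thesis using R.finite_support[OF good_Fr] by (meson finite_imageI finite_subset)
qed

lemma lookup_Cdiv: "Poly_Mapping.lookup (Cdiv f) q = (if q \<in> Ht1 S then coef q f else 0)"
  unfolding Cdiv_def by (rule lookup_Abs_if[OF finite_coef])

lemma Cdiv_Div: "Cdiv f \<in> carrier (Div S)"
  using lookup_Cdiv by (auto simp: in_keys_iff split: if_splits)

lemma lookup_Dmin:
  "Poly_Mapping.lookup (Dmin f) P = (if P \<in> Ht1 R \<and> P \<inter> S \<in> Ht1 S
     then v P f - int (e P (P \<inter> S)) * coef (P \<inter> S) f else 0)"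
proof -
  let ?Y = "{P \<in> Ht1 R. P \<inter> S \<in> Ht1 S}"
  have "{P \<in> ?Y. v P f - int (e P (P \<inter> S)) * coef (P \<inter> S) f \<noteq> 0} \<subseteq>
      {P \<in> Ht1 R. v P f \<noteq> 0} \<union> (\<Union>q\<in>{q \<in> Ht1 S. coef q f \<noteq> 0}. Over q)"
    by (auto simp: Over_iff)
  moreover have "finite ({P \<in> Ht1 R. v P f \<noteq> 0} \<union> (\<Union>q\<in>{q \<in> Ht1 S. coef q f \<noteq> 0}. Over q))"
    using R.finite_support[OF good_Fr] finite_coef Over_finite by simp
  ultimately have "finite {P \<in> ?Y. v P f - int (e P (P \<inter> S)) * coef (P \<inter> S) f \<noteq> 0}"
    by (rule finite_subset)
  from lookup_Abs_if[OF this, of P] show ?thesis by (simp add: Dmin_def)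
qed

lemma Dmin_Div: "Dmin f \<in> carrier (Div R)"
  using lookup_Dmin by (auto simp: in_keys_iff split: if_splits)

lemma Dmin_effective: "effective (Dmin f)"
  unfolding effective_def lookup_Dmin using coef_le by (auto simp: Over_iff)

lemma pdiv_minus_Dmin: "pdiv R f - Dmin f \<in> Estar R S"
  unfolding Estar_iff Estar_like_def
proof (intro conjI ballI impI)
  show "Poly_Mapping.keys (pdiv R f - Dmin f) \<subseteq> Ht1 R"
    by (auto simp: in_keys_iff lookup_minus lookup_Dmin R.lookup_pdiv[OF good_Fr] split: if_splits)
  show "\<exists>n. \<forall>P\<in>Over q. Poly_Mapping.lookup (pdiv R f - Dmin f) P = int (e P q) * n" if "q \<in> Ht1 S" for q
    using that
    by (intro exI[of _ "coef q f"]) (auto simp: lookup_minus lookup_Dmin R.lookup_pdiv[OF good_Fr] Over_iff)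
  show "Poly_Mapping.lookup (pdiv R f - Dmin f) P = 0" if "P \<in> Ht1 R" "P \<inter> S = {0}" for P
    using that good_zero by (simp add: lookup_minus lookup_Dmin R.lookup_pdiv[OF good_Fr] S.Ht1_iff)
qed

text \<open>Over \<open>q\<close> the difference is \<open>coef q f\<close> times the ramification
  indices, and a prime where the minimum is attained shows \<open>coef q f\<close> to be
  nonnegative. Elsewhere \<open>Dmin f\<close> is 0 and the integrality of \<open>f\<close>
  suffices.\<close>

lemma effective_pdiv_minus_Dmin:
  assumes fR: "f \<in> R"
  shows "effective (pdiv R f - Dmin f)"
  unfolding effective_def
proof
  fix P
  show "0 \<le> Poly_Mapping.lookup (pdiv R f - Dmin f) P"
  proof (cases "P \<in> Ht1 R \<and> P \<inter> S \<in> Ht1 S")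
    case True
    then obtain Q where Q: "Q \<in> Over (P \<inter> S)" "v Q f = int (e Q (P \<inter> S)) * coef (P \<inter> S) f"
      using coef_attained by blast
    then have "0 \<le> int (e Q (P \<inter> S)) * coef (P \<inter> S) f"
      using R.v_nonneg[of Q, OF _ fR good_Fr(2)] by (simp add: Over_iff)
    then have "0 \<le> coef (P \<inter> S) f" using ram_index(1)[OF _ Q(1)] True by (simp add: zero_le_mult_iff)
    then show ?thesis using True by (simp add: lookup_minus lookup_Dmin R.lookup_pdiv[OF good_Fr])
  next
    case False
    then show ?thesis using R.v_nonneg[of P, OF _ fR good_Fr(2)]
      by (auto simp: lookup_minus lookup_Dmin R.lookup_pdiv[OF good_Fr])
  qed
qed

text \<open>Each fibre contains a prime at which \<open>Dmin f\<close> vanishes. An effective part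
  from \<open>Estar\<close> has one common multiplier along the fibre, which the vanishing at that
  prime forces to be 0.\<close>

lemma minimal_effective_Dmin: "minimal_effective R S (Dmin f)"
  unfolding minimal_effective_def
proof (intro conjI allI impI Dmin_Div Dmin_effective)
  fix D1 D2
  assume "D1 \<in> Estar R S \<and> effective D1 \<and> D2 \<in> carrier (Div R) \<and> effective D2 \<and> Dmin f = D1 + D2"
  then have D1: "Estar_like D1" "effective D1" and D2: "effective D2" and eq: "Dmin f = D1 + D2"
    by (auto simp: Estar_iff)
  have le: "Poly_Mapping.lookup D1 P \<le> Poly_Mapping.lookup (Dmin f) P" for P
    unfolding eq using D2 by (simp add: lookup_add effective_def)
  have nn: "0 \<le> Poly_Mapping.lookup D1 P" for P using D1 by (simp add: effective_def)
  show "D1 = 0"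
  proof (rule poly_mapping_eqI)
    fix P
    show "Poly_Mapping.lookup D1 P = Poly_Mapping.lookup 0 P"
    proof (cases "P \<in> Ht1 R \<and> P \<inter> S \<in> Ht1 S")
      case True
      then have P: "P \<in> Over (P \<inter> S)" "P \<inter> S \<in> Ht1 S" by (simp_all add: Over_iff)
      obtain n where n: "\<forall>Q\<in>Over (P \<inter> S). Poly_Mapping.lookup D1 Q = int (e Q (P \<inter> S)) * n"
        using D1(1) P unfolding Estar_like_def by blast
      obtain Q where Q: "Q \<in> Over (P \<inter> S)" "v Q f = int (e Q (P \<inter> S)) * coef (P \<inter> S) f"
        using coef_attained P by blast
      then have "Q \<in> Ht1 R" "Q \<inter> S = P \<inter> S" by (simp_all add: Over_iff)
      then have "Poly_Mapping.lookup (Dmin f) Q = 0" using Q P by (simp add: lookup_Dmin)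
      then have "int (e Q (P \<inter> S)) * n = 0" using le[of Q] nn[of Q] n Q by simp
      then have "n = 0" using ram_index(1)[OF P(2) Q(1)] by simp
      then show ?thesis using n P by simp
    next
      case False
      then have "Poly_Mapping.lookup (Dmin f) P = 0" unfolding lookup_Dmin by (rule if_not_P)
      then show ?thesis using le[of P] nn[of P] by simp
    qed
  qed
qed

text \<open>Along a fibre, \<open>D\<close> has coefficients \<open>v Q f - e Q q * n\<close> for
  one integer \<open>n\<close>. Effectivity at a prime attaining the minimum gives
  \<open>n \<le> coef q f\<close>, and strict inequality would allow \<open>E q\<close> to be split
  off. Off these fibres, a nonzero coefficient either permits splitting off a prime of
  \<open>Ht1_ge2\<close> or contradicts the vanishing over zero.\<close>

lemma minimal_effective_unique:
  assumes D: "minimal_effective R S D" and diff: "pdiv R f - D \<in> Estar R S"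
  shows "D = Dmin f"
proof -
  have Dk: "Poly_Mapping.keys D \<subseteq> Ht1 R" and De: "\<And>P. 0 \<le> Poly_Mapping.lookup D P"
    using D by (auto simp: minimal_effective_def effective_def)
  have min: "D1 = 0" if "Estar_like D1" "effective D1" "effective (D - D1)" for D1
  proof -
    have "Poly_Mapping.keys (D - D1) \<subseteq> Ht1 R"
      using keys_diff[of D D1] Dk that(1) by (auto simp: Estar_like_def)
    moreover have "D = D1 + (D - D1)" by simp
    ultimately show ?thesis
      using D that unfolding minimal_effective_def by (metis Estar_iff R.Div_simps(1))
  qed
  show ?thesis
  proof (rule poly_mapping_eqI)
    fix P
    show "Poly_Mapping.lookup D P = Poly_Mapping.lookup (Dmin f) P"
    proof (cases "P \<in> Ht1 R \<and> P \<inter> S \<in> Ht1 S")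
      case True
      define q where "q = P \<inter> S"
      have q: "q \<in> Ht1 S" and P: "P \<in> Over q" using True by (simp_all add: q_def Over_iff)
      obtain n where "\<forall>Q\<in>Over q. Poly_Mapping.lookup (pdiv R f - D) Q = int (e Q q) * n"
        using diff q unfolding Estar_iff Estar_like_def by blast
      then have n: "Poly_Mapping.lookup D Q = v Q f - int (e Q q) * n" if "Q \<in> Over q" for Q
        using that by (fastforce simp: lookup_minus R.lookup_pdiv[OF good_Fr] Over_iff)
      obtain Q where Q: "Q \<in> Over q" "v Q f = int (e Q q) * coef q f"
        using coef_attained[OF q] by blast
      have "0 \<le> int (e Q q) * (coef q f - n)"
        using De[of Q] n[OF Q(1)] Q(2) by (simp add: algebra_simps)
      then have "n \<le> coef q f" using ram_index(1)[OF q Q(1)] by (simp add: zero_le_mult_iff)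
      moreover have "\<not> n < coef q f"
      proof
        assume lt: "n < coef q f"
        have "effective (D - E q)"
          unfolding effective_def
        proof
          fix Q'
          show "0 \<le> Poly_Mapping.lookup (D - E q) Q'"
          proof (cases "Q' \<in> Over q")
            case True
            have "int (e Q' q) * (n + 1) \<le> int (e Q' q) * coef q f"
              using lt by (intro mult_left_mono) auto
            also have "\<dots> \<le> v Q' f" by (rule coef_le[OF q True])
            finally show ?thesis using True n[OF True] by (simp add: lookup_minus lookup_E[OF q] algebra_simps)
          next
            case False
            then show ?thesis using De by (simp add: lookup_minus lookup_E[OF q])
          qed
        qed
        moreover have "effective (E q)" by (simp add: effective_def lookup_E[OF q])
        ultimately have "E q = 0" using min Estar_like_E[OF q] by blast
        then have "int (e Q q) = 0" using lookup_E[OF q, of Q] Q(1) by simp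
        then show False using ram_index(1)[OF q Q(1)] by simp
      qed
      ultimately have "n = coef q f" by simp
      then show ?thesis using n[OF P] True by (simp add: lookup_Dmin q_def)
    next
      case False
      then have z: "Poly_Mapping.lookup (Dmin f) P = 0" unfolding lookup_Dmin by (rule if_not_P)
      have "Poly_Mapping.lookup D P = 0"
      proof (rule ccontr)
        assume nz: "Poly_Mapping.lookup D P \<noteq> 0"
        then have P: "P \<in> Ht1 R" using Dk by (auto simp: in_keys_iff)
        have "P \<inter> S \<noteq> {0}"
        proof
          assume 0: "P \<inter> S = {0}"
          then have "Poly_Mapping.lookup (pdiv R f - D) P = 0"
            using diff P unfolding Estar_iff Estar_like_def by blast
          moreover have "v P f = 0" by (rule good_zero[OF P 0])
          ultimately show False using nz P by (simp add: lookup_minus R.lookup_pdiv[OF good_Fr])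
        qed
        then have "P \<in> Ht1_ge2 R S" using P False by (simp add: Ht1_ge2_iff)
        moreover have "effective (D - frag_of P)"
          unfolding effective_def lookup_minus lookup_frag_of
        proof
          fix Q show "0 \<le> Poly_Mapping.lookup D Q - (if Q = P then 1 else 0)"
            using De[of Q] nz by auto
        qed
        moreover have "effective (frag_of P)" by (simp add: effective_def)
        ultimately have "frag_of P = 0" using min Estar_like_frag_of by blast
        then show False by simp
      qed
      then show ?thesis using z by simp
    qed
  qed
qed

end

text \<open>\<open>Msat f\<close> is the module of relative invariants attached to the same cocycle as \<open>f\<close>.\<close>

definition Msat :: "'k \<Rightarrow> 'k set" where
  "Msat f = {x \<in> R. x / f \<in> K}"

lemma good_scale:
  assumes f: "good f" and k: "k \<in> K" "k \<noteq> 0"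
  shows "good (f * k)"
  unfolding good_def
proof (intro conjI ballI impI)
  note fF = good_Fr[OF f]
  show "f * k \<in> R.Fr" "f * k \<noteq> 0" using fF k K_Fr R.frac_mult by auto
  show "v P (f * k) = 0" if "P \<in> Ht1 R" "P \<inter> S = {0}" for P
    using that k fF K_Fr v_zero_of_contract_zero[of P k] good_zero[OF f] by (simp add: R.v_mult)
  show "int (e P q) dvd v P (f * k)" if "q \<in> Ht1 S" "P \<in> Over q" for P q
    using that k fF K_Fr ram_index(2)[OF that k] good_dvd[OF f that] by (simp add: R.v_mult Over_iff)
qed

lemma pdiv_K_Estar:
  assumes k: "k \<in> K" "k \<noteq> 0"
  shows "pdiv R k \<in> Estar R S"
  unfolding Estar_iff Estar_like_def
proof (intro conjI ballI impI)
  show "Poly_Mapping.keys (pdiv R k) \<subseteq> Ht1 R" using R.pdiv_Div[OF K_Fr] k by auto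
  show "\<exists>n. \<forall>P\<in>Over q. Poly_Mapping.lookup (pdiv R k) P = int (e P q) * n" if "q \<in> Ht1 S" for q
    using that k K_Fr ram_index(2)[OF that]
    by (intro exI[of _ "w q k"]) (simp add: R.lookup_pdiv Over_iff)
  show "Poly_Mapping.lookup (pdiv R k) P = 0" if "P \<in> Ht1 R" "P \<inter> S = {0}" for P
    using that k K_Fr v_zero_of_contract_zero[OF that k] by (simp add: R.lookup_pdiv)
qed

text \<open>A nonzero member of \<open>Msat f\<close> differs from \<open>f\<close> by a factor from
  \<open>K\<close>, whose divisor belongs to \<open>Estar\<close>; so D(\<chi>) does not depend on
  the element chosen in its definition.\<close>

lemma Dmin_unique_Msat:
  assumes f: "good f" and D: "minimal_effective R S D"
    and x: "x \<in> Msat f" "x \<noteq> 0" and diff: "pdiv R x - D \<in> Estar R S"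
  shows "D = Dmin f"
proof (rule minimal_effective_unique[OF f D])
  note fF = good_Fr[OF f]
  have k: "f / x \<in> K" "f / x \<noteq> 0" using S.frac_inverse[of "x / f"] x fF by (auto simp: Msat_def)
  have xF: "x \<in> R.Fr" using x R.mem_frac by (simp add: Msat_def)
  have "pdiv R f - D = (pdiv R x - D) + pdiv R (f / x)"
    using R.pdiv_divide[OF fF xF x(2)] by simp
  then show "pdiv R f - D \<in> Estar R S"
    using subgroup.m_closed[OF Estar_subgroup diff pdiv_K_Estar[OF k]] by (simp add: algebra_simps)
qed

text \<open>At a prime over \<open>q\<close> where \<open>coef q f\<close> is attained, this is
  \<open>v P x \<ge> 0\<close> divided by the ramification index.\<close>

lemma Msat_nonneg:
  assumes f: "good f" and q: "q \<in> Ht1 S" and x: "x \<in> Msat f" "x \<noteq> 0"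
  shows "- coef q f \<le> w q (x / f)"
proof -
  obtain P where P: "P \<in> Over q" "v P f = int (e P q) * coef q f"
    using coef_attained[OF f q] by blast
  have P1: "P \<in> Ht1 R" using P by (simp add: Over_iff)
  have xR: "x \<in> R" and k: "x / f \<in> K" "x / f \<noteq> 0" using x good_Fr[OF f] by (auto simp: Msat_def)
  have "int (e P q) * w q (x / f) = v P (x / f)" using ram_index(2)[OF q P(1) k] by simp
  also have "\<dots> = v P x - v P f" using R.v_divide[OF P1 R.mem_frac[OF xR] x(2) good_Fr[OF f]] .
  finally have "0 \<le> int (e P q) * (w q (x / f) + coef q f)"
    using R.v_nonneg[OF P1 xR x(2)] P(2) by (simp add: algebra_simps)
  then show ?thesis using ram_index(1)[OF q P(1)] by (simp add: zero_le_mult_iff)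
qed

text \<open>Multiplying \<open>f\<close> by the power \<open>- coef q f\<close> of a uniformizer
  makes it integral along the fibre over \<open>q\<close>; the remaining poles do not contract into
  \<open>q\<close> and are cleared by an \<open>s\<close> of value 0 at \<open>q\<close>.\<close>

lemma Msat_attained:
  assumes f: "good f" and q: "q \<in> Ht1 S"
  shows "\<exists>x\<in>Msat f. x \<noteq> 0 \<and> w q (x / f) = - coef q f"
proof -
  obtain t where t: "t \<in> K" "t \<noteq> 0" "w q t = 1" using S.v_uniformizer[OF q] .
  define k where "k = t powi (- coef q f)"
  have k: "k \<in> K" "k \<noteq> 0" "w q k = - coef q f"
    using t S.is_val_powi[OF S.is_val[OF q] S.Ht1_prime[OF q] t(1,2)]
    by (simp_all add: k_def S.frac_powi power_int_eq_0_iff)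
  note fF = good_Fr[OF f]
  have g: "good (f * k)" by (rule good_scale[OF f k(1,2)])
  note gF = good_Fr[OF g]
  have "\<not> P \<inter> S \<subseteq> q" if P: "P \<in> Ht1 R" "v P (f * k) < 0" for P
  proof
    assume "P \<inter> S \<subseteq> q"
    then consider "P \<inter> S = {0}" | "P \<inter> S = q"
      using q contract_prime[OF P(1)] unfolding S.Ht1_iff by blast
    then show False
    proof cases
      case 1
      then show False using good_zero[OF g P(1)] P(2) by simp
    next
      case 2
      then have O: "P \<in> Over q" using P(1) by (simp add: Over_iff)
      have "v P (f * k) = v P f - int (e P q) * coef q f"
        using R.v_mult[OF P(1) fF K_Fr[OF k(1)] k(2)] ram_index(2)[OF q O k(1,2)] k(3) by simp
      then show False using coef_le[OF f q O] P(2) by simp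
    qed
  qed
  then obtain s where s: "s \<in> S" "s \<notin> q" "s \<noteq> 0" "s * (f * k) \<in> R"
    using R.clear_denominator[OF S.subdomain_axioms sub S.Ht1_prime[OF q] gF] by blast
  have e: "s * (f * k) / f = s * k" using fF by simp
  have sK: "s \<in> K" using s S.mem_frac by simp
  have "w q (s * k) = - coef q f"
    using S.v_mult[OF q sK s(3) k(1,2)] S.v_zero_iff[OF q s(1,3)] s(2) k(3) by simp
  moreover have "s * (f * k) \<in> Msat f"
    unfolding Msat_def using s(4) e S.frac_mult[OF sK k(1)] by simp
  ultimately show ?thesis
    using s(3) fF k(2) e by (intro bexI[of _ "s * (f * k)"]) simp_all
qed

text \<open>Multiplication by \<open>g\<close> embeds the module into \<open>S\<close>. By the two
  preceding lemmas the minimal value of the image at \<open>q\<close> is that of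
  \<open>f * g\<close> minus \<open>coef q f\<close>, and the contribution of \<open>f * g\<close>
  is principal.\<close>

lemma module_class_Msat:
  assumes f: "good f" "f \<in> R" and g: "g \<in> R" "f * g \<in> S" "g \<noteq> 0"
  shows "module_class S (Msat f) = div_class S (- Cdiv f)"
proof -
  note fF = good_Fr[OF f(1)]
  have fg: "f * g \<in> K" "f * g \<noteq> 0" using g fF S.mem_frac by auto
  have gx: "g * x = (f * g) * (x / f)" for x using fF by simp
  have wgx: "w q (g * x) = w q (f * g) + w q (x / f)" if "q \<in> Ht1 S" "x \<in> Msat f" "x \<noteq> 0" for q x
    unfolding gx using that fF by (intro S.v_mult fg) (auto simp: Msat_def)
  let ?D = "pdiv S (f * g) - Cdiv f"
  have keys: "Poly_Mapping.keys ?D \<subseteq> Ht1 S"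
    using keys_diff[of "pdiv S (f * g)" "Cdiv f"] S.pdiv_Div[OF fg] Cdiv_Div[OF f(1)] by auto
  have lk: "Poly_Mapping.lookup ?D q = w q (f * g) - coef q f" if "q \<in> Ht1 S" for q
    using that by (simp add: lookup_minus S.lookup_pdiv[OF fg] lookup_Cdiv[OF f(1)])
  have "module_class S (Msat f) = div_class S ?D"
  proof (rule S.module_class_eq[where c = g])
    show "f \<in> Msat f" using f fF S.mem_frac by (simp add: Msat_def)
    show "f \<noteq> 0" "g \<noteq> 0" by fact+
    show "x + y \<in> Msat f" if "x \<in> Msat f" "y \<in> Msat f" for x y
      using that R.add_mem S.frac_add by (simp add: Msat_def add_divide_distrib)
    show "0 \<in> Msat f" using S.mem_frac by (simp add: Msat_def)
    show "a * x \<in> Msat f" if "a \<in> S" "x \<in> Msat f" for a x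
    proof -
      have "a * (x / f) \<in> K" using S.frac_mult[OF S.mem_frac[OF that(1)]] that(2) unfolding Msat_def by blast
      then show ?thesis using that sub R.mult_mem by (auto simp: Msat_def)
    qed
    show "g * x \<in> S" if x: "x \<in> Msat f" for x
    proof (rule inter)
      show "g * x \<in> R" using x g R.mult_mem by (simp add: Msat_def)
      have "(f * g) * (x / f) \<in> K" using x S.frac_mult[OF fg(1)] unfolding Msat_def by blast
      then show "g * x \<in> K" by (simp only: gx)
    qed
    show "Poly_Mapping.keys ?D \<subseteq> Ht1 S" by (rule keys)
    show "\<exists>z\<in>Msat f. z \<noteq> 0 \<and> w q (g * z) = Poly_Mapping.lookup ?D q" if q: "q \<in> Ht1 S" for q
      using Msat_attained[OF f(1) q] wgx[OF q] lk[OF q] by fastforce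
    show "Poly_Mapping.lookup ?D q \<le> w q (g * x)" if "q \<in> Ht1 S" "x \<in> Msat f" "x \<noteq> 0" for q x
      using Msat_nonneg[OF f(1) that] wgx[OF that] lk[OF that(1)] by simp
  qed
  also have "\<dots> = div_class S (- Cdiv f)"
    using Cdiv_Div[OF f(1)] by (intro S.div_class_eq[OF _ fg]) simp_all
  finally show ?thesis .
qed

text \<open>The two sides correspond by \<open>y = f ^ m / h\<close>. Over zero and over height one
  primes the values of \<open>y\<close> follow from those of \<open>h\<close>. Where the contraction
  has height at least two, \<open>Div S\<close> gives no information, and the elements from
  \<open>ge2\<close> confine \<open>v P y\<close> to 0 from both sides.\<close>

lemma Cdiv_Prin_iff:
  assumes f: "good f" "f \<in> R" and m: "0 < m"
    and ge2: "\<And>P. P \<in> Ht1_ge2 R S \<Longrightarrow> \<exists>f'\<in>Msat f. f' \<notin> P"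
      "\<And>P. P \<in> Ht1_ge2 R S \<Longrightarrow> \<exists>g\<in>R. f * g \<in> K \<and> g \<notin> P"
  shows "frag_cmul (int m) (Cdiv f) \<in> Prin S \<longleftrightarrow>
     (\<exists>y\<in>Msat (f ^ m). y \<noteq> 0 \<and> pdiv R y = frag_cmul (int m) (Dmin f))"
proof
  note fF = good_Fr[OF f(1)]
  assume "frag_cmul (int m) (Cdiv f) \<in> Prin S"
  then obtain h where h: "h \<in> K" "h \<noteq> 0" and hd: "frag_cmul (int m) (Cdiv f) = pdiv S h"
    by (auto simp: S.Prin_iff)
  have wh: "w q h = int m * coef q f" if "q \<in> Ht1 S" for q
  proof -
    have "Poly_Mapping.lookup (frag_cmul (int m) (Cdiv f)) q = Poly_Mapping.lookup (pdiv S h) q"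
      by (simp only: hd)
    then show ?thesis using that by (simp add: lookup_Cdiv[OF f(1)] S.lookup_pdiv[OF h])
  qed
  have hF: "h \<in> R.Fr" by (rule K_Fr[OF h(1)])
  have fm: "f ^ m \<in> R.Fr" "f ^ m \<noteq> 0" using fF R.frac_power by auto
  define y where "y = f ^ m / h"
  have y: "y \<in> R.Fr" "y \<noteq> 0" using fm h hF R.frac_divide by (auto simp: y_def)
  have vy: "v P y = int m * v P f - v P h" if "P \<in> Ht1 R" for P
    unfolding y_def using R.v_divide[OF that fm hF h(2)] R.v_power[OF that fF] by simp
  have vy_Dmin: "v P y = int m * Poly_Mapping.lookup (Dmin f) P" if P: "P \<in> Ht1 R" for P
  proof -
    consider "P \<inter> S = {0}" | "P \<inter> S \<in> Ht1 S" | "P \<in> Ht1_ge2 R S" using P Ht1_ge2_iff by blast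
    then show ?thesis
    proof cases
      case 1
      then have "P \<inter> S \<notin> Ht1 S" by (simp add: S.Ht1_iff)
      then show ?thesis
        using vy[OF P] good_zero[OF f(1) P 1] v_zero_of_contract_zero[OF P 1 h] by (simp add: lookup_Dmin[OF f(1)])
    next
      case 2
      have O: "P \<in> Over (P \<inter> S)" using P by (simp add: Over_iff)
      show ?thesis
        using vy[OF P] ram_index(2)[OF 2 O h] wh[OF 2] P 2
        by (simp add: lookup_Dmin[OF f(1)] algebra_simps)
    next
      case 3
      then have D0: "Poly_Mapping.lookup (Dmin f) P = 0"
        by (simp add: Ht1_ge2_iff lookup_Dmin[OF f(1)])
      have PS: "P \<in> Ht1 R" "P \<inter> S \<notin> Ht1 S" using 3 by (simp_all add: Ht1_ge2_iff)
      \<comment> \<open>The access to \<open>P\<close> from the height one primes of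
        \<open>S\<close>: nonnegativity at those implies membership in \<open>S\<close>, hence in
        \<open>R\<close>.\<close>
      have integral: "0 \<le> v P z" if z: "z \<in> K" "z \<noteq> 0" "\<And>q. q \<in> Ht1 S \<Longrightarrow> 0 \<le> w q z" for z
        using S.mem_if_nonneg[OF z] sub R.v_nonneg[OF P _ z(2)] by blast
      obtain f' where f': "f' \<in> Msat f" "f' \<notin> P" using ge2(1)[OF 3] by blast
      have f'0: "f' \<noteq> 0" using f'(2) R.prime_ofD(2)[OF R.Ht1_prime[OF P]] by auto
      have f'R: "f' \<in> R" and k: "f' / f \<in> K" "f' / f \<noteq> 0" using f' f'0 fF by (auto simp: Msat_def)
      \<comment> \<open>Since \<open>f'\<close> has value 0 at \<open>P\<close>, this value is
        \<open>- v P y\<close>, giving the upper bound.\<close>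
      have "0 \<le> v P ((f' / f) ^ m * h)"
      proof (rule integral)
        show "(f' / f) ^ m * h \<in> K" "(f' / f) ^ m * h \<noteq> 0"
          using S.frac_mult[OF S.frac_power[OF k(1)] h(1)] k h by auto
        fix q assume q: "q \<in> Ht1 S"
        have "w q ((f' / f) ^ m * h) = int m * w q (f' / f) + w q h"
          using S.v_mult[OF q S.frac_power[OF k(1)] _ h] S.v_power[OF q k] k(2) by simp
        also have "\<dots> = int m * (w q (f' / f) + coef q f)" by (simp add: wh[OF q] distrib_left)
        finally show "0 \<le> w q ((f' / f) ^ m * h)"
          using Msat_nonneg[OF f(1) q f'(1) f'0] by simp
      qed
      moreover have "v P ((f' / f) ^ m * h) = int m * v P (f' / f) + v P h"
        using R.v_mult[OF P K_Fr[OF S.frac_power[OF k(1)]] _ hF h(2)] R.v_power[OF P K_Fr[OF k(1)] k(2)] k(2)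
        by simp
      moreover have "v P (f' / f) = - v P f"
        using R.v_divide[OF P R.mem_frac[OF f'R] f'0 fF] R.v_zero_iff[OF P f'R f'0] f'(2) by simp
      ultimately have le: "v P y \<le> 0" using vy[OF P] by simp
      obtain g where g: "g \<in> R" "f * g \<in> K" "g \<notin> P" using ge2(2)[OF 3] by blast
      have g0: "g \<noteq> 0" using g(3) R.prime_ofD(2)[OF R.Ht1_prime[OF P]] by auto
      have fg0: "f * g \<noteq> 0" using g0 fF by simp
      have vfg: "v Q (f * g) = v Q f + v Q g" if "Q \<in> Ht1 R" for Q
        by (rule R.v_mult[OF that fF R.mem_frac[OF g(1)] g0])
      \<comment> \<open>Since \<open>g\<close> has value 0 at \<open>P\<close>, this value equals
        \<open>v P y\<close>, giving the lower bound.\<close>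
      have "0 \<le> v P ((f * g) ^ m / h)"
      proof (rule integral)
        show "(f * g) ^ m / h \<in> K" "(f * g) ^ m / h \<noteq> 0"
          using S.frac_divide[OF S.frac_power[OF g(2)] h(1)] fg0 h by auto
        fix q assume q: "q \<in> Ht1 S"
        obtain Q where Q: "Q \<in> Over q" "v Q f = int (e Q q) * coef q f"
          using coef_attained[OF f(1) q] by blast
        have Q1: "Q \<in> Ht1 R" using Q by (simp add: Over_iff)
        have "0 \<le> int (e Q q) * (w q (f * g) - coef q f)"
          using vfg[OF Q1] Q(2) ram_index(2)[OF q Q(1) g(2) fg0] R.v_nonneg[OF Q1 g(1) g0]
          by (simp add: algebra_simps)
        then have "0 \<le> w q (f * g) - coef q f"
          using ram_index(1)[OF q Q(1)] by (simp add: zero_le_mult_iff)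
        then have "0 \<le> int m * (w q (f * g) - coef q f)" by simp
        also have "\<dots> = w q ((f * g) ^ m / h)"
          using S.v_divide[OF q S.frac_power[OF g(2)] _ h] S.v_power[OF q g(2) fg0] fg0 wh[OF q]
          by (simp add: right_diff_distrib)
        finally show "0 \<le> w q ((f * g) ^ m / h)" .
      qed
      also have "v P ((f * g) ^ m / h) = int m * v P (f * g) - v P h"
        using R.v_divide[OF P K_Fr[OF S.frac_power[OF g(2)]] _ hF h(2)] R.v_power[OF P K_Fr[OF g(2)] fg0] fg0
        by simp
      also have "\<dots> = v P y"
        using vfg[OF P] vy[OF P] R.v_zero_iff[OF P g(1) g0] g(3) by simp
      finally show ?thesis using le D0 by simp
    qed
  qed
  have yR: "y \<in> R"
  proof (rule R.mem_if_nonneg[OF y])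
    show "0 \<le> v P y" if "P \<in> Ht1 R" for P
      using vy_Dmin[OF that] Dmin_effective[OF f(1)] by (simp add: effective_def)
  qed
  have "y / f ^ m = inverse h" using fm h by (simp add: y_def field_simps)
  then have "y \<in> Msat (f ^ m)" using yR S.frac_inverse[OF h(1)] by (simp add: Msat_def)
  moreover have "pdiv R y = frag_cmul (int m) (Dmin f)"
  proof (rule poly_mapping_eqI)
    fix P show "Poly_Mapping.lookup (pdiv R y) P = Poly_Mapping.lookup (frag_cmul (int m) (Dmin f)) P"
      using vy_Dmin[of P] by (simp add: R.lookup_pdiv[OF y] lookup_Dmin[OF f(1)])
  qed
  ultimately show "\<exists>y\<in>Msat (f ^ m). y \<noteq> 0 \<and> pdiv R y = frag_cmul (int m) (Dmin f)"
    using y(2) by blast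
next
  note fF = good_Fr[OF f(1)]
  assume "\<exists>y\<in>Msat (f ^ m). y \<noteq> 0 \<and> pdiv R y = frag_cmul (int m) (Dmin f)"
  then obtain y where y: "y \<in> R" "y / f ^ m \<in> K" "y \<noteq> 0" and yd: "pdiv R y = frag_cmul (int m) (Dmin f)"
    by (auto simp: Msat_def)
  have yF: "y \<in> R.Fr" by (rule R.mem_frac[OF y(1)])
  have fm: "f ^ m \<in> R.Fr" "f ^ m \<noteq> 0" using fF R.frac_power by auto
  define h where "h = f ^ m / y"
  have h: "h \<in> K" "h \<noteq> 0" using S.frac_inverse[OF y(2)] y(3) fm by (auto simp: h_def)
  have wh: "w q h = int m * coef q f" if q: "q \<in> Ht1 S" for q
  proof -
    obtain P where P: "P \<in> Over q" using Over_nonempty[OF q] by blast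
    then have P1: "P \<in> Ht1 R" "P \<inter> S = q" by (simp_all add: Over_iff)
    have "Poly_Mapping.lookup (pdiv R y) P = Poly_Mapping.lookup (frag_cmul (int m) (Dmin f)) P"
      by (simp only: yd)
    then have "v P y = int m * (v P f - int (e P q) * coef q f)"
      using P1 q by (simp add: R.lookup_pdiv[OF yF y(3)] lookup_Dmin[OF f(1)])
    moreover have "int (e P q) * w q h = int m * v P f - v P y"
      using ram_index(2)[OF q P h] R.v_divide[OF P1(1) fm yF y(3)] R.v_power[OF P1(1) fF] by (simp add: h_def)
    moreover have "int m * (v P f - int (e P q) * coef q f) = int m * v P f - int (e P q) * (int m * coef q f)"
      by (simp add: algebra_simps)
    ultimately have "int (e P q) * w q h = int (e P q) * (int m * coef q f)"
      by linarith
    then show ?thesis using ram_index(1)[OF q P] by simp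
  qed
  have "frag_cmul (int m) (Cdiv f) = pdiv S h"
    using wh by (intro poly_mapping_eqI) (simp add: lookup_Cdiv[OF f(1)] S.lookup_pdiv[OF h])
  then show "frag_cmul (int m) (Cdiv f) \<in> Prin S" using h by (auto simp: S.Prin_iff)
qed

end

section \<open>Modules of rank one\<close>

text \<open>Each \<open>x\<close> in \<open>M\<close> is a fraction times \<open>m0\<close>, so
  every class is that of a pure tensor of some scalar with \<open>m0\<close>. That this line is
  nonzero is detected by the multiplication map into the ambient field.\<close>

lemma (in subdomain) rank_oneI:
  assumes m0: "m0 \<in> M" "m0 \<noteq> 0" and quot: "\<And>x. x \<in> M \<Longrightarrow> x / m0 \<in> Fr"
    and add: "\<And>x y. x \<in> M \<Longrightarrow> y \<in> M \<Longrightarrow> x + y \<in> M"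
    and scale: "\<And>a x. a \<in> A \<Longrightarrow> x \<in> M \<Longrightarrow> a * x \<in> M"
  shows "rank_one A M"
proof -
  let ?G = "free_Abelian_group (Fr \<times> M)"
  define B where "B = {frag_of (a + b, x) - frag_of (a, x) - frag_of (b, x) | a b x.
        a \<in> Fr \<and> b \<in> Fr \<and> x \<in> M} \<union>
      {frag_of (a, x + y) - frag_of (a, x) - frag_of (a, y) | a x y. a \<in> Fr \<and> x \<in> M \<and> y \<in> M} \<union>
      {frag_of (a * r, x) - frag_of (a, r * x) | a r x. a \<in> Fr \<and> r \<in> A \<and> x \<in> M}"
  define T where "T = generate ?G B"
  have T: "tensor_rel A M = T" by (simp add: T_def B_def tensor_rel_def)
  interpret G: comm_group ?G by (rule abelian_free_Abelian_group)
  have kd: "Poly_Mapping.keys (z - z') \<subseteq> Fr \<times> M"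
    if "Poly_Mapping.keys z \<subseteq> Fr \<times> M" "Poly_Mapping.keys z' \<subseteq> Fr \<times> M" for z z' :: "'k \<times> 'k \<Rightarrow>\<^sub>0 int"
    using keys_diff[of z z'] that by blast
  have BG: "B \<subseteq> carrier ?G"
  proof
    fix z assume z: "z \<in> B"
    consider a b x where "z = frag_of (a + b, x) - frag_of (a, x) - frag_of (b, x)" "a \<in> Fr" "b \<in> Fr" "x \<in> M"
      | a x y where "z = frag_of (a, x + y) - frag_of (a, x) - frag_of (a, y)" "a \<in> Fr" "x \<in> M" "y \<in> M"
      | a r x where "z = frag_of (a * r, x) - frag_of (a, r * x)" "a \<in> Fr" "r \<in> A" "x \<in> M"
      using z unfolding B_def by blast
    then have "Poly_Mapping.keys z \<subseteq> Fr \<times> M"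
      by cases (simp_all add: kd frac_add add frac_mult scale mem_frac)
    then show "z \<in> carrier ?G" by (simp only: carrier_free_Abelian_group_iff)
  qed
  have sub: "subgroup T ?G" unfolding T_def by (rule G.generate_is_subgroup[OF BG])
  have T_add: "z + z' \<in> T" if "z \<in> T" "z' \<in> T" for z z'
    using subgroup.m_closed[OF sub that] by simp
  have T_uminus: "- z \<in> T" if "z \<in> T" for z
  proof -
    have "z \<in> carrier ?G" using subgroup.mem_carrier[OF sub that] .
    then show ?thesis using subgroup.m_inv_closed[OF sub that] by simp
  qed
  have T_diff: "z - z' \<in> T" if "z \<in> T" "z' \<in> T" for z z'
    using T_add[OF that(1) T_uminus[OF that(2)]] by simp
  have rel1: "frag_of (a + b, x) - frag_of (a, x) - frag_of (b, x) \<in> T" if "a \<in> Fr" "b \<in> Fr" "x \<in> M" for a b x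
    unfolding T_def B_def using that by (intro generate.incl) blast
  have rel2: "frag_of (a * r, x) - frag_of (a, r * x) \<in> T" if "a \<in> Fr" "r \<in> A" "x \<in> M" for a r x
    unfolding T_def B_def using that by (intro generate.incl) blast
  have spans: "\<exists>c\<in>Fr. z - frag_of (c, m0) \<in> T" if "Poly_Mapping.keys z \<subseteq> Fr \<times> M" for z
  proof (rule free_Abelian_group_induct[where P = "\<lambda>z. \<exists>c\<in>Fr. z - frag_of (c, m0) \<in> T", OF that])
    \<comment> \<open>With both scalars 0, the additivity relation is minus the generator itself, so
      the pure tensor of 0 and \<open>m0\<close> vanishes.\<close>
    have "frag_of (0 + 0, m0) - frag_of (0, m0) - frag_of (0, m0) \<in> T"
      using m0(1) mem_frac by (intro rel1) auto
    then show "\<exists>c\<in>Fr. 0 - frag_of (c, m0) \<in> T" using mem_frac by (intro bexI[of _ 0]) simp_all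
  next
    fix z z'
    assume "\<exists>c\<in>Fr. z - frag_of (c, m0) \<in> T" "\<exists>c\<in>Fr. z' - frag_of (c, m0) \<in> T"
    then obtain c c' where c: "c \<in> Fr" "z - frag_of (c, m0) \<in> T" "c' \<in> Fr" "z' - frag_of (c', m0) \<in> T"
      by blast
    have neg: "c - c' \<in> Fr"
    proof -
      have "- 1 * c' \<in> Fr" using c(3) mem_frac[OF uminus_mem[OF one_mem]] by (intro frac_mult)
      then show ?thesis using frac_add[OF c(1)] by fastforce
    qed
    have r: "frag_of (c' + (c - c'), m0) - frag_of (c', m0) - frag_of (c - c', m0) \<in> T"
      using c neg m0(1) by (intro rel1)
    have "(z - frag_of (c, m0)) - (z' - frag_of (c', m0)) +
        (frag_of (c' + (c - c'), m0) - frag_of (c', m0) - frag_of (c - c', m0)) \<in> T"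
      by (rule T_add[OF T_diff[OF c(2,4)] r])
    then have "(z - z') - frag_of (c - c', m0) \<in> T" by (simp add: algebra_simps)
    then show "\<exists>c\<in>Fr. z - z' - frag_of (c, m0) \<in> T" using neg by blast
  next
    fix ax assume "ax \<in> Fr \<times> M"
    then obtain a x where ax: "ax = (a, x)" "a \<in> Fr" "x \<in> M" by auto
    \<comment> \<open>Numerator and denominator of \<open>x / m0\<close> are moved across the tensor
      sign: \<open>a\<close> and \<open>x\<close> become \<open>a / q\<close> and
      \<open>q * x = p * m0\<close>, then \<open>a / q * p\<close> and \<open>m0\<close>.\<close>
    obtain p q where pq: "p \<in> A" "q \<in> A" "q \<noteq> 0" "x / m0 = p / q"
      using frac_fieldE[OF quot[OF ax(3)]] by metis
    then have eq: "q * x = p * m0" using m0(2) by (simp add: field_simps)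
    have aq: "a / q \<in> Fr" using ax(2) pq mem_frac frac_divide by blast
    have "frag_of (a / q * q, x) - frag_of (a / q, q * x) \<in> T" using aq pq ax by (intro rel2)
    then have r1: "frag_of (a, x) - frag_of (a / q, q * x) \<in> T" using pq(3) by simp
    have r2: "frag_of (a / q * p, m0) - frag_of (a / q, p * m0) \<in> T" using aq pq m0 by (intro rel2)
    have "frag_of ax - frag_of (a / q * p, m0) \<in> T"
      using T_diff[OF r1 r2] eq ax(1) by simp
    moreover have "a / q * p \<in> Fr" using aq pq mem_frac frac_mult by blast
    ultimately show "\<exists>c\<in>Fr. frag_of ax - frag_of (c, m0) \<in> T" by blast
  qed
  have coset: "tensor_class A M z = tensor_class A M z'"
    if "Poly_Mapping.keys z \<subseteq> Fr \<times> M" "z - z' \<in> T" for z z'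
  proof -
    have "z' = (- (z - z')) + z" by simp
    then have "z' \<in> T #>\<^bsub>?G\<^esub> z" unfolding r_coset_def using T_uminus[OF that(2)] by fastforce
    then show ?thesis
      unfolding tensor_class_def T using that(1) by (intro G.repr_independence[OF _ _ sub]) simp_all
  qed
  \<comment> \<open>The multiplication map kills the relations and sends the pure tensor of 1 and
    \<open>m0\<close> to \<open>m0\<close>, which is nonzero.\<close>
  have "\<exists>\<phi> \<in> hom ?G (add_monoid (ring_of_type_algebra :: 'k ring)).
      \<forall>ax\<in>Fr \<times> M. \<phi> (frag_of ax) = fst ax * snd ax"
  proof -
    interpret K: field "ring_of_type_algebra :: 'k ring" by (rule field_from_type_algebra)
    obtain h where "h \<in> hom ?G (add_monoid (ring_of_type_algebra :: 'k ring))"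
      "\<And>ax. ax \<in> Fr \<times> M \<Longrightarrow> h (frag_of ax) = fst ax * snd ax"
      by (rule K.add.free_Abelian_group_universal[of "\<lambda>ax. fst ax * snd ax" "Fr \<times> M"])
        (simp, blast)
    then show ?thesis by blast
  qed
  then obtain \<phi> where hom: "\<phi> \<in> hom ?G (add_monoid (ring_of_type_algebra :: 'k ring))"
    and \<phi>_of: "\<And>a x. a \<in> Fr \<Longrightarrow> x \<in> M \<Longrightarrow> \<phi> (frag_of (a, x)) = a * x" by fastforce
  have \<phi>_add: "\<phi> (z + z') = \<phi> z + \<phi> z'"
    if "Poly_Mapping.keys z \<subseteq> Fr \<times> M" "Poly_Mapping.keys z' \<subseteq> Fr \<times> M" for z z'
    using hom that by (simp add: hom_def)
  have \<phi>_diff: "\<phi> (z - z') = \<phi> z - \<phi> z'"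
    if "Poly_Mapping.keys z \<subseteq> Fr \<times> M" "Poly_Mapping.keys z' \<subseteq> Fr \<times> M" for z z'
  proof -
    have "Poly_Mapping.keys (z - z') \<subseteq> Fr \<times> M" using keys_diff[of z z'] that by blast
    then have "\<phi> ((z - z') + z') = \<phi> (z - z') + \<phi> z'" using that by (intro \<phi>_add)
    then show ?thesis by simp
  qed
  have \<phi>B: "\<phi> z = 0" if z: "z \<in> B" for z
  proof -
    consider a b x where "z = frag_of (a + b, x) - frag_of (a, x) - frag_of (b, x)" "a \<in> Fr" "b \<in> Fr" "x \<in> M"
      | a x y where "z = frag_of (a, x + y) - frag_of (a, x) - frag_of (a, y)" "a \<in> Fr" "x \<in> M" "y \<in> M"
      | a r x where "z = frag_of (a * r, x) - frag_of (a, r * x)" "a \<in> Fr" "r \<in> A" "x \<in> M"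
      using z unfolding B_def by blast
    then show ?thesis
    proof cases
      case (1 a b x)
      show ?thesis unfolding 1(1) using 1(2-) by (simp add: \<phi>_diff kd \<phi>_of frac_add distrib_right)
    next
      case (2 a x y)
      show ?thesis unfolding 2(1) using 2(2-) by (simp add: \<phi>_diff kd \<phi>_of add distrib_left)
    next
      case (3 a r x)
      show ?thesis unfolding 3(1) using 3(2-) by (simp add: \<phi>_diff kd \<phi>_of scale frac_mult mem_frac)
    qed
  qed
  have Bk: "Poly_Mapping.keys z \<subseteq> Fr \<times> M" if "z \<in> B" for z
  proof -
    have "z \<in> carrier ?G" using BG that by blast
    then show ?thesis by (simp only: carrier_free_Abelian_group_iff)
  qed
  have "\<phi> z = 0 \<and> Poly_Mapping.keys z \<subseteq> Fr \<times> M" if "z \<in> T" for z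
    using that unfolding T_def
  proof (induction rule: generate.induct)
    case one
    show ?case using \<phi>_diff[of 0 0] by simp
  next
    case (incl h)
    then show ?case using \<phi>B Bk by blast
  next
    case (inv h)
    then have h: "\<phi> h = 0" "Poly_Mapping.keys h \<subseteq> Fr \<times> M" using \<phi>B Bk by blast+
    then have "inv\<^bsub>?G\<^esub> h = 0 - h" by simp
    then show ?case using \<phi>_diff[of 0 h] \<phi>_diff[of 0 0] h by simp
  next
    case (eng h1 h2)
    then show ?case using \<phi>_add[of h1 h2] keys_add[of h1 h2] by auto
  qed
  then have \<phi>T: "\<phi> z = 0" if "z \<in> T" for z using that by blast
  have z1: "Poly_Mapping.keys (frag_of (1, m0)) \<subseteq> Fr \<times> M" using mem_frac m0 by simp
  have "tensor_class A M (frag_of (1, m0)) \<noteq> tensor_class A M 0"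
  proof
    assume "tensor_class A M (frag_of (1, m0)) = tensor_class A M 0"
    then have "frag_of (1, m0) \<in> T #>\<^bsub>?G\<^esub> 0"
      using G.rcos_self[OF _ sub, of "frag_of (1, m0)"] z1 by (simp add: tensor_class_def T)
    then have "frag_of (1, m0) \<in> T" by (auto simp: r_coset_def)
    then show False using \<phi>T \<phi>_of[of 1 m0] mem_frac m0 by fastforce
  qed
  moreover have "\<exists>c\<in>Fr. tensor_class A M z =
      tensor_class A M (frag_extend (\<lambda>(a, x). frag_of (c * a, x)) (frag_of (1, m0)))"
    if z: "z \<in> carrier ?G" for z
  proof -
    have k: "Poly_Mapping.keys z \<subseteq> Fr \<times> M" using z by (simp only: carrier_free_Abelian_group_iff)
    then obtain c where "c \<in> Fr" "z - frag_of (c, m0) \<in> T" using spans by blast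
    then show ?thesis using coset[OF k] by (intro bexI[of _ c]) simp_all
  qed
  ultimately show ?thesis
    unfolding rank_one_def using z1 by (intro bexI[of _ "frag_of (1, m0)"]) auto
qed

section \<open>Torsion subgroups and exponents\<close>

context comm_group
begin

lemma coset_eq_one_iff:
  assumes "subgroup N G" "x \<in> carrier G"
  shows "N #> x = N \<longleftrightarrow> x \<in> N"
  using rcos_self[OF assms(2,1)] coset_join2[OF assms(2,1)] by auto

lemma pow_eq_one_generate_iff:
  assumes B: "B \<subseteq> carrier G"
  shows "(\<forall>x\<in>generate G B. x [^] (n::nat) = \<one>) \<longleftrightarrow> (\<forall>b\<in>B. b [^] n = \<one>)"
proof
  assume b: "\<forall>b\<in>B. b [^] n = \<one>"
  have "x \<in> carrier G \<and> x [^] n = \<one>" if "x \<in> generate G B" for x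
    using that
  proof (induction rule: generate.induct)
    case one
    then show ?case by simp
  next
    case (incl h)
    then show ?case using B b by blast
  next
    case (inv h)
    then have "h \<in> carrier G" "h [^] n = \<one>" using B b by blast+
    then show ?case by (simp add: nat_pow_inv)
  next
    case (eng h1 h2)
    then show ?case by (simp add: pow_mult_distrib m_comm)
  qed
  then show "\<forall>x\<in>generate G B. x [^] n = \<one>" by blast
next
  assume all: "\<forall>x\<in>generate G B. x [^] n = \<one>"
  show "\<forall>b\<in>B. b [^] n = \<one>"
  proof
    fix b assume "b \<in> B"
    then show "b [^] n = \<one>" using all generate.incl[of b B G] by blast
  qed
qed

lemma group_exponent_generated:
  assumes B: "B \<subseteq> carrier G"
  shows "group_exponent (subgroup_generated G B) = Inf {enat n | n. 0 < n \<and> (\<forall>b\<in>B. b [^] n = \<one>)}"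
proof -
  have "carrier G \<inter> B = B" using B by blast
  then show ?thesis
    unfolding group_exponent_def
    by (simp add: carrier_subgroup_generated pow_subgroup_generated pow_eq_one_generate_iff[OF B])
qed

lemma generate_insert_form:
  assumes x: "x \<in> carrier G" and Y: "Y \<subseteq> carrier G" and g: "g \<in> generate G (insert x Y)"
  shows "\<exists>a\<in>generate G Y. \<exists>k::int. g = a \<otimes> x [^] k"
  using g
proof (induction rule: generate.induct)
  case one
  then show ?case using generate.one x by (intro bexI[of _ \<one>] exI[of _ 0]) auto
next
  case (incl h)
  then consider "h = x" | "h \<in> Y" by blast
  then show ?case
  proof cases
    case 1
    then show ?thesis using generate.one x by (intro bexI[of _ \<one>] exI[of _ 1]) auto
  next
    case 2
    then show ?thesis using generate.incl[of h Y] Y by (intro bexI[of _ h] exI[of _ 0]) auto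
  qed
next
  case (inv h)
  then consider "h = x" | "h \<in> Y" by blast
  then show ?case
  proof cases
    case 1
    then show ?thesis using generate.one x by (intro bexI[of _ \<one>] exI[of _ "-1"]) (auto simp: int_pow_neg)
  next
    case 2
    then show ?thesis using generate.inv[of h Y] Y by (intro bexI[of _ "inv h"] exI[of _ 0]) auto
  qed
next
  case (eng h1 h2)
  then obtain a b k l where ab: "a \<in> generate G Y" "b \<in> generate G Y"
    "h1 = a \<otimes> x [^] (k::int)" "h2 = b \<otimes> x [^] (l::int)" by blast
  then have c: "a \<in> carrier G" "b \<in> carrier G" using generate_incl[OF Y] by auto
  have "h1 \<otimes> h2 = (a \<otimes> b) \<otimes> x [^] (k + l)"
    using c x by (simp add: ab int_pow_mult m_ac)
  then show ?case using generate.eng[OF ab(1,2)] by blast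
qed

lemma finite_cyclic:
  assumes x: "x \<in> carrier G" and n: "0 < n" "x [^] (n::nat) = \<one>"
  shows "finite (range (\<lambda>k::int. x [^] k))"
proof -
  have "x [^] k \<in> (\<lambda>k::int. x [^] k) ` {0..<int n}" for k :: int
  proof -
    have "x [^] k = x [^] (int n * (k div int n) + k mod int n)" by simp
    also have "\<dots> = x [^] (int n * (k div int n)) \<otimes> x [^] (k mod int n)"
      by (rule int_pow_mult[OF x])
    also have "\<dots> = (x [^] int n) [^] (k div int n) \<otimes> x [^] (k mod int n)"
      using x by (simp add: int_pow_pow)
    also have "\<dots> = x [^] (k mod int n)" using n x by (simp add: int_pow_int)
    finally show ?thesis using n by (intro image_eqI[of _ _ "k mod int n"]) auto
  qed
  then have "range (\<lambda>k::int. x [^] k) \<subseteq> (\<lambda>k::int. x [^] k) ` {0..<int n}" by blast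
  then show ?thesis by (rule finite_subset) simp
qed

text \<open>By induction on the generators. The exponents of the new generator \<open>x\<close> that
  occur in \<open>H\<close> form a group of integers; if it is not zero, an element
  \<open>h0\<close> of \<open>H\<close> with the least positive exponent reduces every member of
  \<open>H\<close> to the subgroup generated by \<open>Y\<close>. The intersection with that
  subgroup and the powers of the torsion element \<open>h0\<close> are both finite.\<close>

lemma finite_torsion_subgroup:
  assumes "finite Y" "Y \<subseteq> carrier G" "subgroup H G" "H \<subseteq> generate G Y"
    and "\<And>h. h \<in> H \<Longrightarrow> \<exists>n::nat. 0 < n \<and> h [^] n = \<one>"
  shows "finite H"
  using assms
proof (induction Y arbitrary: H rule: finite_induct)
  case empty
  then show ?case using finite_subset[of H "{\<one>}"] by (simp add: generate_empty)
next
  case (insert x Y)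
  have x: "x \<in> carrier G" and Y: "Y \<subseteq> carrier G" using insert.prems by auto
  let ?A = "generate G Y"
  note HC = subgroup.mem_carrier[OF insert.prems(2)]
  have A: "subgroup ?A G" using generate_is_subgroup[OF Y] .
  note AC = subgroup.mem_carrier[OF A]
  have sub: "subgroup (H \<inter> ?A) G" using subgroups_Inter_pair[OF insert.prems(2) A] .
  have fin: "finite (H \<inter> ?A)"
    using insert.IH[OF Y sub] insert.prems(4) by blast
  define D where "D = {k::int. \<exists>a\<in>?A. a \<otimes> x [^] k \<in> H}"
  have form: "\<exists>a\<in>?A. \<exists>k\<in>D. h = a \<otimes> x [^] k" if h: "h \<in> H" for h
  proof -
    have "h \<in> generate G (insert x Y)" using h insert.prems(3) by blast
    then obtain a k where "a \<in> ?A" "h = a \<otimes> x [^] (k::int)"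
      using generate_insert_form[OF x Y] by blast
    then show ?thesis using h by (auto simp: D_def)
  qed
  have step: "\<exists>a'\<in>?A. (a \<otimes> x [^] k) \<otimes> (b \<otimes> x [^] l) [^] j = a' \<otimes> x [^] (k + l * j)"
    if "a \<in> ?A" "b \<in> ?A" for a b and k l j :: int
  proof -
    have "(a \<otimes> x [^] k) \<otimes> (b \<otimes> x [^] l) [^] j = (a \<otimes> b [^] j) \<otimes> x [^] (k + l * j)"
      using AC[OF that(1)] AC[OF that(2)] x
      by (simp add: int_pow_mult int_pow_pow int_pow_mult_distrib m_comm m_ac)
    moreover have "a \<otimes> b [^] j \<in> ?A"
      using that A by (intro subgroup.m_closed[OF A] subgroup_int_pow_closed[OF A])
    ultimately show ?thesis by blast
  qed
  show ?case
  proof (cases "D \<subseteq> {0}")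
    case True
    have "H \<subseteq> H \<inter> ?A"
    proof
      fix h assume h: "h \<in> H"
      then obtain a k where "a \<in> ?A" "k \<in> D" "h = a \<otimes> x [^] k" using form by blast
      then show "h \<in> H \<inter> ?A" using True h AC by auto
    qed
    then show ?thesis using fin finite_subset by blast
  next
    case False
    have comb: "k + l * j \<in> D" if kl: "k \<in> D" "l \<in> D" for k l j
    proof -
      obtain a b where ab: "a \<in> ?A" "a \<otimes> x [^] k \<in> H" "b \<in> ?A" "b \<otimes> x [^] l \<in> H"
        using kl unfolding D_def by blast
      have "(a \<otimes> x [^] k) \<otimes> (b \<otimes> x [^] l) [^] j \<in> H"
        by (rule subgroup.m_closed[OF insert.prems(2) ab(2) subgroup_int_pow_closed[OF insert.prems(2) ab(4)]])
      then show ?thesis using step[OF ab(1,3), of k l j] unfolding D_def by auto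
    qed
    obtain k0 where k0: "k0 \<in> D" "k0 \<noteq> 0" using False by blast
    \<comment> \<open>This is \<open>- k0\<close>, so a positive exponent occurs.\<close>
    have "k0 + k0 * (-2) \<in> D" using comb k0 by blast
    then have "- k0 \<in> D" by simp
    then have "nat \<bar>k0\<bar> > 0 \<and> int (nat \<bar>k0\<bar>) \<in> D" using k0 by (auto simp: abs_if)
    then have ex: "\<exists>n. 0 < n \<and> int n \<in> D" by blast
    define d where "d = (LEAST n. 0 < n \<and> int n \<in> D)"
    have d: "0 < d" "int d \<in> D" using LeastI_ex[OF ex] by (auto simp: d_def)
    have dvd: "int d dvd k" if k: "k \<in> D" for k
    proof (rule ccontr)
      assume nd: "\<not> int d dvd k"
      have "k + int d * (- (k div int d)) \<in> D" using comb k d(2) by blast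
      then have "k mod int d \<in> D" by (simp add: minus_mult_div_eq_mod[symmetric])
      moreover have "0 \<le> k mod int d" "k mod int d < int d" using d by simp_all
      moreover have "k mod int d \<noteq> 0" using nd by presburger
      ultimately have "0 < nat (k mod int d) \<and> int (nat (k mod int d)) \<in> D" "nat (k mod int d) < d"
        by auto
      then show False using not_less_Least unfolding d_def by blast
    qed
    obtain b where b: "b \<in> ?A" "b \<otimes> x [^] int d \<in> H" using d(2) unfolding D_def by blast
    define h0 where "h0 = b \<otimes> x [^] int d"
    have h0: "h0 \<in> H" "h0 \<in> carrier G" using b HC by (auto simp: h0_def)
    have "H \<subseteq> (\<lambda>(a, c). a \<otimes> c) ` ((H \<inter> ?A) \<times> range (\<lambda>k::int. h0 [^] k))"
    proof
      fix h assume h: "h \<in> H"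
      then obtain a k where ak: "a \<in> ?A" "k \<in> D" "h = a \<otimes> x [^] k" using form by blast
      obtain j where j: "k = int d * j" using dvd[OF ak(2)] by blast
      obtain a' where a': "a' \<in> ?A" "h \<otimes> h0 [^] (- j) = a' \<otimes> x [^] (k + int d * (- j))"
        unfolding ak(3) h0_def using step[OF ak(1) b(1), of k "int d" "- j"] by blast
      then have "h \<otimes> h0 [^] (- j) = a'" using j AC by simp
      moreover have "h \<otimes> h0 [^] (- j) \<in> H"
        by (rule subgroup.m_closed[OF insert.prems(2) h subgroup_int_pow_closed[OF insert.prems(2) h0(1)]])
      moreover have "h = (h \<otimes> h0 [^] (- j)) \<otimes> h0 [^] j"
        using HC[OF h] h0(2) by (simp add: m_assoc int_pow_mult[symmetric])
      ultimately show "h \<in> (\<lambda>(a, c). a \<otimes> c) ` ((H \<inter> ?A) \<times> range (\<lambda>k::int. h0 [^] k))"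
        using a'(1) by (intro image_eqI[of _ _ "(a', h0 [^] j)"]) auto
    qed
    moreover obtain n :: nat where "0 < n" "h0 [^] n = \<one>" using insert.prems(4)[OF h0(1)] by blast
    ultimately show ?thesis using finite_cyclic[OF h0(2)] fin by (meson finite_SigmaI finite_imageI finite_subset)
  qed
qed

end

section \<open>Cocycles and relative invariants\<close>

locale krull_action =
  fixes R :: "'k::field set" and G :: "('g, 'm) monoid_scheme" and act :: "'g \<Rightarrow> 'k \<Rightarrow> 'k"
  assumes krull_R: "krull_domain R" and action: "ring_action G act R"
begin

sublocale R: krull R
  by (rule krull_domain_imp_krull[OF krull_R])

abbreviation S where "S \<equiv> fixed_ring G act R"

section \<open>The action and its ring of invariants\<close>

lemma group_action: "group_action G R act"
  using action by (simp add: ring_action_def)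

lemma G_group: "Group.group G"
  using group_action.group_hom[OF group_action] by (simp add: group_hom_def)

lemma act_hom: "\<sigma> \<in> carrier G \<Longrightarrow> act \<sigma> \<in> ring_hom (rng R) (rng R)"
  using action by (auto simp: ring_action_def ring_iso_def)

lemma act_closed: "\<sigma> \<in> carrier G \<Longrightarrow> x \<in> R \<Longrightarrow> act \<sigma> x \<in> R"
  using ring_hom_closed[OF act_hom, of \<sigma> x] by simp

lemma act_mult: "\<sigma> \<in> carrier G \<Longrightarrow> x \<in> R \<Longrightarrow> y \<in> R \<Longrightarrow> act \<sigma> (x * y) = act \<sigma> x * act \<sigma> y"
  using ring_hom_mult[OF act_hom, of \<sigma> x y] by simp

lemma act_add: "\<sigma> \<in> carrier G \<Longrightarrow> x \<in> R \<Longrightarrow> y \<in> R \<Longrightarrow> act \<sigma> (x + y) = act \<sigma> x + act \<sigma> y"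
  using ring_hom_add[OF act_hom, of \<sigma> x y] by simp

lemma act_one: "\<sigma> \<in> carrier G \<Longrightarrow> act \<sigma> 1 = 1"
  using ring_hom_one[OF act_hom, of \<sigma>] by simp

lemma act_zero: "\<sigma> \<in> carrier G \<Longrightarrow> act \<sigma> 0 = 0"
  by (metis R.zero_mem act_add add.right_neutral add_left_cancel)

lemma act_uminus: "\<sigma> \<in> carrier G \<Longrightarrow> x \<in> R \<Longrightarrow> act \<sigma> (- x) = - act \<sigma> x"
  using act_add[of \<sigma> x "- x"] act_zero[of \<sigma>] R.uminus_mem by (simp add: add_eq_0_iff)

lemma act_power: "\<sigma> \<in> carrier G \<Longrightarrow> x \<in> R \<Longrightarrow> act \<sigma> (x ^ n) = act \<sigma> x ^ n"
  by (induction n) (simp_all add: act_one act_mult R.power_mem)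

lemma act_comp: "\<sigma> \<in> carrier G \<Longrightarrow> \<tau> \<in> carrier G \<Longrightarrow> x \<in> R \<Longrightarrow> act (\<sigma> \<otimes>\<^bsub>G\<^esub> \<tau>) x = act \<sigma> (act \<tau> x)"
  using group_action.composition_rule[OF group_action] by blast

lemma act_nonzero: "\<sigma> \<in> carrier G \<Longrightarrow> x \<in> R \<Longrightarrow> x \<noteq> 0 \<Longrightarrow> act \<sigma> x \<noteq> 0"
  using group_action.inj_prop[OF group_action, of \<sigma>] act_zero[of \<sigma>] by (metis R.zero_mem inj_onD)

lemma S_iff: "x \<in> S \<longleftrightarrow> x \<in> R \<and> (\<forall>\<sigma>\<in>carrier G. act \<sigma> x = x)"
  by (simp add: fixed_ring_def)

text \<open>The action is given on \<open>R\<close>, not on fractions, so invariance of a fraction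
  \<open>x = a / b\<close> in \<open>R\<close> is checked on \<open>x * b = a\<close>, and
  \<open>b\<close> is cancelled.\<close>

sublocale krull_pair R S
proof (intro krull_pair.intro krull_pair_axioms.intro subdomain.intro R.krull_axioms)
  interpret F: field "ring_of_type_algebra :: 'k ring"
    by (rule field_from_type_algebra)
  show "S \<subseteq> R" by (auto simp: S_iff)
  show "subring S ring_of_type_algebra"
    by (rule F.subringI)
      (auto simp: S_iff R.uminus_ring_of_type_algebra act_one act_add act_mult act_uminus
        R.add_mem R.mult_mem R.uminus_mem)
  fix x assume x: "x \<in> R" "x \<in> frac_field S"
  then obtain a b where ab: "a \<in> S" "b \<in> S" "b \<noteq> 0" "x = a / b" by (auto simp: frac_field_def)
  have "act \<sigma> x = x" if \<sigma>: "\<sigma> \<in> carrier G" for \<sigma>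
  proof -
    have "act \<sigma> (x * b) = act \<sigma> x * act \<sigma> b" using ab x by (intro act_mult \<sigma>) (auto simp: S_iff)
    moreover have "x * b = a" using ab by simp
    moreover have "act \<sigma> a = a" "act \<sigma> b = b" using ab \<sigma> by (simp_all add: S_iff)
    ultimately have "act \<sigma> x * b = x * b" by metis
    then show ?thesis using mult_right_cancel[OF ab(3)] by blast
  qed
  then show "x \<in> S" using x by (simp add: S_iff)
qed

section \<open>Units, cocycles and the first cohomology group\<close>

abbreviation U where "U \<equiv> Units (rng R)"
abbreviation Z where "Z \<equiv> Z1 G act R"
abbreviation M where "M \<equiv> semi_inv G act R"

lemma U_iff: "u \<in> U \<longleftrightarrow> u \<in> R \<and> u \<noteq> 0 \<and> inverse u \<in> R"
  by (auto simp: Units_rng)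

lemma U_mult: "u \<in> U \<Longrightarrow> u' \<in> U \<Longrightarrow> u * u' \<in> U"
  by (simp add: U_iff R.mult_mem)

lemma U_inverse: "u \<in> U \<Longrightarrow> inverse u \<in> U"
  by (simp add: U_iff)

lemma U_one: "1 \<in> U"
  by (simp add: U_iff)

lemma act_inverse: "\<sigma> \<in> carrier G \<Longrightarrow> u \<in> U \<Longrightarrow> act \<sigma> (inverse u) = inverse (act \<sigma> u)"
  using act_mult[of \<sigma> u "inverse u"] act_one[of \<sigma>] inverse_unique[of "act \<sigma> u" "act \<sigma> (inverse u)"]
  by (simp add: U_iff)

lemma U_act: "\<sigma> \<in> carrier G \<Longrightarrow> u \<in> U \<Longrightarrow> act \<sigma> u \<in> U"
  using act_inverse[of \<sigma> u] act_closed[of \<sigma> u] act_closed[of \<sigma> "inverse u"] act_nonzero[of \<sigma> u]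
  by (auto simp: U_iff)

lemma Z_simps [simp]:
  "\<chi> \<otimes>\<^bsub>Z\<^esub> \<psi> = (\<lambda>\<sigma>\<in>carrier G. \<chi> \<sigma> * \<psi> \<sigma>)" "\<one>\<^bsub>Z\<^esub> = (\<lambda>\<sigma>\<in>carrier G. 1)"
  by (simp_all add: Z1_def)

lemma Z_iff: "\<chi> \<in> carrier Z \<longleftrightarrow> \<chi> \<in> extensional (carrier G) \<and> (\<forall>\<sigma>\<in>carrier G. \<chi> \<sigma> \<in> U) \<and>
    (\<forall>\<sigma>\<in>carrier G. \<forall>\<tau>\<in>carrier G. \<chi> (\<sigma> \<otimes>\<^bsub>G\<^esub> \<tau>) = \<chi> \<sigma> * act \<sigma> (\<chi> \<tau>))"
  by (auto simp: Z1_def PiE_def Pi_def)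

lemma G_closed: "\<sigma> \<in> carrier G \<Longrightarrow> \<tau> \<in> carrier G \<Longrightarrow> \<sigma> \<otimes>\<^bsub>G\<^esub> \<tau> \<in> carrier G"
  using monoid.m_closed[OF group.is_monoid[OF G_group]] by blast

lemma Z_closed:
  assumes "\<chi> \<in> carrier Z" "\<psi> \<in> carrier Z"
  shows "(\<lambda>\<sigma>\<in>carrier G. \<chi> \<sigma> * \<psi> \<sigma>) \<in> carrier Z"
  using assms by (simp add: Z_iff U_mult G_closed act_mult U_iff[THEN iffD1, THEN conjunct1] mult_ac)

lemma Z_inverse_closed:
  assumes "\<chi> \<in> carrier Z"
  shows "(\<lambda>\<sigma>\<in>carrier G. inverse (\<chi> \<sigma>)) \<in> carrier Z"
  using assms by (simp add: Z_iff U_inverse G_closed act_inverse)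

lemma Z_group: "comm_group Z"
proof (rule comm_groupI)
  show "\<chi> \<otimes>\<^bsub>Z\<^esub> \<psi> \<in> carrier Z" if "\<chi> \<in> carrier Z" "\<psi> \<in> carrier Z" for \<chi> \<psi>
    using Z_closed[OF that] by simp
  show "\<one>\<^bsub>Z\<^esub> \<in> carrier Z" by (simp add: Z_iff U_one G_closed act_one)
  show "\<chi> \<otimes>\<^bsub>Z\<^esub> \<psi> \<otimes>\<^bsub>Z\<^esub> \<phi> = \<chi> \<otimes>\<^bsub>Z\<^esub> (\<psi> \<otimes>\<^bsub>Z\<^esub> \<phi>)" for \<chi> \<psi> \<phi>
    by (simp add: mult.assoc cong: restrict_cong)
  show "\<chi> \<otimes>\<^bsub>Z\<^esub> \<psi> = \<psi> \<otimes>\<^bsub>Z\<^esub> \<chi>" for \<chi> \<psi>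
    by (simp add: mult.commute cong: restrict_cong)
  show "\<one>\<^bsub>Z\<^esub> \<otimes>\<^bsub>Z\<^esub> \<chi> = \<chi>" if "\<chi> \<in> carrier Z" for \<chi>
    using that by (intro extensionalityI[of _ "carrier G"]) (auto simp: Z_iff)
  show "\<exists>\<psi>\<in>carrier Z. \<psi> \<otimes>\<^bsub>Z\<^esub> \<chi> = \<one>\<^bsub>Z\<^esub>" if "\<chi> \<in> carrier Z" for \<chi>
    using that by (intro bexI[OF _ Z_inverse_closed[OF that]]) (auto simp: Z_iff U_iff intro!: restrict_ext)
qed

lemma Z_ext: "\<chi> \<in> carrier Z \<Longrightarrow> \<psi> \<in> carrier Z \<Longrightarrow> (\<And>\<sigma>. \<sigma> \<in> carrier G \<Longrightarrow> \<chi> \<sigma> = \<psi> \<sigma>) \<Longrightarrow> \<chi> = \<psi>"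
  by (rule extensionalityI[of _ "carrier G"]) (auto simp: Z_iff)

lemma Z_inv:
  assumes "\<chi> \<in> carrier Z"
  shows "inv\<^bsub>Z\<^esub> \<chi> = (\<lambda>\<sigma>\<in>carrier G. inverse (\<chi> \<sigma>))"
proof -
  interpret Z: comm_group Z by (rule Z_group)
  show ?thesis
    using assms Z_inverse_closed[OF assms]
    by (intro Z.inv_equality) (auto simp: Z_iff U_iff intro!: restrict_ext)
qed

lemma Z_pow:
  assumes "\<chi> \<in> carrier Z" "\<sigma> \<in> carrier G"
  shows "(\<chi> [^]\<^bsub>Z\<^esub> (n::nat)) \<sigma> = \<chi> \<sigma> ^ n"
  using assms by (induction n) simp_all

lemma B1_iff: "\<chi> \<in> B1 G act R \<longleftrightarrow> (\<exists>u\<in>U. \<chi> = (\<lambda>\<sigma>\<in>carrier G. act \<sigma> u / u))"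
  by (auto simp: B1_def)

lemma B1_Z: "u \<in> U \<Longrightarrow> (\<lambda>\<sigma>\<in>carrier G. act \<sigma> u / u) \<in> carrier Z"
proof -
  assume u: "u \<in> U"
  have "act \<sigma> u / u \<in> U" if "\<sigma> \<in> carrier G" for \<sigma>
    unfolding divide_inverse by (intro U_mult U_inverse U_act u that)
  moreover have "act (\<sigma> \<otimes>\<^bsub>G\<^esub> \<tau>) u / u = act \<sigma> u / u * act \<sigma> (act \<tau> u / u)"
    if "\<sigma> \<in> carrier G" "\<tau> \<in> carrier G" for \<sigma> \<tau>
  proof -
    have "act \<sigma> (act \<tau> u / u) = act \<sigma> (act \<tau> u) / act \<sigma> u"
      unfolding divide_inverse using that u act_closed[of \<tau> u]
      by (simp add: act_mult act_inverse U_iff)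
    moreover have "act \<sigma> u \<noteq> 0" using act_nonzero that u by (simp add: U_iff)
    ultimately show ?thesis using that u by (simp add: act_comp U_iff)
  qed
  ultimately show ?thesis by (simp add: Z_iff G_closed)
qed

lemma B1_subgroup: "subgroup (B1 G act R) Z"
proof (rule subgroup.intro)
  show "B1 G act R \<subseteq> carrier Z" using B1_Z by (auto simp: B1_iff)
  show "\<one>\<^bsub>Z\<^esub> \<in> B1 G act R"
    unfolding B1_iff using U_one by (intro bexI[of _ 1]) (auto simp: act_one intro!: restrict_ext)
  show "\<chi> \<otimes>\<^bsub>Z\<^esub> \<psi> \<in> B1 G act R" if \<chi>\<psi>: "\<chi> \<in> B1 G act R" "\<psi> \<in> B1 G act R" for \<chi> \<psi>
  proof -
    obtain u u' where u: "u \<in> U" "u' \<in> U" "\<chi> = (\<lambda>\<sigma>\<in>carrier G. act \<sigma> u / u)" "\<psi> = (\<lambda>\<sigma>\<in>carrier G. act \<sigma> u' / u')"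
      using \<chi>\<psi> by (auto simp: B1_iff)
    show ?thesis unfolding B1_iff
      using u U_mult by (intro bexI[of _ "u * u'"]) (auto simp: act_mult U_iff intro!: restrict_ext)
  qed
  show "inv\<^bsub>Z\<^esub> \<chi> \<in> B1 G act R" if \<chi>: "\<chi> \<in> B1 G act R" for \<chi>
  proof -
    obtain u where u: "u \<in> U" "\<chi> = (\<lambda>\<sigma>\<in>carrier G. act \<sigma> u / u)"
      using \<chi> by (auto simp: B1_iff)
    have "inv\<^bsub>Z\<^esub> \<chi> = (\<lambda>\<sigma>\<in>carrier G. inverse (\<chi> \<sigma>))" using Z_inv B1_Z u by simp
    then show ?thesis unfolding B1_iff using u U_inverse
      by (intro bexI[of _ "inverse u"]) (auto simp: act_inverse divide_inverse mult.commute intro!: restrict_ext)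
  qed
qed

abbreviation coh' where "coh' \<equiv> coh G act R"
abbreviation H where "H \<equiv> H1 G act R"

lemma H_group: "comm_group H"
  unfolding H1_def by (rule comm_group.abelian_FactGroup[OF Z_group B1_subgroup])

lemma coh_hom: "coh' \<in> hom Z H"
  using normal.r_coset_hom_Mod[OF comm_group.subgroup_imp_normal[OF Z_group B1_subgroup]]
  by (simp add: coh_def[abs_def] H1_def)

lemma coh_group_hom: "group_hom Z H coh'"
  using Z_group H_group coh_hom by (simp add: group_hom_def group_hom_axioms_def comm_group_def)

lemma coh_eq_one_iff: "\<chi> \<in> carrier Z \<Longrightarrow> coh' \<chi> = \<one>\<^bsub>H\<^esub> \<longleftrightarrow> \<chi> \<in> B1 G act R"
  using comm_group.coset_eq_one_iff[OF Z_group B1_subgroup] by (simp add: coh_def H1_def)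

lemma coh_eqD:
  assumes "\<chi> \<in> carrier Z" "\<psi> \<in> carrier Z" "coh' \<chi> = coh' \<psi>"
  shows "\<exists>u\<in>U. \<forall>\<sigma>\<in>carrier G. \<chi> \<sigma> = act \<sigma> u / u * \<psi> \<sigma>"
proof -
  interpret Z: comm_group Z by (rule Z_group)
  have "\<chi> \<in> B1 G act R #>\<^bsub>Z\<^esub> \<psi>"
    using Z.rcos_self[OF assms(1) B1_subgroup] assms(3) by (simp add: coh_def)
  then obtain b where "b \<in> B1 G act R" "\<chi> = b \<otimes>\<^bsub>Z\<^esub> \<psi>" by (auto simp: r_coset_def)
  then show ?thesis by (auto simp: B1_iff)
qed

section \<open>Modules of relative invariants\<close>

lemma M_iff: "x \<in> M \<chi> \<longleftrightarrow> x \<in> R \<and> (\<forall>\<sigma>\<in>carrier G. act \<sigma> x = \<chi> \<sigma> * x)"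
  by (simp add: semi_inv_def)

lemma zero_M: "0 \<in> M \<chi>"
  by (simp add: M_iff act_zero)

lemma M_mult:
  assumes "x \<in> M \<chi>" "y \<in> M \<psi>" "\<And>\<sigma>. \<sigma> \<in> carrier G \<Longrightarrow> \<phi> \<sigma> = \<chi> \<sigma> * \<psi> \<sigma>"
  shows "x * y \<in> M \<phi>"
  using assms by (simp add: M_iff R.mult_mem act_mult mult_ac)

lemma M_power:
  assumes "x \<in> M \<chi>" "\<And>\<sigma>. \<sigma> \<in> carrier G \<Longrightarrow> \<phi> \<sigma> = \<chi> \<sigma> ^ n"
  shows "x ^ n \<in> M \<phi>"
  using assms by (simp add: M_iff R.power_mem act_power power_mult_distrib)

lemma M_inverse_mult:
  assumes "x \<in> M \<chi>" "y \<in> M \<psi>" "\<And>\<sigma>. \<sigma> \<in> carrier G \<Longrightarrow> \<chi> \<sigma> * \<psi> \<sigma> = 1"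
  shows "x * y \<in> S"
proof -
  have "x * y \<in> M (\<lambda>_. 1)" using assms by (intro M_mult) auto
  then show ?thesis by (simp add: M_iff S_iff)
qed

text \<open>A nonzero relative invariant \<open>g\<close> of the inverse cocycle exhibits
  \<open>x / f\<close> as the quotient of the invariants \<open>x * g\<close> and
  \<open>f * g\<close>. Conversely, clearing the denominator of \<open>x / f\<close> shows that
  \<open>x\<close> transforms like \<open>f\<close>.\<close>

lemma M_eq_Msat:
  assumes f: "f \<in> M \<chi>" "f \<noteq> 0" and g: "g \<in> M \<psi>" "g \<noteq> 0"
    and inv: "\<And>\<sigma>. \<sigma> \<in> carrier G \<Longrightarrow> \<chi> \<sigma> * \<psi> \<sigma> = 1"
  shows "M \<chi> = Msat f"
proof (intro equalityI subsetI)
  fix x assume x: "x \<in> M \<chi>"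
  have "(x * g) / (f * g) \<in> K"
    using M_inverse_mult[OF x g(1) inv] M_inverse_mult[OF f(1) g(1) inv] f g
    by (intro S.frac_fieldI) auto
  then show "x \<in> Msat f" using x g by (simp add: Msat_def M_iff)
next
  fix x assume x: "x \<in> Msat f"
  then obtain a b where ab: "a \<in> S" "b \<in> S" "b \<noteq> 0" "x / f = a / b"
    unfolding Msat_def by (auto elim: S.frac_fieldE)
  then have eq: "x * b = a * f" using f by (simp add: field_simps)
  have "act \<sigma> x = \<chi> \<sigma> * x" if \<sigma>: "\<sigma> \<in> carrier G" for \<sigma>
  proof -
    have "act \<sigma> (x * b) = act \<sigma> x * b" "act \<sigma> (a * f) = a * (\<chi> \<sigma> * f)"
      using ab x f \<sigma> by (simp_all add: act_mult S_iff M_iff Msat_def)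
    then have "act \<sigma> x * b = \<chi> \<sigma> * (x * b)" unfolding eq by (simp add: ac_simps)
    then show ?thesis using ab(3) by (simp add: mult.assoc[symmetric])
  qed
  then show "x \<in> M \<chi>" using x by (simp add: M_iff Msat_def)
qed

lemma M_cohomologous:
  assumes "u \<in> U" "\<And>\<sigma>. \<sigma> \<in> carrier G \<Longrightarrow> \<chi> \<sigma> = act \<sigma> u / u * \<psi> \<sigma>" "x \<in> M \<psi>"
  shows "u * x \<in> M \<chi>"
  using assms by (simp add: M_iff U_iff R.mult_mem act_mult)

lemma image_m_inv_iff:
  assumes "Y \<subseteq> carrier Z"
  shows "\<chi> \<in> m_inv Z ` Y \<longleftrightarrow> \<chi> \<in> carrier Z \<and> inv\<^bsub>Z\<^esub> \<chi> \<in> Y"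
proof -
  note gr = comm_group.axioms(2)[OF Z_group]
  have "\<chi> \<in> carrier Z \<and> inv\<^bsub>Z\<^esub> \<chi> \<in> Y" if "\<chi> = inv\<^bsub>Z\<^esub> \<psi>" "\<psi> \<in> Y" for \<psi>
    using that assms group.inv_closed[OF gr, of \<psi>] group.inv_inv[OF gr, of \<psi>] by auto
  moreover have "\<chi> \<in> m_inv Z ` Y" if "\<chi> \<in> carrier Z" "inv\<^bsub>Z\<^esub> \<chi> \<in> Y"
    using that group.inv_inv[OF gr, of \<chi>] by (intro image_eqI[of _ _ "inv\<^bsub>Z\<^esub> \<chi>"]) simp_all
  ultimately show ?thesis by blast
qed

lemma Z1_2_iff: "\<chi> \<in> Z1_2 G act R \<longleftrightarrow> \<chi> \<in> carrier Z \<and> M (inv\<^bsub>Z\<^esub> \<chi>) \<noteq> {0} \<and>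
    (\<forall>P\<in>Ht1_ge2 R S. \<not> M (inv\<^bsub>Z\<^esub> \<chi>) \<subseteq> P)"
proof -
  have up: "Z1_up G act R \<subseteq> carrier Z" by (simp add: Z1_up_def)
  have "inv\<^bsub>Z\<^esub> \<chi> \<in> carrier Z" if "\<chi> \<in> carrier Z"
    using group.inv_closed[OF comm_group.axioms(2)[OF Z_group] that] .
  then have "inv\<^bsub>Z\<^esub> \<chi> \<in> Z1_up G act R \<longleftrightarrow> M (inv\<^bsub>Z\<^esub> \<chi>) \<noteq> {0}" if "\<chi> \<in> carrier Z"
    using that by (simp only: Z1_up_def mem_Collect_eq simp_thms)
  then have "\<chi> \<in> m_inv Z ` Z1_up G act R \<longleftrightarrow> \<chi> \<in> carrier Z \<and> M (inv\<^bsub>Z\<^esub> \<chi>) \<noteq> {0}"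
    unfolding image_m_inv_iff[OF up] by blast
  then show ?thesis unfolding Z1_2_def by blast
qed

text \<open>\<open>Z1_2\<close> tests the inverse cocycle; intersecting with the negatives makes the
  condition symmetric in \<chi> and its inverse.\<close>

lemma Z1_tilde_iff: "\<chi> \<in> Z1_tilde G act R \<longleftrightarrow> \<chi> \<in> carrier Z \<and> M \<chi> \<noteq> {0} \<and> M (inv\<^bsub>Z\<^esub> \<chi>) \<noteq> {0} \<and>
    (\<forall>P\<in>Ht1_ge2 R S. \<not> M \<chi> \<subseteq> P \<and> \<not> M (inv\<^bsub>Z\<^esub> \<chi>) \<subseteq> P)"
proof -
  note gr = comm_group.axioms(2)[OF Z_group]
  have sub: "Z1_2 G act R \<subseteq> carrier Z" using Z1_2_iff by blast
  have "inv\<^bsub>Z\<^esub> \<chi> \<in> Z1_2 G act R \<longleftrightarrow> M \<chi> \<noteq> {0} \<and> (\<forall>P\<in>Ht1_ge2 R S. \<not> M \<chi> \<subseteq> P)" if "\<chi> \<in> carrier Z"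
    unfolding Z1_2_iff group.inv_inv[OF gr that] using group.inv_closed[OF gr that] by blast
  then show ?thesis
    unfolding Z1_tilde_def Int_iff image_m_inv_iff[OF sub] Z1_2_iff[of \<chi>] by blast
qed

end

section \<open>The two class groups\<close>

context krull_action
begin

abbreviation Zet where "Zet \<equiv> Z1_e G act R \<inter> Z1_tilde G act R"

lemma Zet_Z: "\<chi> \<in> Zet \<Longrightarrow> \<chi> \<in> carrier Z"
  by (simp add: Z1_tilde_iff)

lemma Z_nonzero: "\<chi> \<in> carrier Z \<Longrightarrow> \<sigma> \<in> carrier G \<Longrightarrow> \<chi> \<sigma> \<noteq> 0"
  by (simp add: Z_iff U_iff)

lemma Z_inv_mult: "\<chi> \<in> carrier Z \<Longrightarrow> \<sigma> \<in> carrier G \<Longrightarrow> \<chi> \<sigma> * (inv\<^bsub>Z\<^esub> \<chi>) \<sigma> = 1"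
  using Z_nonzero[of \<chi> \<sigma>] by (simp add: Z_inv)

lemma Zet_nonzero:
  assumes "\<chi> \<in> Zet"
  shows "\<exists>f\<in>M \<chi>. f \<noteq> 0" "\<exists>g\<in>M (inv\<^bsub>Z\<^esub> \<chi>). g \<noteq> 0"
  using assms zero_M by (auto simp: Z1_tilde_iff)

lemma M_Zet:
  assumes "\<chi> \<in> Zet" "f \<in> M \<chi>" "f \<noteq> 0"
  shows "M \<chi> = Msat f"
proof -
  obtain g where g: "g \<in> M (inv\<^bsub>Z\<^esub> \<chi>)" "g \<noteq> 0" using Zet_nonzero(2)[OF assms(1)] by blast
  show ?thesis by (rule M_eq_Msat[OF assms(2,3) g Z_inv_mult[OF Zet_Z[OF assms(1)]]])
qed

text \<open>With \<open>g\<close> for the inverse cocycle, \<open>f * g\<close> is invariant, so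
  over zero two nonnegative values add up to 0. For divisibility, the element \<open>f0\<close> from
  \<open>Z1_e\<close> varies with \<open>P\<close>, but \<open>f0 / f\<close> lies in
  \<open>K\<close> and has a value divisible by the ramification index.\<close>

lemma Zet_good:
  assumes \<chi>: "\<chi> \<in> Zet" and f: "f \<in> M \<chi>" "f \<noteq> 0"
  shows "good f"
  unfolding good_def
proof (intro conjI ballI impI)
  have fR: "f \<in> R" using f by (simp add: M_iff)
  show fF: "f \<in> R.Fr" "f \<noteq> 0" using fR R.mem_frac f by auto
  obtain g where g: "g \<in> M (inv\<^bsub>Z\<^esub> \<chi>)" "g \<noteq> 0" using Zet_nonzero(2)[OF \<chi>] by blast
  have gR: "g \<in> R" using g by (simp add: M_iff)
  have fg: "f * g \<in> S" "f * g \<noteq> 0"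
    using M_inverse_mult[OF f(1) g(1) Z_inv_mult[OF Zet_Z[OF \<chi>]]] f g by auto
  show "v P f = 0" if P: "P \<in> Ht1 R" "P \<inter> S = {0}" for P
    using v_zero_of_contract_zero[OF P S.mem_frac[OF fg(1)] fg(2)] R.v_mult[OF P(1) fF R.mem_frac[OF gR] g(2)]
      R.v_nonneg[OF P(1) fR f(2)] R.v_nonneg[OF P(1) gR g(2)] by simp
  show "int (e P q) dvd v P f" if q: "q \<in> Ht1 S" and P: "P \<in> Over q" for q P
  proof -
    have PH: "P \<in> Ht1 R" "P \<inter> S = q" using P by (simp_all add: Over_iff)
    then have "P \<in> Ht1_over R S 1" using q by (simp add: Ht1_over_1_iff)
    then obtain f0 where f0: "f0 \<in> M \<chi>" "f0 \<noteq> 0" "[v P f0 = 0] (mod int (e P q))"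
      using \<chi> PH(2) by (auto simp: Z1_e_def)
    then have f0R: "f0 \<in> R" by (simp add: M_iff)
    have k: "f0 / f \<in> K" "f0 / f \<noteq> 0"
      using f0 f M_Zet[OF \<chi> f] by (auto simp: Msat_def)
    have "v P f0 - v P f = int (e P q) * w q (f0 / f)"
      using ram_index(2)[OF q P k] R.v_divide[OF PH(1) R.mem_frac[OF f0R] f0(2) fF] by simp
    then have "int (e P q) dvd v P f0 - v P f" by simp
    moreover have "int (e P q) dvd v P f0" using f0(3) by (simp add: cong_0_iff)
    ultimately show ?thesis by (metis dvd_diff_commute dvd_diff diff_diff_eq2 add_diff_cancel_left')
  qed
qed

lemma Zet_ge2:
  assumes \<chi>: "\<chi> \<in> Zet" and P: "P \<in> Ht1_ge2 R S"
  shows "\<exists>f'\<in>M \<chi>. f' \<notin> P" "\<exists>g\<in>M (inv\<^bsub>Z\<^esub> \<chi>). g \<notin> P"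
  using assms by (auto simp: Z1_tilde_iff)

lemma Dchi_eq:
  assumes f: "good f" "f \<in> M \<chi>" and M: "M \<chi> = Msat f"
  shows "Dchi G act R \<chi> = Dmin f"
  unfolding Dchi_def
proof (rule the_equality)
  have "f \<in> R" using f by (simp add: M_iff)
  then show "minimal_effective R S (Dmin f) \<and>
      (\<exists>x\<in>M \<chi>. x \<noteq> 0 \<and> effective (pdiv R x - Dmin f) \<and> pdiv R x - Dmin f \<in> Estar R S)"
    using minimal_effective_Dmin[OF f(1)] effective_pdiv_minus_Dmin[OF f(1)] pdiv_minus_Dmin[OF f(1)]
      good_Fr(2)[OF f(1)] f(2) by blast
  show "D = Dmin f" if "minimal_effective R S D \<and>
      (\<exists>x\<in>M \<chi>. x \<noteq> 0 \<and> effective (pdiv R x - D) \<and> pdiv R x - D \<in> Estar R S)" for D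
    using that Dmin_unique_Msat[OF f(1)] M by blast
qed

context
  fixes \<chi> f
  assumes \<chi>: "\<chi> \<in> Zet" and f: "f \<in> M \<chi>" "f \<noteq> 0"
begin

lemma fR: "f \<in> R"
  using f by (simp add: M_iff)

lemma Dchi_Zet: "Dchi G act R \<chi> = Dmin f"
  by (rule Dchi_eq[OF Zet_good[OF \<chi> f] f(1) M_Zet[OF \<chi> f]])

lemma module_class_Zet: "module_class S (M \<chi>) = div_class S (- Cdiv f)"
proof -
  obtain g where g: "g \<in> M (inv\<^bsub>Z\<^esub> \<chi>)" "g \<noteq> 0" using Zet_nonzero(2)[OF \<chi>] by blast
  have "f * g \<in> S" by (rule M_inverse_mult[OF f(1) g(1) Z_inv_mult[OF Zet_Z[OF \<chi>]]])
  moreover have "g \<in> R" using g by (simp add: M_iff)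
  ultimately show ?thesis
    unfolding M_Zet[OF \<chi> f] using module_class_Msat[OF Zet_good[OF \<chi> f] fR _ _ g(2)] by blast
qed

lemma module_class_pow_iff:
  assumes m: "0 < m"
  shows "module_class S (M \<chi>) [^]\<^bsub>Cl S\<^esub> m = \<one>\<^bsub>Cl S\<^esub> \<longleftrightarrow>
    (\<exists>y\<in>Msat (f ^ m). y \<noteq> 0 \<and> pdiv R y = frag_cmul (int m) (Dmin f))"
proof -
  let ?C = "frag_cmul (int m) (Cdiv f)"
  note good = Zet_good[OF \<chi> f]
  have C: "- Cdiv f \<in> carrier (Div S)" "- ?C \<in> carrier (Div S)" "?C \<in> carrier (Div S)"
    using Cdiv_Div[OF good] keys_cmul[of _ "Cdiv f"] by (auto simp del: minus_frag_cmul)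
  have eq: "frag_cmul (int m) (- Cdiv f) = - ?C"
    by (rule poly_mapping_eqI) simp
  have "module_class S (M \<chi>) [^]\<^bsub>Cl S\<^esub> m = \<one>\<^bsub>Cl S\<^esub> \<longleftrightarrow> - ?C \<in> Prin S"
    unfolding module_class_Zet S.div_class_pow[OF C(1)] eq by (rule S.div_class_eq_one_iff[OF C(2)])
  also have "\<dots> \<longleftrightarrow> ?C \<in> Prin S"
    using subgroup.m_inv_closed[OF S.Prin_subgroup, of ?C] subgroup.m_inv_closed[OF S.Prin_subgroup, of "- ?C"]
      S.Div_inv[OF C(2)] S.Div_inv[OF C(3)] by (auto simp del: minus_frag_cmul)
  also have "\<dots> \<longleftrightarrow> (\<exists>y\<in>Msat (f ^ m). y \<noteq> 0 \<and> pdiv R y = frag_cmul (int m) (Dmin f))"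
  proof (rule Cdiv_Prin_iff[OF good fR m])
    show "\<exists>f'\<in>Msat f. f' \<notin> P" if "P \<in> Ht1_ge2 R S" for P
      using Zet_ge2(1)[OF \<chi> that] M_Zet[OF \<chi> f] by simp
    show "\<exists>g\<in>R. f * g \<in> K \<and> g \<notin> P" if P: "P \<in> Ht1_ge2 R S" for P
    proof -
      obtain g where g: "g \<in> M (inv\<^bsub>Z\<^esub> \<chi>)" "g \<notin> P" using Zet_ge2(2)[OF \<chi> P] by blast
      have "f * g \<in> S" by (rule M_inverse_mult[OF f(1) g(1) Z_inv_mult[OF Zet_Z[OF \<chi>]]])
      then show ?thesis using g S.mem_frac by (auto simp: M_iff)
    qed
  qed
  finally show ?thesis .
qed

text \<open>In contrast to \<open>module_class_pow_iff\<close>, the function with the prescribed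
  divisor is now any nonzero element of the fraction field of \<open>R\<close> and not one of
  \<open>Msat (f ^ m)\<close>. Bridging this gap takes the condition on torsion classes.\<close>

lemma Dchi_pow_iff:
  "div_class R (Dchi G act R \<chi>) [^]\<^bsub>Cl R\<^esub> (m::nat) = \<one>\<^bsub>Cl R\<^esub> \<longleftrightarrow>
    (\<exists>x\<in>R.Fr. x \<noteq> 0 \<and> pdiv R x = frag_cmul (int m) (Dmin f))"
proof -
  have D: "Dmin f \<in> carrier (Div R)" by (rule Dmin_Div[OF Zet_good[OF \<chi> f]])
  then have "frag_cmul (int m) (Dmin f) \<in> carrier (Div R)"
    using keys_cmul[of "int m" "Dmin f"] by auto
  then show ?thesis
    unfolding Dchi_Zet R.div_class_pow[OF D] using R.div_class_eq_one_iff R.Prin_iff by metis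
qed

end

lemma minimal_effective_zero: "minimal_effective R S 0"
  unfolding minimal_effective_def
proof (intro conjI allI impI)
  show "0 \<in> carrier (Div R)" "effective 0" by (simp_all add: effective_def)
  fix D1 D2 :: "'k set \<Rightarrow>\<^sub>0 int"
  assume h: "D1 \<in> Estar R S \<and> effective D1 \<and> D2 \<in> carrier (Div R) \<and> effective D2 \<and> 0 = D1 + D2"
  show "D1 = 0"
  proof (rule poly_mapping_eqI)
    fix P
    have "Poly_Mapping.lookup (D1 + D2) P = 0" using h by simp
    moreover have "0 \<le> Poly_Mapping.lookup D1 P" "0 \<le> Poly_Mapping.lookup D2 P"
      using h by (simp_all add: effective_def)
    ultimately show "Poly_Mapping.lookup D1 P = Poly_Mapping.lookup 0 P"
      by (simp add: lookup_add)
  qed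
qed

text \<open>
  Let \<open>x\<close> have divisor \<open>m D(\<chi>)\<close>. As a multiple of \<open>D(\<chi>)\<close> is the divisor of a relative invariant,
  a power of \<open>x\<close> is a relative invariant up to a unit, so \<open>x\<close> is one for a cocycle \<open>\<rho>\<close>, and
  \<open>\<delta> = m \<chi> - \<rho>\<close> is torsion in cohomology with \<open>D(\<delta>) = 0\<close>.
\<close>

lemma module_class_pow_if_Dchi_pow:
  assumes tf: "\<forall>c\<in>coh' ` (Z1_down0 G act R \<inter> Zet). torsion_element H c \<longrightarrow> c = \<one>\<^bsub>H\<^esub>"
    and \<chi>: "\<chi> \<in> Zet" and m: "0 < m"
    and n: "0 < n" "module_class S (M \<chi>) [^]\<^bsub>Cl S\<^esub> (n::nat) = \<one>\<^bsub>Cl S\<^esub>"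
    and D: "div_class R (Dchi G act R \<chi>) [^]\<^bsub>Cl R\<^esub> (m::nat) = \<one>\<^bsub>Cl R\<^esub>"
  shows "module_class S (M \<chi>) [^]\<^bsub>Cl S\<^esub> m = \<one>\<^bsub>Cl S\<^esub>"
proof -
  interpret Z: comm_group Z by (rule Z_group)
  interpret coh: group_hom Z H coh' by (rule coh_group_hom)
  obtain f where f: "f \<in> M \<chi>" "f \<noteq> 0" using Zet_nonzero(1)[OF \<chi>] by blast
  obtain g where g: "g \<in> M (inv\<^bsub>Z\<^esub> \<chi>)" "g \<noteq> 0" using Zet_nonzero(2)[OF \<chi>] by blast
  have \<chi>Z: "\<chi> \<in> carrier Z" by (rule Zet_Z[OF \<chi>])
  have fR: "f \<in> R" and gR: "g \<in> R" using f g by (simp_all add: M_iff)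
  note good = Zet_good[OF \<chi> f]
  note fF = good_Fr[OF good]
  obtain x where x: "x \<in> R.Fr" "x \<noteq> 0" and xd: "pdiv R x = frag_cmul (int m) (Dmin f)"
    using D Dchi_pow_iff[OF \<chi> f] by blast
  have vx: "v P x = int m * Poly_Mapping.lookup (Dmin f) P" if "P \<in> Ht1 R" for P
  proof -
    have "Poly_Mapping.lookup (pdiv R x) P = Poly_Mapping.lookup (frag_cmul (int m) (Dmin f)) P"
      by (simp only: xd)
    then show ?thesis using that by (simp add: R.lookup_pdiv[OF x])
  qed
  have xR: "x \<in> R"
    using R.mem_if_nonneg[OF x] vx Dmin_effective[OF good] by (simp add: effective_def)
  obtain y where y: "y \<in> Msat (f ^ n)" "y \<noteq> 0" and yd: "pdiv R y = frag_cmul (int n) (Dmin f)"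
    using n module_class_pow_iff[OF \<chi> f n(1)] by blast
  have yR: "y \<in> R" using y by (simp add: Msat_def)
  have y_act: "act \<sigma> y = \<chi> \<sigma> ^ n * y" if \<sigma>: "\<sigma> \<in> carrier G" for \<sigma>
  proof -
    obtain a b where ab: "a \<in> S" "b \<in> S" "b \<noteq> 0" "y / f ^ n = a / b"
      using y unfolding Msat_def by (auto elim: S.frac_fieldE)
    then have eq: "y * b = a * f ^ n" using f by (simp add: field_simps)
    have "act \<sigma> (y * b) = act \<sigma> y * b" "act \<sigma> (a * f ^ n) = a * (\<chi> \<sigma> * f) ^ n"
      using ab yR fR f \<sigma> by (simp_all add: act_mult act_power S_iff M_iff R.power_mem)
    then have "act \<sigma> y * b = \<chi> \<sigma> ^ n * (y * b)" unfolding eq by (simp add: power_mult_distrib ac_simps)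
    then show ?thesis using ab(3) by (simp add: mult.assoc[symmetric])
  qed
  have xnF: "x ^ n \<in> R.Fr" "x ^ n \<noteq> 0" using x R.frac_power by auto
  have ymF: "y ^ m \<in> R.Fr" "y ^ m \<noteq> 0" using y(2) R.frac_power[OF R.mem_frac[OF yR]] by auto
  \<comment> \<open>Both powers have divisor \<open>n * m\<close> times \<open>Dmin f\<close>, so
    \<open>u\<close> is a unit; it measures how far \<open>x ^ n\<close> is from a relative
    invariant.\<close>
  define u where "u = x ^ n / y ^ m"
  have "v P u = 0" if P: "P \<in> Ht1 R" for P
  proof -
    have "pdiv R (x ^ n) = pdiv R (y ^ m)"
      by (simp add: R.pdiv_power x y(2) R.mem_frac yR xd yd mult.commute)
    then have "Poly_Mapping.lookup (pdiv R (x ^ n)) P = Poly_Mapping.lookup (pdiv R (y ^ m)) P" by simp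
    then show ?thesis using P R.v_divide[OF P xnF ymF] R.lookup_pdiv[OF xnF] R.lookup_pdiv[OF ymF]
      by (simp add: u_def)
  qed
  then have uU: "u \<in> U"
    using R.Unit_if_v_zero[of u] R.frac_divide[OF xnF(1) ymF(1)] xnF ymF by (simp add: u_def)
  then have u0: "u \<noteq> 0" and uR: "u \<in> R" by (simp_all add: U_iff)
  have xn: "x ^ n = u * y ^ m" using ymF by (simp add: u_def)
  \<comment> \<open>A priori the values of \<open>\<rho>\<close> are mere fractions; they turn out
    to be units because their \<open>n\<close>-th powers are.\<close>
  define \<rho> where "\<rho> = (\<lambda>\<sigma>\<in>carrier G. act \<sigma> x / x)"
  have \<rho>_act: "act \<sigma> x = \<rho> \<sigma> * x" if "\<sigma> \<in> carrier G" for \<sigma>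
    using that x by (simp add: \<rho>_def)
  have \<rho>n: "\<rho> \<sigma> ^ n = (act \<sigma> u / u) * \<chi> \<sigma> ^ (n * m)" if \<sigma>: "\<sigma> \<in> carrier G" for \<sigma>
  proof -
    have "act \<sigma> (x ^ n) = act \<sigma> u * (\<chi> \<sigma> ^ n * y) ^ m"
      unfolding xn using \<sigma> uR yR y_act[OF \<sigma>] by (simp add: act_mult act_power R.power_mem)
    then have "(\<rho> \<sigma> * x) ^ n = act \<sigma> u * (\<chi> \<sigma> ^ n * y) ^ m"
      using act_power[OF \<sigma> xR] \<rho>_act[OF \<sigma>] by simp
    then have "(\<rho> \<sigma> ^ n * u) * y ^ m = (act \<sigma> u * \<chi> \<sigma> ^ (n * m)) * y ^ m"
      by (simp add: power_mult_distrib xn power_mult[symmetric] ac_simps)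
    then have "\<rho> \<sigma> ^ n * u = act \<sigma> u * \<chi> \<sigma> ^ (n * m)"
      using mult_right_cancel[OF ymF(2)] by blast
    then show ?thesis using u0 by (simp add: field_simps)
  qed
  have \<rho>U: "\<rho> \<sigma> \<in> U" if \<sigma>: "\<sigma> \<in> carrier G" for \<sigma>
  proof (rule R.Unit_if_v_zero)
    have aR: "act \<sigma> x \<in> R" "act \<sigma> x \<noteq> 0" using act_closed[OF \<sigma> xR] act_nonzero[OF \<sigma> xR x(2)] by auto
    show \<rho>F: "\<rho> \<sigma> \<in> R.Fr" "\<rho> \<sigma> \<noteq> 0"
      using \<sigma> aR x R.frac_divide[OF R.mem_frac[OF aR(1)] x(1)] by (simp_all add: \<rho>_def)
    have "(act \<sigma> u / u) * \<chi> \<sigma> ^ (n * m) \<in> U"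
    proof -
      have "\<chi> \<sigma> ^ k \<in> U" for k
        using \<chi>Z \<sigma> by (induction k) (auto simp: U_one Z_iff intro: U_mult)
      then show ?thesis
        unfolding divide_inverse by (intro U_mult U_inverse U_act[OF \<sigma>] uU)
    qed
    then show "v P (\<rho> \<sigma>) = 0" if P: "P \<in> Ht1 R" for P
      using R.v_Unit[OF _ P] R.v_power[OF P \<rho>F, of n] \<rho>n[OF \<sigma>] n(1) by simp
  qed
  have \<rho>Z: "\<rho> \<in> carrier Z"
    unfolding Z_iff
  proof (intro conjI ballI)
    show "\<rho> \<in> extensional (carrier G)" by (simp add: \<rho>_def)
    show "\<rho> \<sigma> \<in> U" if "\<sigma> \<in> carrier G" for \<sigma> by (rule \<rho>U[OF that])
    fix \<sigma> \<tau> assume \<sigma>\<tau>: "\<sigma> \<in> carrier G" "\<tau> \<in> carrier G"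
    have "\<rho> (\<sigma> \<otimes>\<^bsub>G\<^esub> \<tau>) * x = act \<sigma> (\<rho> \<tau> * x)"
      using \<rho>_act[OF G_closed[OF \<sigma>\<tau>]] act_comp[OF \<sigma>\<tau> xR] \<rho>_act[OF \<sigma>\<tau>(2)] by simp
    also have "\<dots> = \<rho> \<sigma> * act \<sigma> (\<rho> \<tau>) * x"
      using act_mult[OF \<sigma>\<tau>(1) _ xR, of "\<rho> \<tau>"] \<rho>U[OF \<sigma>\<tau>(2)] \<rho>_act[OF \<sigma>\<tau>(1)] by (simp add: U_iff ac_simps)
    finally show "\<rho> (\<sigma> \<otimes>\<^bsub>G\<^esub> \<tau>) = \<rho> \<sigma> * act \<sigma> (\<rho> \<tau>)" using x(2) by simp
  qed
  define \<delta> where "\<delta> = \<chi> [^]\<^bsub>Z\<^esub> m \<otimes>\<^bsub>Z\<^esub> inv\<^bsub>Z\<^esub> \<rho>"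
  have \<delta>Z: "\<delta> \<in> carrier Z" unfolding \<delta>_def using \<chi>Z \<rho>Z by (intro Z.m_closed Z.nat_pow_closed Z.inv_closed)
  have \<delta>: "\<delta> \<sigma> = \<chi> \<sigma> ^ m / \<rho> \<sigma>" if "\<sigma> \<in> carrier G" for \<sigma>
    using that Z_pow[OF \<chi>Z that, of m] Z_inv[OF \<rho>Z] by (simp add: \<delta>_def divide_inverse)
  have \<delta>i: "(inv\<^bsub>Z\<^esub> \<delta>) \<sigma> = \<rho> \<sigma> * (inv\<^bsub>Z\<^esub> \<chi>) \<sigma> ^ m" if "\<sigma> \<in> carrier G" for \<sigma>
    using that \<delta>[OF that] Z_inv[OF \<delta>Z] Z_inv[OF \<chi>Z] by (simp add: field_simps)
  \<comment> \<open>Stated for every nonzero \<open>f'\<close> of \<open>M \<chi>\<close> and not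
    just \<open>f\<close>, because the element avoiding a prime of \<open>Ht1_ge2\<close> varies
    with the prime.\<close>
  have quot: "f' ^ m / x \<in> M \<delta> \<and> (\<forall>P\<in>Ht1 R. v P (f' ^ m / x) = int m * (v P f' - Poly_Mapping.lookup (Dmin f) P))"
    if f': "f' \<in> M \<chi>" "f' \<noteq> 0" for f'
  proof -
    have f'R: "f' \<in> R" using f' by (simp add: M_iff)
    note good' = Zet_good[OF \<chi> f']
    have Deq: "Dmin f = Dmin f'" using Dchi_Zet[OF \<chi> f] Dchi_Zet[OF \<chi> f'] by simp
    have f'm: "f' ^ m \<in> R.Fr" "f' ^ m \<noteq> 0" using f' R.frac_power[OF R.mem_frac[OF f'R]] by auto
    have val: "v P (f' ^ m / x) = int m * (v P f' - Poly_Mapping.lookup (Dmin f) P)" if P: "P \<in> Ht1 R" for P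
      using R.v_divide[OF P f'm x] R.v_power[OF P R.mem_frac[OF f'R] f'(2)] vx[OF P]
      by (simp add: right_diff_distrib)
    have "0 \<le> v P f' - Poly_Mapping.lookup (Dmin f) P" if P: "P \<in> Ht1 R" for P
    proof -
      have "0 \<le> Poly_Mapping.lookup (pdiv R f' - Dmin f') P"
        using effective_pdiv_minus_Dmin[OF good' f'R] by (simp add: effective_def)
      then show ?thesis using P by (simp add: Deq lookup_minus R.lookup_pdiv[OF good_Fr[OF good']])
    qed
    then have zR: "f' ^ m / x \<in> R"
      using val R.frac_divide[OF f'm(1) x(1)] f'm(2) x(2) by (intro R.mem_if_nonneg) auto
    have "act \<sigma> (f' ^ m / x) = \<delta> \<sigma> * (f' ^ m / x)" if \<sigma>: "\<sigma> \<in> carrier G" for \<sigma>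
    proof -
      have "act \<sigma> (f' ^ m / x * x) = act \<sigma> (f' ^ m / x) * (\<rho> \<sigma> * x)"
        using act_mult[OF \<sigma> zR xR] \<rho>_act[OF \<sigma>] by simp
      moreover have "act \<sigma> (f' ^ m) = \<chi> \<sigma> ^ m * f' ^ m"
        using act_power[OF \<sigma> f'R] f'(1) \<sigma> by (simp add: M_iff power_mult_distrib)
      ultimately have "act \<sigma> (f' ^ m / x) * (\<rho> \<sigma> * x) = \<chi> \<sigma> ^ m * f' ^ m" using x(2) by simp
      moreover have "(\<delta> \<sigma> * (f' ^ m / x)) * (\<rho> \<sigma> * x) = \<chi> \<sigma> ^ m * f' ^ m"
        using Z_nonzero[OF \<rho>Z \<sigma>] x(2) \<delta>[OF \<sigma>] by simp
      moreover have "\<rho> \<sigma> * x \<noteq> 0" using Z_nonzero[OF \<rho>Z \<sigma>] x(2) by simp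
      ultimately show ?thesis by (metis mult_right_cancel)
    qed
    then show ?thesis using zR val by (auto simp: M_iff)
  qed
  have prod: "x * g' ^ m \<in> M (inv\<^bsub>Z\<^esub> \<delta>)" if g': "g' \<in> M (inv\<^bsub>Z\<^esub> \<chi>)" for g'
  proof -
    have "x \<in> M \<rho>" using xR \<rho>_act by (simp add: M_iff)
    moreover have "g' ^ m \<in> M (\<lambda>\<sigma>. (inv\<^bsub>Z\<^esub> \<chi>) \<sigma> ^ m)" using g' by (intro M_power) auto
    ultimately show ?thesis by (rule M_mult) (simp add: \<delta>i)
  qed
  define z where "z = f ^ m / x"
  have z: "z \<in> M \<delta>" "z \<noteq> 0" and vz: "\<And>P. P \<in> Ht1 R \<Longrightarrow> v P z = int m * (v P f - Poly_Mapping.lookup (Dmin f) P)"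
    using quot[OF f] f(2) x(2) by (simp_all add: z_def)
  have zi: "x * g ^ m \<in> M (inv\<^bsub>Z\<^esub> \<delta>)" "x * g ^ m \<noteq> 0" using prod[OF g(1)] g(2) x(2) by auto
  have D0: "Poly_Mapping.lookup (Dmin f) P = 0" if "P \<in> Ht1_ge2 R S" for P
    using that by (simp add: lookup_Dmin[OF good] Ht1_ge2_iff)
  have zR: "z \<in> R" using z by (simp add: M_iff)
  have \<delta>_up: "\<delta> \<in> Z1_up G act R" using \<delta>Z z by (auto simp: Z1_up_def)
  have \<delta>_tilde: "\<delta> \<in> Z1_tilde G act R"
    unfolding Z1_tilde_iff
  proof (intro conjI ballI \<delta>Z)
    show "M \<delta> \<noteq> {0}" "M (inv\<^bsub>Z\<^esub> \<delta>) \<noteq> {0}" using z zi by blast+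
    fix P assume P: "P \<in> Ht1_ge2 R S"
    then have PH: "P \<in> Ht1 R" by (simp add: Ht1_ge2_iff)
    have 0: "0 \<in> P" using R.prime_ofD(2)[OF R.Ht1_prime[OF PH]] .
    obtain f' where f': "f' \<in> M \<chi>" "f' \<notin> P" using Zet_ge2(1)[OF \<chi> P] by blast
    then have f'0: "f' \<noteq> 0" and f'R: "f' \<in> R" using 0 by (auto simp: M_iff)
    have "v P f' = 0" using R.v_zero_iff[OF PH f'R f'0] f'(2) by simp
    then have "v P (f' ^ m / x) = 0" using quot[OF f'(1) f'0] PH D0[OF P] by simp
    moreover have "f' ^ m / x \<in> R" "f' ^ m / x \<noteq> 0" using quot[OF f'(1) f'0] f'0 x(2) by (auto simp: M_iff)
    ultimately have "f' ^ m / x \<notin> P" using R.v_zero_iff[OF PH] by blast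
    then show "\<not> M \<delta> \<subseteq> P" using quot[OF f'(1) f'0] by blast
    obtain g' where g': "g' \<in> M (inv\<^bsub>Z\<^esub> \<chi>)" "g' \<notin> P" using Zet_ge2(2)[OF \<chi> P] by blast
    then have g'R: "g' \<in> R" by (simp add: M_iff)
    have "v P x = 0" using vx[OF PH] D0[OF P] by simp
    then have "x \<notin> P" using R.v_zero_iff[OF PH xR x(2)] by simp
    moreover have "g' ^ m \<notin> P" using R.prime_power_mem[OF R.Ht1_prime[OF PH] g'R] g'(2) by blast
    ultimately have "x * g' ^ m \<notin> P"
      using R.prime_ofD(6)[OF R.Ht1_prime[OF PH] xR R.power_mem[OF g'R]] by blast
    then show "\<not> M (inv\<^bsub>Z\<^esub> \<delta>) \<subseteq> P" using prod[OF g'(1)] by blast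
  qed
  have \<delta>_e: "\<delta> \<in> Z1_e G act R"
    unfolding Z1_e_def
  proof (intro CollectI conjI ballI \<delta>_up)
    fix P assume "P \<in> Ht1_over R S 1"
    then have P: "P \<in> Ht1 R" "P \<inter> S \<in> Ht1 S" by (simp_all add: Ht1_over_1_iff)
    have "v P z = int (e P (P \<inter> S)) * (int m * coef (P \<inter> S) f)"
      using vz[OF P(1)] P by (simp add: lookup_Dmin[OF good])
    then show "\<exists>f\<in>M \<delta>. f \<noteq> 0 \<and> [v P f = 0] (mod int (e P (P \<inter> S)))"
      using z by (intro bexI[of _ z]) (simp_all add: cong_0_iff)
  qed
  have \<delta>_Zet: "\<delta> \<in> Zet" using \<delta>_e \<delta>_tilde by simp
  have M\<delta>: "M \<delta> = Msat z" by (rule M_Zet[OF \<delta>_Zet z])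
  have rank: "rank_one S (M \<delta>)"
  proof (rule S.rank_oneI[OF z])
    show "a / z \<in> K" if "a \<in> M \<delta>" for a using that unfolding M\<delta> Msat_def by simp
    show "a + b \<in> M \<delta>" if "a \<in> M \<delta>" "b \<in> M \<delta>" for a b
      using that by (simp add: M_iff R.add_mem act_add distrib_left)
    show "a * b \<in> M \<delta>" if "a \<in> S" "b \<in> M \<delta>" for a b
      using that by (simp add: M_iff S_iff R.mult_mem act_mult ac_simps)
  qed
  have "pdiv R z = frag_cmul (int m) (pdiv R f - Dmin f)"
    using vz by (intro poly_mapping_eqI)
      (simp add: R.lookup_pdiv[OF R.mem_frac[OF zR] z(2)] lookup_minus R.lookup_pdiv[OF fF] lookup_Dmin[OF good])
  then have "pdiv R z - 0 \<in> Estar R S"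
    using free_Abelian_subgroup_cmul[OF Estar_subgroup[unfolded Div_def] pdiv_minus_Dmin[OF good]] by simp
  \<comment> \<open>The zero divisor is minimal effective and differs from the divisor of
    \<open>z\<close> by an element of \<open>Estar\<close>, so uniqueness applies.\<close>
  then have "0 = Dmin z"
    by (rule minimal_effective_unique[OF Zet_good[OF \<delta>_Zet z] minimal_effective_zero])
  then have "\<delta> \<in> Z1_down0 G act R"
    using Dchi_Zet[OF \<delta>_Zet z] \<delta>_up rank by (simp add: Z1_down0_def Z1_down_def)
  moreover have "torsion_element H (coh' \<delta>)"
    unfolding torsion_element_def
  proof (intro conjI exI[of _ n] n(1))
    show "coh' \<delta> \<in> carrier H" using coh.hom_closed[OF \<delta>Z] .
    \<comment> \<open>By the formula for the \<open>n\<close>-th power of \<open>\<rho>\<close>, all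
      powers of \<chi> cancel and the coboundary of \<open>inverse u\<close> remains.\<close>
    have "\<delta> [^]\<^bsub>Z\<^esub> n = (\<lambda>\<sigma>\<in>carrier G. act \<sigma> (inverse u) / inverse u)"
    proof (rule Z_ext)
      show "\<delta> [^]\<^bsub>Z\<^esub> n \<in> carrier Z" using \<delta>Z by (rule Z.nat_pow_closed)
      show "(\<lambda>\<sigma>\<in>carrier G. act \<sigma> (inverse u) / inverse u) \<in> carrier Z" by (rule B1_Z[OF U_inverse[OF uU]])
      fix \<sigma> assume \<sigma>: "\<sigma> \<in> carrier G"
      have "(\<delta> [^]\<^bsub>Z\<^esub> n) \<sigma> = \<chi> \<sigma> ^ (n * m) / \<rho> \<sigma> ^ n"
        using Z_pow[OF \<delta>Z \<sigma>] \<delta>[OF \<sigma>] by (simp add: power_divide power_mult[symmetric] mult.commute)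
      also have "\<dots> = u / act \<sigma> u"
        unfolding \<rho>n[OF \<sigma>] using Z_nonzero[OF \<chi>Z \<sigma>] by simp
      finally show "(\<delta> [^]\<^bsub>Z\<^esub> n) \<sigma> = (\<lambda>\<sigma>\<in>carrier G. act \<sigma> (inverse u) / inverse u) \<sigma>"
        using \<sigma> act_inverse[OF \<sigma> uU] by (simp add: divide_inverse mult.commute)
    qed
    then have "\<delta> [^]\<^bsub>Z\<^esub> n \<in> B1 G act R" using U_inverse[OF uU] by (auto simp: B1_iff)
    then have "coh' (\<delta> [^]\<^bsub>Z\<^esub> n) = \<one>\<^bsub>H\<^esub>" using coh_eq_one_iff[OF Z.nat_pow_closed[OF \<delta>Z]] by blast
    then show "coh' \<delta> [^]\<^bsub>H\<^esub> n = \<one>\<^bsub>H\<^esub>" using coh.hom_nat_pow[OF \<delta>Z] by simp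
  qed
  ultimately have "coh' \<delta> = \<one>\<^bsub>H\<^esub>" using tf \<delta>_Zet by blast
  then obtain u' where u': "u' \<in> U" "\<delta> = (\<lambda>\<sigma>\<in>carrier G. act \<sigma> u' / u')"
    using coh_eq_one_iff[OF \<delta>Z] by (auto simp: B1_iff)
  have u'R: "u' \<in> R" "u' \<noteq> 0" using u' by (simp_all add: U_iff)
  \<comment> \<open>The unit \<open>u'\<close> leaves the divisor of \<open>x\<close> unchanged and
    corrects its cocycle \<open>\<rho>\<close> to the \<open>m\<close>-th power of \<chi>.\<close>
  define y' where "y' = x * u'"
  have y'R: "y' \<in> R" "y' \<noteq> 0" using xR x u'R R.mult_mem by (auto simp: y'_def)
  have y'_act: "act \<sigma> y' = \<chi> \<sigma> ^ m * y'" if \<sigma>: "\<sigma> \<in> carrier G" for \<sigma>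
  proof -
    have "act \<sigma> u' = \<delta> \<sigma> * u'" using u' u'R \<sigma> by simp
    then have "act \<sigma> y' = \<rho> \<sigma> * x * (\<delta> \<sigma> * u')"
      using act_mult[OF \<sigma> xR u'R(1)] \<rho>_act[OF \<sigma>] by (simp add: y'_def)
    then show ?thesis using \<delta>[OF \<sigma>] Z_nonzero[OF \<rho>Z \<sigma>] by (simp add: y'_def)
  qed
  have "y' * g ^ m \<in> S"
  proof (rule M_inverse_mult)
    show "y' \<in> M (\<lambda>\<sigma>. \<chi> \<sigma> ^ m)" using y'R y'_act by (simp add: M_iff)
    show "g ^ m \<in> M (\<lambda>\<sigma>. (inv\<^bsub>Z\<^esub> \<chi>) \<sigma> ^ m)" using g by (intro M_power) auto
    show "\<chi> \<sigma> ^ m * (inv\<^bsub>Z\<^esub> \<chi>) \<sigma> ^ m = 1" if "\<sigma> \<in> carrier G" for \<sigma>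
      using Z_inv_mult[OF \<chi>Z that] by (simp add: power_mult_distrib[symmetric])
  qed
  moreover have "f * g \<in> S" by (rule M_inverse_mult[OF f(1) g(1) Z_inv_mult[OF \<chi>Z]])
  ultimately have "y' * g ^ m / (f * g) ^ m \<in> K"
    using S.frac_fieldI[OF _ S.power_mem, of "y' * g ^ m" "f * g" m] f g by simp
  then have "y' \<in> Msat (f ^ m)" using y'R g by (simp add: Msat_def power_mult_distrib)
  moreover have "pdiv R y' = frag_cmul (int m) (Dmin f)"
  proof -
    have "pdiv R u' = 0"
      using R.v_Unit[OF u'(1)] R.lookup_pdiv[OF R.mem_frac[OF u'R(1)] u'R(2)] by (intro poly_mapping_eqI) simp
    then show ?thesis
      using R.pdiv_mult[OF x R.mem_frac[OF u'R(1)] u'R(2)] xd by (simp add: y'_def)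
  qed
  ultimately show ?thesis using module_class_pow_iff[OF \<chi> f m] y'R(2) by blast
qed

section \<open>Generators, finiteness and exponents\<close>

lemma module_class_closed: "\<chi> \<in> Zet \<Longrightarrow> module_class S (M \<chi>) \<in> carrier (Cl S)"
proof -
  assume \<chi>: "\<chi> \<in> Zet"
  obtain f where f: "f \<in> M \<chi>" "f \<noteq> 0" using Zet_nonzero(1)[OF \<chi>] by blast
  have "- Cdiv f \<in> carrier (Div S)" using Cdiv_Div[OF Zet_good[OF \<chi> f]] by simp
  then show ?thesis unfolding module_class_Zet[OF \<chi> f] by (rule S.div_class_closed)
qed

lemma Dchi_class_closed: "\<chi> \<in> Zet \<Longrightarrow> div_class R (Dchi G act R \<chi>) \<in> carrier (Cl R)"
proof -
  assume \<chi>: "\<chi> \<in> Zet"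
  obtain f where f: "f \<in> M \<chi>" "f \<noteq> 0" using Zet_nonzero(1)[OF \<chi>] by blast
  show ?thesis
    unfolding Dchi_Zet[OF \<chi> f] by (rule R.div_class_closed[OF Dmin_Div[OF Zet_good[OF \<chi> f]]])
qed

text \<open>Products of cocycles correspond to products of relative invariants; the induction
  carries a representing cocycle along with the product of powers.\<close>

lemma finprod_coh:
  assumes "finite L" "L \<subseteq> carrier Z" "\<And>l. l \<in> L \<Longrightarrow> f l \<in> M l"
  shows "\<exists>\<psi>\<in>carrier Z. (\<Otimes>\<^bsub>H\<^esub>l\<in>L. coh' l [^]\<^bsub>H\<^esub> (n l :: nat)) = coh' \<psi> \<and> (\<Prod>l\<in>L. f l ^ n l) \<in> M \<psi>"
  using assms
proof (induction L rule: finite_induct)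
  case empty
  interpret Z: comm_group Z by (rule Z_group)
  interpret coh: group_hom Z H coh' by (rule coh_group_hom)
  interpret H: comm_group H by (rule H_group)
  have "(\<Otimes>\<^bsub>H\<^esub>l\<in>{}. coh' l [^]\<^bsub>H\<^esub> n l) = coh' \<one>\<^bsub>Z\<^esub>"
    using H.finprod_empty coh.hom_one by (simp del: Z_simps)
  moreover have "(\<Prod>l\<in>{}. f l ^ n l) \<in> M \<one>\<^bsub>Z\<^esub>" by (simp add: M_iff act_one)
  ultimately show ?case using Z.one_closed by blast
next
  case (insert l L)
  interpret Z: comm_group Z by (rule Z_group)
  interpret H: comm_group H by (rule H_group)
  interpret coh: group_hom Z H coh' by (rule coh_group_hom)
  obtain \<psi> where \<psi>: "\<psi> \<in> carrier Z" "(\<Otimes>\<^bsub>H\<^esub>l\<in>L. coh' l [^]\<^bsub>H\<^esub> n l) = coh' \<psi>" "(\<Prod>l\<in>L. f l ^ n l) \<in> M \<psi>"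
    using insert by auto
  have lZ: "l \<in> carrier Z" "L \<subseteq> carrier Z" using insert.prems by auto
  have closed: "coh' k [^]\<^bsub>H\<^esub> n k \<in> carrier H" if "k \<in> carrier Z" for k
    using that by (intro H.nat_pow_closed coh.hom_closed)
  have "(\<Otimes>\<^bsub>H\<^esub>l\<in>insert l L. coh' l [^]\<^bsub>H\<^esub> n l) = coh' l [^]\<^bsub>H\<^esub> n l \<otimes>\<^bsub>H\<^esub> coh' \<psi>"
    unfolding \<psi>(2)[symmetric] using insert.hyps lZ closed by (intro H.finprod_insert) auto
  also have "\<dots> = coh' (l [^]\<^bsub>Z\<^esub> n l \<otimes>\<^bsub>Z\<^esub> \<psi>)"
    using coh.hom_mult[OF Z.nat_pow_closed[OF lZ(1)] \<psi>(1)] coh.hom_nat_pow[OF lZ(1)] by simp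
  finally have 1: "(\<Otimes>\<^bsub>H\<^esub>l\<in>insert l L. coh' l [^]\<^bsub>H\<^esub> n l) = coh' (l [^]\<^bsub>Z\<^esub> n l \<otimes>\<^bsub>Z\<^esub> \<psi>)" .
  have "f l ^ n l \<in> M (\<lambda>\<sigma>. l \<sigma> ^ n l)" using insert.prems by (intro M_power) auto
  then have "f l ^ n l * (\<Prod>l\<in>L. f l ^ n l) \<in> M (l [^]\<^bsub>Z\<^esub> n l \<otimes>\<^bsub>Z\<^esub> \<psi>)"
    using \<psi>(3) by (rule M_mult) (simp add: Z_pow[OF lZ(1)])
  then have 2: "(\<Prod>l\<in>insert l L. f l ^ n l) \<in> M (l [^]\<^bsub>Z\<^esub> n l \<otimes>\<^bsub>Z\<^esub> \<psi>)"
    using insert.hyps by simp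
  show ?case
    using 1 2 Z.m_closed[OF Z.nat_pow_closed[OF lZ(1)] \<psi>(1)] by blast
qed

text \<open>The natural number exponents keep the product of powers of the fixed \<open>f l\<close>
  inside \<open>R\<close>, and a unit moves it into the module of \<chi>. For the resulting
  \<open>F\<close>, \<open>coef q F\<close> can be nonzero only if \<open>q\<close> lies below a
  zero of some \<open>f l\<close>, and these \<open>q\<close> form a finite set independent of
  \<chi>.\<close>

lemma Zet_classes_finitely_generated:
  assumes \<Lambda>: "finite \<Lambda>" "\<Lambda> \<subseteq> Z1_up G act R"
    and gen: "coh' ` Zet \<subseteq> {\<Otimes>\<^bsub>H\<^esub>l\<in>\<Lambda>. coh' l [^]\<^bsub>H\<^esub> n l | n :: ('g \<Rightarrow> 'k) \<Rightarrow> nat. True}"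
  shows "\<exists>Y. finite Y \<and> Y \<subseteq> carrier (Cl S) \<and> (\<forall>\<chi>\<in>Zet. module_class S (M \<chi>) \<in> generate (Cl S) Y)"
proof -
  interpret d: group_hom "Div S" "Cl S" "div_class S"
    using S.Div_group S.Cl_group S.div_class_hom
    by (simp add: group_hom_def group_hom_axioms_def comm_group_def)
  have "\<exists>f. f \<in> M l \<and> f \<noteq> 0" if "l \<in> \<Lambda>" for l
    using that \<Lambda>(2) zero_M[of l] by (auto simp: Z1_up_def)
  then obtain f where f: "\<And>l. l \<in> \<Lambda> \<Longrightarrow> f l \<in> M l \<and> f l \<noteq> 0" by metis
  have fR: "f l \<in> R" if "l \<in> \<Lambda>" for l using f[OF that] by (simp add: M_iff)
  have \<Lambda>Z: "\<Lambda> \<subseteq> carrier Z" using \<Lambda>(2) by (auto simp: Z1_up_def)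
  define Q where "Q = (\<lambda>P. P \<inter> S) ` (\<Union>l\<in>\<Lambda>. {P \<in> Ht1 R. v P (f l) \<noteq> 0}) \<inter> Ht1 S"
  have "finite {P \<in> Ht1 R. v P (f l) \<noteq> 0}" if "l \<in> \<Lambda>" for l
    using R.finite_support[OF R.mem_frac[OF fR[OF that]]] f[OF that] by blast
  then have Q: "finite Q" using \<Lambda>(1) by (simp add: Q_def)
  have QD: "frag_of ` Q \<subseteq> carrier (Div S)" by (auto simp: Q_def)
  have "module_class S (M \<chi>) \<in> generate (Cl S) (div_class S ` frag_of ` Q)" if \<chi>: "\<chi> \<in> Zet" for \<chi>
  proof -
    have \<chi>Z: "\<chi> \<in> carrier Z" by (rule Zet_Z[OF \<chi>])
    obtain n :: "('g \<Rightarrow> 'k) \<Rightarrow> nat" where n: "coh' \<chi> = (\<Otimes>\<^bsub>H\<^esub>l\<in>\<Lambda>. coh' l [^]\<^bsub>H\<^esub> n l)"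
      using gen \<chi> by blast
    obtain \<psi> where \<psi>: "\<psi> \<in> carrier Z" "coh' \<chi> = coh' \<psi>" "(\<Prod>l\<in>\<Lambda>. f l ^ n l) \<in> M \<psi>"
      using finprod_coh[OF \<Lambda>(1) \<Lambda>Z, of f n] f n by auto
    obtain u where u: "u \<in> U" "\<forall>\<sigma>\<in>carrier G. \<chi> \<sigma> = act \<sigma> u / u * \<psi> \<sigma>"
      using coh_eqD[OF \<chi>Z \<psi>(1,2)] by blast
    define F where "F = u * (\<Prod>l\<in>\<Lambda>. f l ^ n l)"
    have F: "F \<in> M \<chi>" unfolding F_def using u \<psi>(3) by (intro M_cohomologous) auto
    have F0: "F \<noteq> 0" using u f \<Lambda>(1) by (simp add: F_def U_iff)
    note good = Zet_good[OF \<chi> F F0]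
    have "q \<in> Q" if q: "q \<in> Poly_Mapping.keys (Cdiv F)" for q
    proof -
      have qH: "q \<in> Ht1 S" "coef q F \<noteq> 0"
        using q by (auto simp: in_keys_iff lookup_Cdiv[OF good] split: if_splits)
      obtain P where P: "P \<in> Over q" "v P F = int (e P q) * coef q F"
        using coef_attained[OF good qH(1)] by blast
      then have vF: "v P F \<noteq> 0" using ram_index(1)[OF qH(1) P(1)] qH(2) by simp
      have PH: "P \<in> Ht1 R" "P \<inter> S = q" using P by (simp_all add: Over_iff)
      have pr: "f l ^ n l \<in> R \<and> f l ^ n l \<noteq> 0" if "l \<in> \<Lambda>" for l
        using f[OF that] fR[OF that] R.power_mem by simp
      have "(\<Prod>l\<in>\<Lambda>. f l ^ n l) \<in> R.Fr" using R.prod_mem[of \<Lambda> "\<lambda>l. f l ^ n l"] pr R.mem_frac by blast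
      moreover have "(\<Prod>l\<in>\<Lambda>. f l ^ n l) \<noteq> 0" using pr \<Lambda>(1) by simp
      ultimately have "v P F = v P u + (\<Sum>l\<in>\<Lambda>. v P (f l ^ n l))"
        unfolding F_def using R.v_prod[OF PH(1) pr] R.v_mult[OF PH(1), of u] u(1) R.mem_frac
        by (simp add: U_iff)
      then have "(\<Sum>l\<in>\<Lambda>. v P (f l ^ n l)) \<noteq> 0" using R.v_Unit[OF u(1) PH(1)] vF by simp
      then obtain l where l: "l \<in> \<Lambda>" "v P (f l ^ n l) \<noteq> 0" by (meson sum.neutral)
      then have "v P (f l) \<noteq> 0" using R.v_power[OF PH(1) R.mem_frac[OF fR]] f by auto
      then show ?thesis using l(1) PH qH(1) by (auto simp: Q_def)
    qed
    then have keys: "Poly_Mapping.keys (Cdiv F) \<subseteq> Q" by blast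
    have sub: "subgroup (generate (Div S) (frag_of ` Q)) (free_Abelian_group (Ht1 S))"
      using d.G.generate_is_subgroup[OF QD] by (simp add: Div_def)
    have "frag_cmul (- Poly_Mapping.lookup (Cdiv F) q) (frag_of q) \<in> generate (Div S) (frag_of ` Q)"
      if "q \<in> Poly_Mapping.keys (Cdiv F)" for q
      using that keys by (intro free_Abelian_subgroup_cmul[OF sub] generate.incl) auto
    then have "(\<Sum>q\<in>Poly_Mapping.keys (Cdiv F). frag_cmul (- Poly_Mapping.lookup (Cdiv F) q) (frag_of q))
        \<in> generate (Div S) (frag_of ` Q)"
      by (rule free_Abelian_subgroup_sum[OF sub])
    moreover have "(\<Sum>q\<in>Poly_Mapping.keys (Cdiv F). frag_cmul (- Poly_Mapping.lookup (Cdiv F) q) (frag_of q))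
        = - Cdiv F"
    proof (rule poly_mapping_eqI)
      fix q
      have "Poly_Mapping.lookup (\<Sum>q\<in>Poly_Mapping.keys (Cdiv F).
          frag_cmul (- Poly_Mapping.lookup (Cdiv F) q) (frag_of q)) q =
        (\<Sum>p\<in>Poly_Mapping.keys (Cdiv F). if q = p then - Poly_Mapping.lookup (Cdiv F) p else 0)"
        unfolding lookup_sum by (rule sum.cong) auto
      then show "Poly_Mapping.lookup (\<Sum>q\<in>Poly_Mapping.keys (Cdiv F).
          frag_cmul (- Poly_Mapping.lookup (Cdiv F) q) (frag_of q)) q = Poly_Mapping.lookup (- Cdiv F) q"
        by (simp add: in_keys_iff)
    qed
    ultimately have "div_class S (- Cdiv F) \<in> div_class S ` generate (Div S) (frag_of ` Q)" by simp
    then show ?thesis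
      unfolding module_class_Zet[OF \<chi> F F0] d.generate_img[OF QD] .
  qed
  moreover have "div_class S ` frag_of ` Q \<subseteq> carrier (Cl S)" using QD d.hom_closed by blast
  moreover have "finite (div_class S ` frag_of ` Q)" using Q by simp
  ultimately show ?thesis by blast
qed

text \<open>A torsion group inside a finitely generated abelian group is finite; the finitely
  generated group is the one produced by \<open>Zet_classes_finitely_generated\<close>, not all of
  \<open>Cl S\<close>.\<close>

lemma finite_Cl_tilde:
  assumes \<Lambda>: "finite \<Lambda>" "\<Lambda> \<subseteq> Z1_up G act R"
    and gen: "coh' ` Zet \<subseteq> {\<Otimes>\<^bsub>H\<^esub>l\<in>\<Lambda>. coh' l [^]\<^bsub>H\<^esub> n l | n :: ('g \<Rightarrow> 'k) \<Rightarrow> nat. True}"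
    and tors: "torsion_group (Cl_tilde G act R)"
  shows "finite (carrier (Cl_tilde G act R))"
proof -
  interpret C: comm_group "Cl S" by (rule S.Cl_group)
  let ?B = "(\<lambda>\<chi>. module_class S (M \<chi>)) ` Zet"
  obtain Y where Y: "finite Y" "Y \<subseteq> carrier (Cl S)" "\<forall>\<chi>\<in>Zet. module_class S (M \<chi>) \<in> generate (Cl S) Y"
    using Zet_classes_finitely_generated[OF \<Lambda> gen] by blast
  have B: "?B \<subseteq> carrier (Cl S)" using module_class_closed by blast
  have car: "carrier (Cl_tilde G act R) = generate (Cl S) ?B"
    unfolding Cl_tilde_def carrier_subgroup_generated using B by (simp add: Int_absorb1)
  have "generate (Cl S) ?B \<subseteq> generate (Cl S) Y"
    using Y(3) by (intro C.generate_subgroup_incl C.generate_is_subgroup Y(2)) blast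
  moreover have "\<exists>n::nat. 0 < n \<and> h [^]\<^bsub>Cl S\<^esub> n = \<one>\<^bsub>Cl S\<^esub>" if "h \<in> generate (Cl S) ?B" for h
    using tors that unfolding torsion_group_def torsion_element_def car
    by (simp add: Cl_tilde_def pow_subgroup_generated)
  ultimately show ?thesis
    unfolding car by (rule C.finite_torsion_subgroup[OF Y(1,2) C.generate_is_subgroup[OF B]])
qed

lemma finite_group_exponent:
  assumes fin: "finite (carrier (Cl_tilde G act R))"
  shows "\<exists>m>0. \<forall>x\<in>carrier (Cl_tilde G act R). x [^]\<^bsub>Cl_tilde G act R\<^esub> (m::nat) = \<one>\<^bsub>Cl_tilde G act R\<^esub>"
proof -
  interpret C: comm_group "Cl S" by (rule S.Cl_group)
  interpret T: group "Cl_tilde G act R"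
    unfolding Cl_tilde_def by (rule C.group_subgroup_generated)
  show ?thesis using fin T.order_gt_0_iff_finite T.pow_order_eq_1 by blast
qed

text \<open>An integer kills a commutative group exactly when it kills the generators, and both
  groups have generators indexed by \<open>Zet\<close>; so it is enough that the two classes of each
  single \<chi> are killed by the same positive integers. The torsion assumption provides the
  multiple \<open>n\<close> on which the harder direction relies.\<close>

lemma exponents_eq:
  assumes tors: "torsion_group (Cl_tilde G act R)"
    and tf: "\<forall>c\<in>coh' ` (Z1_down0 G act R \<inter> Zet). torsion_element H c \<longrightarrow> c = \<one>\<^bsub>H\<^esub>"
  shows "group_exponent (UrCl G act R) = group_exponent (Cl_tilde G act R)"
proof -
  interpret CS: comm_group "Cl S" by (rule S.Cl_group)
  interpret CR: comm_group "Cl R" by (rule R.Cl_group)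
  let ?B = "(\<lambda>\<chi>. module_class S (M \<chi>)) ` Zet"
  let ?B' = "(\<lambda>\<chi>. div_class R (Dchi G act R \<chi>)) ` Zet"
  have B: "?B \<subseteq> carrier (Cl S)" "?B' \<subseteq> carrier (Cl R)" using module_class_closed Dchi_class_closed by blast+
  have tor: "\<exists>n::nat. 0 < n \<and> module_class S (M \<chi>) [^]\<^bsub>Cl S\<^esub> n = \<one>\<^bsub>Cl S\<^esub>" if \<chi>: "\<chi> \<in> Zet" for \<chi>
  proof -
    have "module_class S (M \<chi>) \<in> carrier (Cl_tilde G act R)"
      unfolding Cl_tilde_def carrier_subgroup_generated using B \<chi> by (intro generate.incl) blast
    then show ?thesis
      using tors unfolding torsion_group_def torsion_element_def
      by (simp add: Cl_tilde_def pow_subgroup_generated)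
  qed
  have iff: "module_class S (M \<chi>) [^]\<^bsub>Cl S\<^esub> m = \<one>\<^bsub>Cl S\<^esub> \<longleftrightarrow>
      div_class R (Dchi G act R \<chi>) [^]\<^bsub>Cl R\<^esub> m = \<one>\<^bsub>Cl R\<^esub>"
    if \<chi>: "\<chi> \<in> Zet" and m: "0 < m" for \<chi> and m :: nat
  proof
    assume l: "module_class S (M \<chi>) [^]\<^bsub>Cl S\<^esub> m = \<one>\<^bsub>Cl S\<^esub>"
    obtain f where f: "f \<in> M \<chi>" "f \<noteq> 0" using Zet_nonzero(1)[OF \<chi>] by blast
    obtain y where "y \<in> Msat (f ^ m)" "y \<noteq> 0" "pdiv R y = frag_cmul (int m) (Dmin f)"
      using l module_class_pow_iff[OF \<chi> f m] by blast
    then show "div_class R (Dchi G act R \<chi>) [^]\<^bsub>Cl R\<^esub> m = \<one>\<^bsub>Cl R\<^esub>"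
      unfolding Dchi_pow_iff[OF \<chi> f] Msat_def using R.mem_frac by blast
  next
    assume "div_class R (Dchi G act R \<chi>) [^]\<^bsub>Cl R\<^esub> m = \<one>\<^bsub>Cl R\<^esub>"
    then show "module_class S (M \<chi>) [^]\<^bsub>Cl S\<^esub> m = \<one>\<^bsub>Cl S\<^esub>"
      using module_class_pow_if_Dchi_pow[OF tf \<chi> m] tor[OF \<chi>] by blast
  qed
  have "{enat n | n. 0 < n \<and> (\<forall>b\<in>?B'. b [^]\<^bsub>Cl R\<^esub> n = \<one>\<^bsub>Cl R\<^esub>)} =
      {enat n | n. 0 < n \<and> (\<forall>b\<in>?B. b [^]\<^bsub>Cl S\<^esub> n = \<one>\<^bsub>Cl S\<^esub>)}"
    using iff by blast
  then show ?thesis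
    unfolding UrCl_def Cl_tilde_def CS.group_exponent_generated[OF B(1)] CR.group_exponent_generated[OF B(2)]
    by (rule arg_cong)
qed

end

theorem theorem3p15:
  fixes R :: "'k::field set"
    and G :: "('g, 'm) monoid_scheme"
    and act :: "'g \<Rightarrow> 'k \<Rightarrow> 'k"
    and \<Lambda> :: "('g \<Rightarrow> 'k) set"
  assumes "krull_domain R"
    and "ring_action G act R"
    and "finite \<Lambda>" and "\<Lambda> \<noteq> {}" and "\<Lambda> \<subseteq> Z1_up G act R"
    and "coh G act R ` (Z1_e G act R \<inter> Z1_tilde G act R) \<subseteq>
         {\<Otimes>\<^bsub>H1 G act R\<^esub>l\<in>\<Lambda>. coh G act R l [^]\<^bsub>H1 G act R\<^esub> n l | n :: ('g \<Rightarrow> 'k) \<Rightarrow> nat. True}"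
    and "torsion_group (Cl_tilde G act R)"
  shows "finite (carrier (Cl_tilde G act R)) \<and>
    ((\<forall>c \<in> coh G act R ` (Z1_down0 G act R \<inter> Z1_e G act R \<inter> Z1_tilde G act R).
        torsion_element (H1 G act R) c \<longrightarrow> c = \<one>\<^bsub>H1 G act R\<^esub>) \<longrightarrow>
     group_exponent (UrCl G act R) = group_exponent (Cl_tilde G act R) \<and>
     group_exponent (Cl_tilde G act R) < \<infinity>)"
proof -
  interpret krull_action R G act using assms(1,2) by (rule krull_action.intro)
  have fin: "finite (carrier (Cl_tilde G act R))"
    by (rule finite_Cl_tilde[OF assms(3,5,6,7)])
  obtain m :: nat where "0 < m" "\<forall>x\<in>carrier (Cl_tilde G act R). x [^]\<^bsub>Cl_tilde G act R\<^esub> m = \<one>\<^bsub>Cl_tilde G act R\<^esub>"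
    using finite_group_exponent[OF fin] by blast
  then have "group_exponent (Cl_tilde G act R) \<le> enat m"
    unfolding group_exponent_def by (intro Inf_lower) blast
  then have "group_exponent (Cl_tilde G act R) < \<infinity>"
    by (rule order.strict_trans1) simp
  then show ?thesis
    using fin exponents_eq[OF assms(7)] by (simp add: Int_assoc)
qed

end
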